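(* Let $N,n$ be positive integers and let $\lambda=(\lambda_1\ge\dots\ge\lambda_N\ge 0)$ be a partition of $n$ with at most $N$ parts. Then the map $\iota^*:\mathcal{O}_{\mathcal W}\to\mathcal{O}_{\mathcal C}$ (pull-back of functions along $\iota:\mathcal{C}\to\mathcal{W}$), $B^{\mathcal W}_{ij}\mapsto B^{\mathcal T}_{ij}|_{\mathcal C}$ for $i=1,\dots,N$, $j\ge i$, is an isomorphism of graded algebras. In particular, the elements $B^{\mathcal T}_{ij}|_{\mathcal C}$ generate $\mathcal{O}_{\mathcal C}$.
   Context: The cell $\mathcal W$: let $d$ be an integer with $\lambda_1\le d-N$, $d_i=\lambda_i+N-i$, $P=\{d_1>\dots>d_N\}$. $\mathcal{W}$ is the set of $N$-dimensional subspaces $X$ of the space of polynomials in $\mathbb{C}[u]$ of degree less than $d$ such that for each $i$, $X$ contains a polynomial of degree $d_i$. Each $X\in\mathcal W$ has a unique basis (the flag basis) $f_i(u)=u^{d_i}+\sum_{1\le j\le d_i,\ d_i-j\notin P}f_{ij}u^{d_i-j}$, $i=1,\dots,N$, and $\mathcal W$ is an affine space of dimension $n$ with coordinates $f_{ij}$. $\mathcal{O}_{\mathcal W}=\mathbb{C}[f_{ij}]$, graded by $\deg f_{ij}=j$. With $\mathrm{Wr}(g_1,\dots,g_N)=\det(g_i^{(j-1)})_{i,j=1}^N$ and the row determinant $\mathrm{rdet}A=\sum_\sigma(-1)^\sigma a_{1\sigma(1)}a_{2\sigma(2)}\cdots$, and $\partial=d/du$, set $\mathcal{D}^{\mathcal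 W}=\frac1{\mathrm{Wr}(f_1,\dots,f_N)}\mathrm{rdet}$ of the $(N+1)\times(N+1)$ matrix whose $i$-th row is $(f_i,f_i',\dots,f_i^{(N)})$ for $i\le N$ and whose last row is $(1,\partial,\dots,\partial^N)$. Then $\mathcal{D}^{\mathcal W}=\partial^N+\sum_{i=1}^N B^{\mathcal W}_i(u)\partial^{N-i}$, $B^{\mathcal W}_i(u)=\sum_{j\ge i}B^{\mathcal W}_{ij}u^{-j}$ with $B^{\mathcal W}_{ij}\in\mathcal{O}_{\mathcal W}$ homogeneous of degree $j-i$ (expansion at $u=\infty$). It is known that the $B^{\mathcal W}_{ij}$ generate $\mathcal{O}_{\mathcal W}$. The quotient critical set $\mathcal C$: $l_a=\sum_{b=a+1}^N\lambda_b$ for $a=0,\dots,N$ (so $l_0=n$, $l_N=0$), $l=l_0+\dots+l_{N-1}$. $T=(t^{(a)}_i)_{0\le a\le N-1,\,1\le i\le l_a}$ are coordinates on $\mathbb{C}^l_T=\mathbb{C}^l$, $t^0=(t^{(0)}_1,\dots,t^{(0)}_n)$, $t=(t^{(a)}_i)_{a\ge1}$. The master function is $\Phi(T)=\prod_{a=1}^{N-1}\prod_{i<j}(t^{(a)}_i-t^{(a)}_j)^2\prod_{a=0}^{N-2}\prod_{i=1}^{l_a}\prod_{j=1}^{l_{a+1}}(t^{(a)}_i-t^{(a+1)}_j)^{-1}$. A point $T=(t^0,t)$ is a critical point of $\log\Phi(t^0,\cdot)$ if for all $a=1,\dots,N-1$, $i=1,\dots,l_a$: $\sum_{j=1}^{l_{a-1}}\frac1{t^{(a)}_i-t^{(a-1)}_j}-\sum_{j\ne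 i}\frac2{t^{(a)}_i-t^{(a)}_j}+\sum_{j=1}^{l_{a+1}}\frac1{t^{(a)}_i-t^{(a+1)}_j}=0$, with all denominators nonzero. $\tilde C\subset\mathbb{C}^l_T$ is the union of all critical points of $\log\Phi(t^0,\cdot)$ over all $t^0$ with distinct coordinates, and $C$ is its Zariski closure. $S_l=S_{l_0}\times\dots\times S_{l_{N-1}}$ permutes coordinates with the same upper index; $\mathbb{C}^l_\Sigma=\mathbb{C}^l_T/S_l$ is the affine space with coordinates $\Sigma=(\sigma^{(a)}_i)$, the elementary symmetric functions of $t^{(a)}_1,\dots,t^{(a)}_{l_a}$, $a=0,\dots,N-1$; $\mathbb{C}[\Sigma]=\mathbb{C}[T]^{S_l}$ is graded by $\deg\sigma^{(a)}_i=i$. $\mathcal{C}\subset\mathbb{C}^l_\Sigma$ is the image of $C$; $\mathcal{O}_{\mathcal C}$ is the restriction of $\mathbb{C}[\Sigma]$ to $\mathcal C$, graded by $\deg(\sigma^{(a)}_i|_{\mathcal C})=i$. The operator $\mathcal{D}^{\mathcal T}$ and the map $\iota$: $\chi^a(u,T)=\sum_{j=1}^{l_{a-1}}\frac1{u-t^{(a-1)}_j}-\sum_{j=1}^{l_a}\frac1{u-t^{(a)}_j}$, $a=1,\dots,N$; $\mathcal{D}^{\mathcal T}=(\partial-\chi^1(u,T))\cdots(\partial-\chi^N(u,T))=\partial^N+\sum_{i=1}^N B^{\mathcal T}_i(u)\partial^{N-i}$, $B^{\mathcal T}_i(u)=\sum_{j\ge i}B^{\mathcal T}_{ij}u^{-j}$,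 $B^{\mathcal T}_{ij}\in\mathbb{C}[\Sigma]$. If $T$ is a critical point of $\log\Phi(t^0,\cdot)$, it is known that the kernel $X_T$ of the specialization of $\mathcal{D}^{\mathcal T}$ at $T$ consists of polynomials and is a point of $\mathcal W$; $T\mapsto X_T$ defines a rational map $\iota:\mathcal C\to\mathcal W$ (which is in fact regular). *)

theory Defs
  imports
    "HOL-Library.Poly_Mapping"
    "HOL-Computational_Algebra.Formal_Laurent_Series"
    "HOL-Algebra.Generated_Rings"
    "HOL-Algebra.Module"
    "Jordan_Normal_Form.Determinant"
begin

section \<open>Polynomial functions on sets of points with coordinates\<close>

text \<open>A polynomial with complex coefficients in variables of type \<open>'v\<close> is a finitely supported
  map from exponent vectors to coefficients.\<close>

type_synonym 'v mpolynomial = "('v \<Rightarrow>\<^sub>0 nat) \<Rightarrow>\<^sub>0 complex"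

definition mpoly_eval :: "'v mpolynomial \<Rightarrow> ('v \<Rightarrow> complex) \<Rightarrow> complex" where
  "mpoly_eval q x =
     (\<Sum>m\<in>Poly_Mapping.keys q. poly_mapping.lookup q m *
        (\<Prod>v\<in>Poly_Mapping.keys m. x v ^ poly_mapping.lookup m v))"

definition mpolys :: "'v set \<Rightarrow> 'v mpolynomial set" where
  "mpolys I = {q. \<forall>m\<in>Poly_Mapping.keys q. Poly_Mapping.keys m \<subseteq> I}"

definition mpolys_homogeneous :: "'v set \<Rightarrow> ('v \<Rightarrow> nat) \<Rightarrow> nat \<Rightarrow> 'v mpolynomial set" where
  "mpolys_homogeneous I w k =
     {q \<in> mpolys I. \<forall>m\<in>Poly_Mapping.keys q.
        (\<Sum>v\<in>Poly_Mapping.keys m. w v * poly_mapping.lookup m v) = k}"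

definition affine_points :: "'v set \<Rightarrow> ('v \<Rightarrow> complex) set" where
  "affine_points I = (I \<rightarrow>\<^sub>E UNIV)"

definition zariski_closure :: "'v set \<Rightarrow> ('v \<Rightarrow> complex) set \<Rightarrow> ('v \<Rightarrow> complex) set" where
  "zariski_closure I S =
     {x \<in> affine_points I.
        \<forall>q\<in>mpolys I. (\<forall>s\<in>S. mpoly_eval q s = 0) \<longrightarrow> mpoly_eval q x = 0}"

text \<open>The restrictions to \<open>S\<close> of the polynomials \<open>q \<in> Q\<close> in the coordinates \<open>c p\<close> of the
  points \<open>p\<close> of \<open>S\<close>.  Functions on \<open>S\<close> are extensional, i.e. \<open>undefined\<close> off \<open>S\<close>.\<close>

definition poly_functions ::
  "'p set \<Rightarrow> ('p \<Rightarrow> 'v \<Rightarrow> complex) \<Rightarrow> 'v mpolynomial set \<Rightarrow> ('p \<Rightarrow> complex) set" where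
  "poly_functions S c Q = (\<lambda>q. \<lambda>p\<in>S. mpoly_eval q (c p)) ` Q"

definition function_algebra ::
  "'p set \<Rightarrow> ('p \<Rightarrow> complex) set \<Rightarrow> (complex, 'p \<Rightarrow> complex) module" where
  "function_algebra S A =
     \<lparr>carrier = A,
      mult = (\<lambda>f g. \<lambda>p\<in>S. f p * g p),
      one = (\<lambda>p\<in>S. 1),
      zero = (\<lambda>p\<in>S. 0),
      add = (\<lambda>f g. \<lambda>p\<in>S. f p + g p),
      smult = (\<lambda>a f. \<lambda>p\<in>S. a * f p)\<rparr>"

text \<open>\<open>Rk k\<close> and \<open>Sk k\<close> are the homogeneous components of degree \<open>k\<close> of \<open>R\<close> and \<open>S\<close>.\<close>

definition graded_algebra_iso ::
  "(complex, 'a) module \<Rightarrow> (nat \<Rightarrow> 'a set) \<Rightarrow> (complex, 'b) module \<Rightarrow> (nat \<Rightarrow> 'b set)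
     \<Rightarrow> ('a \<Rightarrow> 'b) \<Rightarrow> bool" where
  "graded_algebra_iso R Rk S Sk \<phi> \<longleftrightarrow>
     \<phi> \<in> ring_iso R S \<and>
     (\<forall>a. \<forall>x\<in>carrier R. \<phi> (a \<odot>\<^bsub>R\<^esub> x) = a \<odot>\<^bsub>S\<^esub> \<phi> x) \<and>
     (\<forall>k. \<phi> ` Rk k = Sk k)"

definition subalgebra_generated ::
  "(complex, 'a) module \<Rightarrow> 'a set \<Rightarrow> 'a set" where
  "subalgebra_generated R G = generate_ring R ({a \<odot>\<^bsub>R\<^esub> \<one>\<^bsub>R\<^esub> | a. True} \<union> G)"

definition pullback :: "'p set \<Rightarrow> ('p \<Rightarrow> 'q) \<Rightarrow> ('q \<Rightarrow> complex) \<Rightarrow> 'p \<Rightarrow> complex" where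
  "pullback S \<phi> g = (\<lambda>p\<in>S. g (\<phi> p))"


section \<open>Differential operators with coefficients in Laurent series at infinity\<close>

text \<open>Rational functions of \<open>u\<close> are represented by their expansions at \<open>u = \<infinity>\<close>, i.e. as Laurent
  series in \<open>fls_X = u\<^sup>-\<^sup>1\<close>.  Thus \<open>u = fls_X_inv\<close>, the coefficient of \<open>u\<^sup>-\<^sup>j\<close> in \<open>g\<close> is
  \<open>fls_nth g j\<close>, and \<open>d/du = - fls_X\<^sup>2 d/d(fls_X)\<close>.\<close>

definition poly_at_inf :: "complex poly \<Rightarrow> complex fls" where
  "poly_at_inf p = (\<Sum>k\<le>degree p. fls_const (poly.coeff p k) * fls_X_inv ^ k)"

definition du :: "complex fls \<Rightarrow> complex fls" where
  "du g = - (fls_X ^ 2 * fls_deriv g)"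

text \<open>The operator \<open>\<Sum>\<^sub>k b\<^sub>k \<partial>\<^sup>k\<close> (coefficients on the left) is represented by the polynomial with
  coefficients \<open>b\<^sub>k\<close>.  The product of operators is not the product of the type \<open>poly\<close>: it is
  determined by \<open>\<partial> b = b \<partial> + b'\<close>.\<close>

type_synonym diffop = "complex fls poly"

definition d_times :: "diffop \<Rightarrow> diffop" where
  "d_times B = map_poly du B + pCons 0 B"

definition diffop_mult :: "diffop \<Rightarrow> diffop \<Rightarrow> diffop" where
  "diffop_mult A B = (\<Sum>k\<le>degree A. Polynomial.smult (poly.coeff A k) ((d_times ^^ k) B))"

definition diffop_prod :: "diffop list \<Rightarrow> diffop" where
  "diffop_prod As = foldr diffop_mult As 1"

definition diffop_apply :: "diffop \<Rightarrow> complex fls \<Rightarrow> complex fls" where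
  "diffop_apply A g = (\<Sum>k\<le>degree A. poly.coeff A k * (du ^^ k) g)"

definition rdet :: "nat \<Rightarrow> (nat \<Rightarrow> nat \<Rightarrow> diffop) \<Rightarrow> diffop" where
  "rdet n A = (\<Sum>\<sigma> | \<sigma> permutes {1..n}.
     of_int (sign \<sigma>) * diffop_prod (map (\<lambda>i. A i (\<sigma> i)) [1..<Suc n]))"

definition wronskian :: "nat \<Rightarrow> (nat \<Rightarrow> complex fls) \<Rightarrow> complex fls" where
  "wronskian N g = det (mat N N (\<lambda>(i, j). (du ^^ j) (g (Suc i))))"


section \<open>The cell of subspaces with prescribed degrees\<close>

definition dexp :: "nat \<Rightarrow> (nat \<Rightarrow> nat) \<Rightarrow> nat \<Rightarrow> nat" where
  "dexp N lam i = lam i + N - i"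

definition exponents :: "nat \<Rightarrow> (nat \<Rightarrow> nat) \<Rightarrow> nat set" where
  "exponents N lam = dexp N lam ` {1..N}"

definition cell :: "nat \<Rightarrow> nat \<Rightarrow> (nat \<Rightarrow> nat) \<Rightarrow> complex poly set set" where
  "cell d N lam =
     {X. module.subspace Polynomial.smult X \<and>
         X \<subseteq> {p. p = 0 \<or> degree p < d} \<and>
         vector_space.dim Polynomial.smult X = N \<and>
         (\<forall>i\<in>{1..N}. \<exists>p\<in>X. p \<noteq> 0 \<and> degree p = dexp N lam i)}"

text \<open>The member \<open>f\<^sub>i\<close> of the flag basis of \<open>X\<close>.\<close>

definition flag_poly :: "nat \<Rightarrow> (nat \<Rightarrow> nat) \<Rightarrow> complex poly set \<Rightarrow> nat \<Rightarrow> complex poly" where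
  "flag_poly N lam X i =
     (THE f. f \<in> X \<and> degree f = dexp N lam i \<and> lead_coeff f = 1 \<and>
             (\<forall>k < dexp N lam i. k \<in> exponents N lam \<longrightarrow> poly.coeff f k = 0))"

definition cell_index :: "nat \<Rightarrow> (nat \<Rightarrow> nat) \<Rightarrow> (nat \<times> nat) set" where
  "cell_index N lam =
     {(i, j). i \<in> {1..N} \<and> 1 \<le> j \<and> j \<le> dexp N lam i \<and> dexp N lam i - j \<notin> exponents N lam}"

definition cell_coord :: "nat \<Rightarrow> (nat \<Rightarrow> nat) \<Rightarrow> complex poly set \<Rightarrow> nat \<times> nat \<Rightarrow> complex" where
  "cell_coord N lam X = (\<lambda>(i, j). poly.coeff (flag_poly N lam X i) (dexp N lam i - j))"

text \<open>The flag basis identifies the cell with the affine space with coordinates \<open>f\<^sub>i\<^sub>j\<close>, so the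
  polynomial ring in the \<open>f\<^sub>i\<^sub>j\<close> is taken as the algebra of polynomial functions on the cell.\<close>

definition O_W :: "nat \<Rightarrow> nat \<Rightarrow> (nat \<Rightarrow> nat) \<Rightarrow> (complex, complex poly set \<Rightarrow> complex) module" where
  "O_W d N lam = function_algebra (cell d N lam)
     (poly_functions (cell d N lam) (cell_coord N lam) (mpolys (cell_index N lam)))"

text \<open>The weight \<open>snd\<close> expresses \<open>deg f\<^sub>i\<^sub>j = j\<close>.\<close>

definition O_W_degree ::
  "nat \<Rightarrow> nat \<Rightarrow> (nat \<Rightarrow> nat) \<Rightarrow> nat \<Rightarrow> (complex poly set \<Rightarrow> complex) set" where
  "O_W_degree d N lam k = poly_functions (cell d N lam) (cell_coord N lam)
     (mpolys_homogeneous (cell_index N lam) snd k)"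

definition D_W :: "nat \<Rightarrow> (nat \<Rightarrow> nat) \<Rightarrow> complex poly set \<Rightarrow> diffop" where
  "D_W N lam X =
     (let f = (\<lambda>i. poly_at_inf (flag_poly N lam X i))
      in Polynomial.smult (inverse (wronskian N f))
           (rdet (Suc N) (\<lambda>i j. if i \<le> N then [: (du ^^ (j - 1)) (f i) :]
                                 else Polynomial.monom 1 (j - 1))))"

text \<open>The Wronskian of the flag basis is a polynomial in \<open>u\<close> whose leading coefficient is a nonzero
  constant on the cell, so that expanding at infinity commutes with specialization to \<open>X\<close>.\<close>

definition B_W :: "nat \<Rightarrow> nat \<Rightarrow> (nat \<Rightarrow> nat) \<Rightarrow> nat \<Rightarrow> nat \<Rightarrow> complex poly set \<Rightarrow> complex" where
  "B_W d N lam i j =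
     (\<lambda>X \<in> cell d N lam. fls_nth (poly.coeff (D_W N lam X) (N - i)) (int j))"


section \<open>The quotient critical set\<close>

definition num_vars :: "nat \<Rightarrow> (nat \<Rightarrow> nat) \<Rightarrow> nat \<Rightarrow> nat" where
  "num_vars N lam a = (\<Sum>b = a + 1..N. lam b)"

text \<open>The pair \<open>(a, i)\<close> is the index of \<open>t\<^sup>(\<^sup>a\<^sup>)\<^sub>i\<close>, and also of \<open>\<sigma>\<^sup>(\<^sup>a\<^sup>)\<^sub>i\<close>.\<close>

definition crit_index :: "nat \<Rightarrow> (nat \<Rightarrow> nat) \<Rightarrow> (nat \<times> nat) set" where
  "crit_index N lam = {(a, i). a < N \<and> 1 \<le> i \<and> i \<le> num_vars N lam a}"

text \<open>\<open>T = (t\<^sup>0, t)\<close> is a critical point of the logarithm of the master function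
  \<open>\<Phi>(t\<^sup>0, \<cdot>)\<close>.\<close>

definition critical_point :: "nat \<Rightarrow> (nat \<Rightarrow> nat) \<Rightarrow> (nat \<times> nat \<Rightarrow> complex) \<Rightarrow> bool" where
  "critical_point N lam T \<longleftrightarrow>
     T \<in> affine_points (crit_index N lam) \<and>
     (\<forall>a\<in>{1..N - 1}. \<forall>i\<in>{1..num_vars N lam a}.
        (\<forall>j\<in>{1..num_vars N lam (a - 1)}. T (a, i) \<noteq> T (a - 1, j)) \<and>
        (\<forall>j\<in>{1..num_vars N lam a} - {i}. T (a, i) \<noteq> T (a, j)) \<and>
        (\<forall>j\<in>{1..num_vars N lam (a + 1)}. T (a, i) \<noteq> T (a + 1, j)) \<and>
        (\<Sum>j = 1..num_vars N lam (a - 1). 1 / (T (a, i) - T (a - 1, j)))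
          - (\<Sum>j\<in>{1..num_vars N lam a} - {i}. 2 / (T (a, i) - T (a, j)))
          + (\<Sum>j = 1..num_vars N lam (a + 1). 1 / (T (a, i) - T (a + 1, j))) = 0)"

definition critical_points :: "nat \<Rightarrow> (nat \<Rightarrow> nat) \<Rightarrow> (nat \<times> nat \<Rightarrow> complex) set" where
  "critical_points N lam =
     {T. critical_point N lam T \<and> inj_on (\<lambda>i. T (0, i)) {1..num_vars N lam 0}}"

definition critical_closure :: "nat \<Rightarrow> (nat \<Rightarrow> nat) \<Rightarrow> (nat \<times> nat \<Rightarrow> complex) set" where
  "critical_closure N lam = zariski_closure (crit_index N lam) (critical_points N lam)"

text \<open>The quotient map by the product of symmetric groups, in terms of the elementary symmetric
  functions of each group of variables.\<close>

definition quotient_map ::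
  "nat \<Rightarrow> (nat \<Rightarrow> nat) \<Rightarrow> (nat \<times> nat \<Rightarrow> complex) \<Rightarrow> nat \<times> nat \<Rightarrow> complex" where
  "quotient_map N lam T =
     (\<lambda>(a, i) \<in> crit_index N lam.
        \<Sum>Y | Y \<subseteq> {1..num_vars N lam a} \<and> card Y = i. \<Prod>k\<in>Y. T (a, k))"

definition quotient_critical_set :: "nat \<Rightarrow> (nat \<Rightarrow> nat) \<Rightarrow> (nat \<times> nat \<Rightarrow> complex) set" where
  "quotient_critical_set N lam = quotient_map N lam ` critical_closure N lam"

definition O_C :: "nat \<Rightarrow> (nat \<Rightarrow> nat) \<Rightarrow> (complex, (nat \<times> nat \<Rightarrow> complex) \<Rightarrow> complex) module" where
  "O_C N lam = function_algebra (quotient_critical_set N lam)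
     (poly_functions (quotient_critical_set N lam) (\<lambda>s. s) (mpolys (crit_index N lam)))"

text \<open>The weight \<open>snd\<close> expresses \<open>deg \<sigma>\<^sup>(\<^sup>a\<^sup>)\<^sub>i = i\<close>.\<close>

definition O_C_degree ::
  "nat \<Rightarrow> (nat \<Rightarrow> nat) \<Rightarrow> nat \<Rightarrow> ((nat \<times> nat \<Rightarrow> complex) \<Rightarrow> complex) set" where
  "O_C_degree N lam k = poly_functions (quotient_critical_set N lam) (\<lambda>s. s)
     (mpolys_homogeneous (crit_index N lam) snd k)"

definition chi :: "nat \<Rightarrow> (nat \<Rightarrow> nat) \<Rightarrow> (nat \<times> nat \<Rightarrow> complex) \<Rightarrow> nat \<Rightarrow> complex fls" where
  "chi N lam T a =
     (\<Sum>j = 1..num_vars N lam (a - 1). 1 / (fls_X_inv - fls_const (T (a - 1, j))))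
     - (\<Sum>j = 1..num_vars N lam a. 1 / (fls_X_inv - fls_const (T (a, j))))"

definition D_T :: "nat \<Rightarrow> (nat \<Rightarrow> nat) \<Rightarrow> (nat \<times> nat \<Rightarrow> complex) \<Rightarrow> diffop" where
  "D_T N lam T =
     diffop_prod (map (\<lambda>a. Polynomial.monom 1 1 - [: chi N lam T a :]) [1..<Suc N])"

definition B_T :: "nat \<Rightarrow> (nat \<Rightarrow> nat) \<Rightarrow> nat \<Rightarrow> nat \<Rightarrow> (nat \<times> nat \<Rightarrow> complex) \<Rightarrow> complex" where
  "B_T N lam i j T = fls_nth (poly.coeff (D_T N lam T) (N - i)) (int j)"

text \<open>The restriction of \<open>B_T\<close> to the quotient critical set: \<open>B_T\<close> is invariant under the product
  of symmetric groups, so that it may be evaluated at any lift \<open>T\<close> of the point \<open>s\<close>.\<close>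

definition B_C :: "nat \<Rightarrow> (nat \<Rightarrow> nat) \<Rightarrow> nat \<Rightarrow> nat \<Rightarrow> (nat \<times> nat \<Rightarrow> complex) \<Rightarrow> complex" where
  "B_C N lam i j =
     (\<lambda>s \<in> quotient_critical_set N lam.
        B_T N lam i j (inv_into (affine_points (crit_index N lam)) (quotient_map N lam) s))"

text \<open>The kernel of \<open>D_T\<close>; at a critical point it consists of polynomials.\<close>

definition X_T :: "nat \<Rightarrow> (nat \<Rightarrow> nat) \<Rightarrow> (nat \<times> nat \<Rightarrow> complex) \<Rightarrow> complex poly set" where
  "X_T N lam T = {p. diffop_apply (D_T N lam T) (poly_at_inf p) = 0}"

text \<open>The regular map from the quotient critical set to the cell that sends the image of each
  critical point \<open>T\<close> to \<open>X_T\<close>; it is unique because these images are Zariski dense in the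
  quotient critical set.\<close>

definition iota ::
  "nat \<Rightarrow> nat \<Rightarrow> (nat \<Rightarrow> nat) \<Rightarrow> (nat \<times> nat \<Rightarrow> complex) \<Rightarrow> complex poly set" where
  "iota d N lam =
     (THE \<phi>. \<phi> \<in> quotient_critical_set N lam \<rightarrow>\<^sub>E cell d N lam \<and>
        (\<forall>v \<in> cell_index N lam.
           (\<lambda>s \<in> quotient_critical_set N lam. cell_coord N lam (\<phi> s) v) \<in> carrier (O_C N lam)) \<and>
        (\<forall>T \<in> critical_points N lam. \<phi> (quotient_map N lam T) = X_T N lam T))"

definition iota_pullback ::
  "nat \<Rightarrow> nat \<Rightarrow> (nat \<Rightarrow> nat) \<Rightarrow> (complex poly set \<Rightarrow> complex)
     \<Rightarrow> (nat \<times> nat \<Rightarrow> complex) \<Rightarrow> complex" where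
  "iota_pullback d N lam = pullback (quotient_critical_set N lam) (iota d N lam)"

end

(* For X in the cell with flag basis f_1, ..., f_N let W_m be the Wronskian of f_N, ..., f_(N+1-m).
   The monic operator with kernel spanned by f_N, ..., f_(N+1-m) factors into first order operators
   d/du - (log (W_k / W_(k-1)))', so up to constants the W_m are the polynomials whose roots are the
   groups of coordinates t^(N-m); let psi(X) be the collection of their coefficients.  Comparing
   expansions at infinity in D f_i = 0 recovers the f_ij polynomially and homogeneously from the
   coefficients B_ij of D, hence from psi(X): psi is a closed embedding, and the B_ij generate.

   It remains to see that psi maps the cell onto the quotient critical set.  At a critical point the
   equations say that the residues vanish in the successive integrations that produce the kernel of
   the operator from its factorization, so this kernel consists of polynomials and the image of the
   critical point lies on psi(cell), which is closed.  Conversely the Wronskian identity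
   W_m q' - W_m' q = W_(m+1) W_(m-1) turns a flag whose W_m have simple roots, with no common roots
   of neighbours, into a critical point.  Such flags are dense, by perturbing one f_i at a time, and
   since the roots of monic polynomials with bounded coefficients are bounded, every psi(X) is the
   image of a limit of critical points. *)

theory Submission
  imports Defs "HOL-Computational_Algebra.Fundamental_Theorem_Algebra"
begin

section \<open>Polynomial functions\<close>

text \<open>Polynomiality is proved once, for an abstract graded family of function spaces, and
  instantiated three times: with weighted homogeneous polynomials (degrees are respected), with one
  ungraded space (equations are polynomial, so they pass to Zariski closures), and with the
  subalgebra generated by the \<open>B_ij\<close> (it is everything). The \<open>f_ij\<close> can be
  recovered because the operator of any quotient point sends \<open>u^k\<close> to a series with
  leading coefficient \<open>prod_m (k - d_m)\<close>. The divisors in the recursion are therefore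
  constants, nonzero precisely at the exponents where the flag basis has free coefficients. The same
  product decides which degrees occur in the kernel. The obstacle is that the quotient critical set
  is only the image of a closure. Lying on the image of \<open>psi\<close> is a polynomial equation
  and extends to the closure; the converse needs an actual limit of critical points before dividing
  by the permutations. A perturbation may change only coefficients outside the exponent set, so it
  has to be shown that these restricted directions have no common zero.\<close>

definition monom_val :: "('v \<Rightarrow>\<^sub>0 nat) \<Rightarrow> ('v \<Rightarrow> complex) \<Rightarrow> complex" where
  "monom_val m x = (\<Prod>v\<in>Poly_Mapping.keys m. x v ^ poly_mapping.lookup m v)"

lemma monom_val_superset:
  assumes "finite V" "Poly_Mapping.keys m \<subseteq> V"
  shows "monom_val m x = (\<Prod>v\<in>V. x v ^ poly_mapping.lookup m v)"
  unfolding monom_val_def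
  by (rule prod.mono_neutral_left) (use assms in \<open>auto simp: in_keys_iff\<close>)

lemma monom_val_add: "monom_val (m + m') x = monom_val m x * monom_val m' x"
proof -
  let ?V = "Poly_Mapping.keys m \<union> Poly_Mapping.keys m'"
  have "monom_val (m + m') x = (\<Prod>v\<in>?V. x v ^ poly_mapping.lookup (m + m') v)"
    by (rule monom_val_superset) (auto simp: keys_add)
  also have "\<dots> = (\<Prod>v\<in>?V. x v ^ poly_mapping.lookup m v) * (\<Prod>v\<in>?V. x v ^ poly_mapping.lookup m' v)"
    by (simp add: lookup_add power_add prod.distrib)
  also have "\<dots> = monom_val m x * monom_val m' x"
    by (subst (1 2) monom_val_superset[of ?V]) auto
  finally show ?thesis .
qed

lemma mpoly_eval_superset:
  assumes "finite K" "Poly_Mapping.keys q \<subseteq> K"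
  shows "mpoly_eval q x = (\<Sum>m\<in>K. poly_mapping.lookup q m * monom_val m x)"
  unfolding mpoly_eval_def monom_val_def[symmetric]
  by (rule sum.mono_neutral_left) (use assms in \<open>auto simp: in_keys_iff\<close>)

lemma mpoly_eval_eq: "mpoly_eval q x = (\<Sum>m\<in>Poly_Mapping.keys q. poly_mapping.lookup q m * monom_val m x)"
  by (rule mpoly_eval_superset) auto

lemma mpoly_eval_0 [simp]: "mpoly_eval 0 x = 0"
  by (simp add: mpoly_eval_def)

lemma mpoly_eval_single: "mpoly_eval (Poly_Mapping.single m c) x = c * monom_val m x"
  by (subst mpoly_eval_superset[of "{m}"]) (auto simp: lookup_single)

lemma mpoly_eval_add: "mpoly_eval (p + q) x = mpoly_eval p x + mpoly_eval q x"
proof -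
  let ?K = "Poly_Mapping.keys p \<union> Poly_Mapping.keys q"
  have "mpoly_eval (p + q) x = (\<Sum>m\<in>?K. poly_mapping.lookup (p + q) m * monom_val m x)"
    by (rule mpoly_eval_superset) (auto simp: keys_add)
  also have "\<dots> = mpoly_eval p x + mpoly_eval q x"
    by (subst (1 2) mpoly_eval_superset[of ?K]) (auto simp: lookup_add algebra_simps sum.distrib)
  finally show ?thesis .
qed

lemma mpoly_eval_sum: "mpoly_eval (\<Sum>i\<in>A. f i) x = (\<Sum>i\<in>A. mpoly_eval (f i) x)"
  by (induction A rule: infinite_finite_induct) (auto simp: mpoly_eval_add)

lemma mpolynomial_sum_single:
  "q = (\<Sum>m\<in>Poly_Mapping.keys q. Poly_Mapping.single m (poly_mapping.lookup q m))"
  by (rule poly_mapping_eqI) (auto simp: lookup_sum lookup_single when_def in_keys_iff)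

lemma mpoly_eval_mult: "mpoly_eval (p * q) x = mpoly_eval p x * mpoly_eval q x"
proof -
  let ?P = "Poly_Mapping.keys p" and ?Q = "Poly_Mapping.keys q"
  let ?sp = "\<lambda>m. Poly_Mapping.single m (poly_mapping.lookup p m)"
  let ?sq = "\<lambda>m. Poly_Mapping.single m (poly_mapping.lookup q m)"
  have "p * q = (\<Sum>m\<in>?P. ?sp m) * (\<Sum>m\<in>?Q. ?sq m)"
    using mpolynomial_sum_single[of p] mpolynomial_sum_single[of q] by simp
  also have "\<dots> = (\<Sum>m\<in>?P. \<Sum>m'\<in>?Q. ?sp m * ?sq m')"
    by (simp add: sum_product)
  finally have "mpoly_eval (p * q) x = (\<Sum>m\<in>?P. \<Sum>m'\<in>?Q. mpoly_eval (?sp m * ?sq m') x)"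
    by (simp add: mpoly_eval_sum)
  also have "\<dots> = (\<Sum>m\<in>?P. \<Sum>m'\<in>?Q. (poly_mapping.lookup p m * monom_val m x)
      * (poly_mapping.lookup q m' * monom_val m' x))"
    by (simp add: mult_single mpoly_eval_single monom_val_add mult_ac)
  also have "\<dots> = mpoly_eval p x * mpoly_eval q x"
    by (simp add: mpoly_eval_eq sum_product)
  finally show ?thesis .
qed

section \<open>Weighted homogeneous polynomials and graded families of functions\<close>

definition monom_deg :: "('v \<Rightarrow> nat) \<Rightarrow> ('v \<Rightarrow>\<^sub>0 nat) \<Rightarrow> nat" where
  "monom_deg w m = (\<Sum>v\<in>Poly_Mapping.keys m. w v * poly_mapping.lookup m v)"

lemma monom_deg_add: "monom_deg w (m + m') = monom_deg w m + monom_deg w m'"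
proof -
  have *: "monom_deg w m = (\<Sum>v\<in>V. w v * poly_mapping.lookup m v)"
    if "finite V" "Poly_Mapping.keys m \<subseteq> V" for V m
    unfolding monom_deg_def
    by (rule sum.mono_neutral_left) (use that in \<open>auto simp: in_keys_iff\<close>)
  let ?V = "Poly_Mapping.keys m \<union> Poly_Mapping.keys m'"
  have "monom_deg w (m + m') = (\<Sum>v\<in>?V. w v * poly_mapping.lookup (m + m') v)"
    by (rule *) (auto simp: keys_add)
  also have "\<dots> = monom_deg w m + monom_deg w m'"
    by (subst (1 2) *[of ?V]) (auto simp: lookup_add algebra_simps sum.distrib)
  finally show ?thesis .
qed

lemma mpolys_homogeneous_iff:
  "q \<in> mpolys_homogeneous I w k \<longleftrightarrow>
     (\<forall>m\<in>Poly_Mapping.keys q. Poly_Mapping.keys m \<subseteq> I \<and> monom_deg w m = k)"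
  by (auto simp: mpolys_homogeneous_def mpolys_def monom_deg_def)

lemma mpolys_homogeneous_trivial: "mpolys_homogeneous I (\<lambda>_. 0) 0 = mpolys I"
  by (auto simp: mpolys_homogeneous_def)

lemma mpolys_homogeneous_add:
  "p \<in> mpolys_homogeneous I w k \<Longrightarrow> q \<in> mpolys_homogeneous I w k
    \<Longrightarrow> p + q \<in> mpolys_homogeneous I w k"
  using keys_add[of p q] by (auto simp: mpolys_homogeneous_iff subset_iff)

lemma mpolys_homogeneous_mult:
  assumes "p \<in> mpolys_homogeneous I w j" "q \<in> mpolys_homogeneous I w k"
  shows "p * q \<in> mpolys_homogeneous I w (j + k)"
  unfolding mpolys_homogeneous_iff
proof
  fix m assume "m \<in> Poly_Mapping.keys (p * q)"
  then obtain a b where m: "m = a + b" and ab: "a \<in> Poly_Mapping.keys p" "b \<in> Poly_Mapping.keys q"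
    using keys_mult[of p q] by blast
  then have "Poly_Mapping.keys a \<subseteq> I" "Poly_Mapping.keys b \<subseteq> I" "monom_deg w a = j" "monom_deg w b = k"
    using assms by (auto simp: mpolys_homogeneous_iff)
  then show "Poly_Mapping.keys m \<subseteq> I \<and> monom_deg w m = j + k"
    using keys_add[of a b] by (auto simp: m monom_deg_add)
qed

text \<open>The axioms abstract spaces of homogeneous functions that matter only through their
  values on \<open>S\<close>; the \<open>H k\<close> may overlap or even coincide. One argument thus
  covers weighted polynomials, a constant family that forgets degrees, and a subalgebra.\<close>

locale graded_functions =
  fixes S :: "'p set" and H :: "nat \<Rightarrow> ('p \<Rightarrow> complex) set"
  assumes const: "(\<lambda>_. c) \<in> H 0"
    and zero: "(\<lambda>_. 0) \<in> H k"
    and add: "f \<in> H k \<Longrightarrow> g \<in> H k \<Longrightarrow> (\<lambda>p. f p + g p) \<in> H k"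
    and mult: "f \<in> H j \<Longrightarrow> g \<in> H k \<Longrightarrow> (\<lambda>p. f p * g p) \<in> H (j + k)"
    and cong: "f \<in> H k \<Longrightarrow> (\<And>p. p \<in> S \<Longrightarrow> f p = g p) \<Longrightarrow> g \<in> H k"
begin

lemma cmult: "f \<in> H k \<Longrightarrow> (\<lambda>p. c * f p) \<in> H k"
  using mult[OF const] by simp

lemma uminus: "f \<in> H k \<Longrightarrow> (\<lambda>p. - f p) \<in> H k"
  using cmult[of f k "-1"] by simp

lemma diff: "f \<in> H k \<Longrightarrow> g \<in> H k \<Longrightarrow> (\<lambda>p. f p - g p) \<in> H k"
  using add[OF _ uminus[of g]] by simp

lemma sum: "(\<And>i. i \<in> A \<Longrightarrow> f i \<in> H k) \<Longrightarrow> (\<lambda>p. \<Sum>i\<in>A. f i p) \<in> H k"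
  by (induction A rule: infinite_finite_induct) (auto simp: zero add)

lemma prod: "(\<And>i. i \<in> A \<Longrightarrow> f i \<in> H (k i)) \<Longrightarrow> (\<lambda>p. \<Prod>i\<in>A. f i p) \<in> H (\<Sum>i\<in>A. k i)"
  by (induction A rule: infinite_finite_induct) (auto simp: const mult)

lemma power: "f \<in> H k \<Longrightarrow> (\<lambda>p. f p ^ n) \<in> H (k * n)"
  using prod[of "{..<n}" "\<lambda>_. f" "\<lambda>_. k"] by (simp add: mult.commute)

text \<open>A variable of weight \<open>w v\<close> is replaced by a function of the same degree, so
  each monomial keeps its degree. This is how polynomial maps between the cell and the quotient
  critical set pull functions back.\<close>

lemma mpoly_compose:
  assumes q: "q \<in> mpolys_homogeneous I w k" and c: "\<And>v. v \<in> I \<Longrightarrow> (\<lambda>p. c p v) \<in> H (w v)"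
  shows "(\<lambda>p. mpoly_eval q (c p)) \<in> H k"
  unfolding mpoly_eval_eq
proof (rule sum)
  fix m assume m: "m \<in> Poly_Mapping.keys q"
  then have sub: "Poly_Mapping.keys m \<subseteq> I" and deg: "monom_deg w m = k"
    using q by (auto simp: mpolys_homogeneous_iff)
  have "(\<lambda>p. \<Prod>v\<in>Poly_Mapping.keys m. c p v ^ poly_mapping.lookup m v) \<in> H (monom_deg w m)"
    unfolding monom_deg_def by (rule prod) (use sub in \<open>auto intro!: power c\<close>)
  then show "(\<lambda>p. poly_mapping.lookup q m * monom_val m (c p)) \<in> H k"
    unfolding monom_val_def deg by (rule cmult)
qed

end

text \<open>Unlike in \<open>poly_functions\<close>, values off \<open>S\<close> are arbitrary, so
  pointwise sums and products stay inside without being restricted again.\<close>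

definition polyfuns ::
  "'p set \<Rightarrow> ('p \<Rightarrow> 'v \<Rightarrow> complex) \<Rightarrow> 'v set \<Rightarrow> ('v \<Rightarrow> nat) \<Rightarrow> nat \<Rightarrow> ('p \<Rightarrow> complex) set" where
  "polyfuns S c I w k = {f. \<exists>q\<in>mpolys_homogeneous I w k. \<forall>p\<in>S. f p = mpoly_eval q (c p)}"

lemma polyfunsI: "q \<in> mpolys_homogeneous I w k \<Longrightarrow> (\<And>p. p \<in> S \<Longrightarrow> f p = mpoly_eval q (c p))
   \<Longrightarrow> f \<in> polyfuns S c I w k"
  by (auto simp: polyfuns_def)

lemma graded_functions_polyfuns: "graded_functions S (polyfuns S c I w)"
proof
  show "(\<lambda>_. a) \<in> polyfuns S c I w 0" for a
    by (rule polyfunsI[of "Poly_Mapping.single 0 a"])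
      (auto simp: mpolys_homogeneous_iff mpoly_eval_single monom_val_def monom_deg_def)
  show "(\<lambda>_. 0) \<in> polyfuns S c I w k" for k
    by (rule polyfunsI[of 0]) (auto simp: mpolys_homogeneous_iff)
  show "(\<lambda>p. f p + g p) \<in> polyfuns S c I w k"
    if "f \<in> polyfuns S c I w k" "g \<in> polyfuns S c I w k" for f g k
  proof -
    from that obtain p q where "p \<in> mpolys_homogeneous I w k" "\<forall>x\<in>S. f x = mpoly_eval p (c x)"
      "q \<in> mpolys_homogeneous I w k" "\<forall>x\<in>S. g x = mpoly_eval q (c x)" by (auto simp: polyfuns_def)
    then show ?thesis
      by (intro polyfunsI[of "p + q"]) (auto simp: mpolys_homogeneous_add mpoly_eval_add)
  qed
  show "(\<lambda>p. f p * g p) \<in> polyfuns S c I w (j + k)"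
    if "f \<in> polyfuns S c I w j" "g \<in> polyfuns S c I w k" for f g j k
  proof -
    from that obtain p q where "p \<in> mpolys_homogeneous I w j" "\<forall>x\<in>S. f x = mpoly_eval p (c x)"
      "q \<in> mpolys_homogeneous I w k" "\<forall>x\<in>S. g x = mpoly_eval q (c x)" by (auto simp: polyfuns_def)
    then show ?thesis
      by (intro polyfunsI[of "p * q"]) (auto simp: mpolys_homogeneous_mult mpoly_eval_mult)
  qed
  show "g \<in> polyfuns S c I w k"
    if "f \<in> polyfuns S c I w k" "\<And>p. p \<in> S \<Longrightarrow> f p = g p" for f g k
    using that by (auto simp: polyfuns_def)
qed

lemma polyfuns_coord:
  assumes "v \<in> I" shows "(\<lambda>p. c p v) \<in> polyfuns S c I w (w v)"
proof (rule polyfunsI[of "Poly_Mapping.single (Poly_Mapping.single v 1) 1"])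
  show "Poly_Mapping.single (Poly_Mapping.single v 1) 1 \<in> mpolys_homogeneous I w (w v)"
    using assms by (auto simp: mpolys_homogeneous_iff monom_deg_def)
qed (auto simp: mpoly_eval_single monom_val_def)

lemma polyfuns_ungrade: "f \<in> polyfuns S c I w k \<Longrightarrow> f \<in> polyfuns S c I (\<lambda>_. 0) 0"
  unfolding polyfuns_def mpolys_homogeneous_trivial by (auto simp: mpolys_homogeneous_def)

lemma poly_functions_restrict:
  assumes "f \<in> polyfuns S c I w k"
  shows "restrict f S \<in> poly_functions S c (mpolys_homogeneous I w k)"
proof -
  from assms obtain q where "q \<in> mpolys_homogeneous I w k" "\<forall>p\<in>S. f p = mpoly_eval q (c p)"
    by (auto simp: polyfuns_def)
  then show ?thesis unfolding poly_functions_def by (intro image_eqI[of _ _ q]) (auto intro!: restrict_ext)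
qed


section \<open>Graded families of Laurent series\<close>

text \<open>Subdegrees vary with the point of a family, so the convolution is summed over a range
  fixed by uniform lower bounds \<open>a\<close> and \<open>b\<close>; all terms gained or lost
  vanish.\<close>

lemma fls_times_nth_bounded:
  fixes f g :: "'a :: comm_semiring_0 fls"
  assumes f: "\<And>n. n < a \<Longrightarrow> fls_nth f n = 0" and g: "\<And>n. n < b \<Longrightarrow> fls_nth g n = 0"
  shows "fls_nth (f * g) n = (\<Sum>i=a..n - b. fls_nth f i * fls_nth g (n - i))"
proof -
  have fs: "fls_nth f i = 0" if "i < fls_subdegree f" for i using that by simp
  have "fls_nth (f * g) n =
    (\<Sum>i=fls_subdegree f + fls_subdegree g..n. fls_nth f (i - fls_subdegree g) * fls_nth g (fls_subdegree g + n - i))"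
    by (rule fls_times_nth)
  also have "\<dots> = (\<Sum>i=fls_subdegree f..n - fls_subdegree g. fls_nth f i * fls_nth g (n - i))"
    by (rule sum.reindex_bij_witness[of _ "\<lambda>i. i + fls_subdegree g" "\<lambda>i. i - fls_subdegree g"])
      (auto simp: algebra_simps)
  also have "\<dots> = (\<Sum>i=min a (fls_subdegree f)..max (n - b) (n - fls_subdegree g). fls_nth f i * fls_nth g (n - i))"
    by (rule sum.mono_neutral_left) auto
  also have "\<dots> = (\<Sum>i=a..n - b. fls_nth f i * fls_nth g (n - i))"
  proof (rule sum.mono_neutral_right)
    show "\<forall>i\<in>{min a (fls_subdegree f)..max (n - b) (n - fls_subdegree g)} - {a..n - b}.
       fls_nth f i * fls_nth g (n - i) = 0"
    proof
      fix i assume "i \<in> {min a (fls_subdegree f)..max (n - b) (n - fls_subdegree g)} - {a..n - b}"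
      then have "i < a \<or> n - i < b" by auto
      then show "fls_nth f i * fls_nth g (n - i) = 0" using f g by auto
    qed
  qed auto
  finally show ?thesis .
qed

lemma du_nth: "fls_nth (du f) n = - of_int (n - 1) * fls_nth f (n - 1)"
proof -
  have "fls_nth (fls_X ^ 2 * fls_deriv f) n = of_int (n - 1) * fls_nth f (n - 1)"
    by (simp add: fls_X_power_times_conv_shift)
  then show ?thesis by (simp add: du_def algebra_simps)
qed

lemma du_add [simp]: "du (f + g) = du f + du g"
  and du_mult: "du (f * g) = du f * g + f * du g"
  and du_0 [simp]: "du 0 = 0"
  and du_1 [simp]: "du 1 = 0"
  and du_const [simp]: "du (fls_const c) = 0"
  by (simp_all add: du_def algebra_simps)

lemma du_cmult [simp]: "du (fls_const c * g) = fls_const c * du g"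
  by (simp add: du_mult)

lemma du_sum [simp]: "du (\<Sum>i\<in>A. f i) = (\<Sum>i\<in>A. du (f i))"
  by (induction A rule: infinite_finite_induct) auto

lemma dupow_linear [simp]:
  "(du ^^ k) (f + g) = (du ^^ k) f + (du ^^ k) g"
  "(du ^^ k) 0 = 0"
  "(du ^^ k) (fls_const c * g) = fls_const c * (du ^^ k) g"
  by (induction k) auto

context graded_functions begin

text \<open>\<open>H k\<close> is a space of functions of degree \<open>k\<close>.  If \<open>u\<close> is given degree \<open>1\<close>, then \<open>G r\<close> consists
  of the families of Laurent series of order at least \<open>r\<close> that are homogeneous of degree \<open>-r\<close>.\<close>

definition G :: "int \<Rightarrow> ('p \<Rightarrow> complex fls) set" where
  "G r = {g. (\<forall>n<r. \<forall>p\<in>S. fls_nth (g p) n = 0) \<and> (\<forall>k. (\<lambda>p. fls_nth (g p) (r + int k)) \<in> H k)}"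

lemma G_add: "f \<in> G r \<Longrightarrow> g \<in> G r \<Longrightarrow> (\<lambda>p. f p + g p) \<in> G r"
  by (auto simp: G_def intro: add)

lemma G_diff: "f \<in> G r \<Longrightarrow> g \<in> G r \<Longrightarrow> (\<lambda>p. f p - g p) \<in> G r"
  by (auto simp: G_def intro: diff)

lemma G_zero: "(\<lambda>_. 0) \<in> G r"
  by (auto simp: G_def zero)

lemma G_const: "(\<lambda>_. fls_const c) \<in> G 0"
  by (auto simp: G_def zero const)

lemma G_one: "(\<lambda>_. 1) \<in> G 0"
  using G_const[of 1] by simp

lemma G_sum: "(\<And>i. i \<in> A \<Longrightarrow> f i \<in> G r) \<Longrightarrow> (\<lambda>p. \<Sum>i\<in>A. f i p) \<in> G r"
  by (induction A rule: infinite_finite_induct) (auto simp: G_zero G_add)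

lemma G_mult:
  assumes "f \<in> G r" "g \<in> G s" shows "(\<lambda>p. f p * g p) \<in> G (r + s)"
proof -
  have nth: "fls_nth (f p * g p) n = (\<Sum>i=r..n - s. fls_nth (f p) i * fls_nth (g p) (n - i))"
    if "p \<in> S" for p n
    by (rule fls_times_nth_bounded) (use assms that in \<open>auto simp: G_def\<close>)
  have "(\<lambda>p. \<Sum>i=r..(r + s + int k) - s. fls_nth (f p) i * fls_nth (g p) ((r + s + int k) - i)) \<in> H k" for k
  proof (rule sum)
    fix i assume i: "i \<in> {r..(r + s + int k) - s}"
    define a where "a = nat (i - r)"
    have ia: "i = r + int a" "a \<le> k" using i by (auto simp: a_def)
    then have e: "(r + s + int k) - i = s + int (k - a)" by auto
    have "(\<lambda>p. fls_nth (f p) (r + int a) * fls_nth (g p) (s + int (k - a))) \<in> H (a + (k - a))"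
      using assms by (intro mult) (auto simp: G_def)
    then show "(\<lambda>p. fls_nth (f p) i * fls_nth (g p) ((r + s + int k) - i)) \<in> H k"
      unfolding e using ia by simp
  qed
  then have "(\<lambda>p. fls_nth (f p * g p) (r + s + int k)) \<in> H k" for k
    by (rule cong) (simp add: nth)
  then show ?thesis
    unfolding G_def using nth by auto
qed

lemma G_prod: "(\<And>i. i \<in> A \<Longrightarrow> f i \<in> G (r i)) \<Longrightarrow> (\<lambda>p. \<Prod>i\<in>A. f i p) \<in> G (\<Sum>i\<in>A. r i)"
  by (induction A rule: infinite_finite_induct) (auto simp: G_one G_mult)

lemma G_du: "f \<in> G r \<Longrightarrow> (\<lambda>p. du (f p)) \<in> G (r + 1)"
proof -
  assume f: "f \<in> G r"
  have "(\<lambda>p. (- of_int (r + int k)) * fls_nth (f p) (r + int k)) \<in> H k" for k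
    using f by (intro cmult) (auto simp: G_def)
  moreover have "fls_nth (du (f p)) (r + 1 + int k) = (- of_int (r + int k)) * fls_nth (f p) (r + int k)"
    for p k by (simp add: du_nth add.commute add.left_commute)
  ultimately show ?thesis using f by (auto simp: G_def du_nth)
qed

lemma G_dupow: "f \<in> G r \<Longrightarrow> (\<lambda>p. (du ^^ k) (f p)) \<in> G (r + int k)"
proof (induction k)
  case (Suc k)
  have "(\<lambda>p. du ((du ^^ k) (f p))) \<in> G (r + int k + 1)" using Suc by (intro G_du) auto
  then show ?case by (simp add: algebra_simps)
qed simp

text \<open>The coefficients of the inverse satisfy a recursion that divides only by the leading
  coefficient. As this is the same constant \<open>c\<close> at every point, polynomiality and
  degrees survive.\<close>

lemma G_inverse:
  assumes f: "f \<in> G r" and lead: "\<And>p. p \<in> S \<Longrightarrow> fls_nth (f p) r = c" and c: "c \<noteq> 0"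
  shows "(\<lambda>p. inverse (f p)) \<in> G (- r)"
proof -
  have sub: "fls_subdegree (f p) = r" if "p \<in> S" for p
    using f lead[OF that] c that by (intro fls_subdegree_eqI) (auto simp: G_def)
  have low: "fls_nth (inverse (f p)) n = 0" if "p \<in> S" "n < - r" for p n
    using sub[OF that(1)] that(2) by (simp add: fls_inverse_subdegree)
  have "(\<lambda>p. fls_nth (inverse (f p)) (- r + int k)) \<in> H k" for k
  proof (induction k rule: less_induct)
    case (less k)
    have eq: "fls_nth (inverse (f p)) (- r + int k) =
      inverse c * ((if k = 0 then 1 else 0) - (\<Sum>j=1..k. fls_nth (f p) (r + int j) * fls_nth (inverse (f p)) (- r + int (k - j))))"
      if p: "p \<in> S" for p
    proof -
      have "f p \<noteq> 0" using lead[OF p] c by auto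
      then have "f p * inverse (f p) = 1" by simp
      then have "(if k = 0 then 1 else 0) = fls_nth (f p * inverse (f p)) (int k)" by simp
      also have "\<dots> = (\<Sum>i=r..int k - (- r). fls_nth (f p) i * fls_nth (inverse (f p)) (int k - i))"
        by (rule fls_times_nth_bounded) (use f p low[OF p] in \<open>auto simp: G_def\<close>)
      also have "\<dots> = (\<Sum>j=0..k. fls_nth (f p) (r + int j) * fls_nth (inverse (f p)) (- r + int (k - j)))"
        by (rule sum.reindex_bij_witness[of _ "\<lambda>j. r + int j" "\<lambda>i. nat (i - r)"])
          (auto simp: algebra_simps of_nat_diff)
      also have "\<dots> = c * fls_nth (inverse (f p)) (- r + int k) +
          (\<Sum>j=1..k. fls_nth (f p) (r + int j) * fls_nth (inverse (f p)) (- r + int (k - j)))"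
        using lead[OF p] by (simp add: sum.atLeast_Suc_atMost)
      finally show ?thesis using c by (simp add: field_simps)
    qed
    have "(\<lambda>p. inverse c * ((if k = 0 then 1 else 0) - (\<Sum>j=1..k. fls_nth (f p) (r + int j) * fls_nth (inverse (f p)) (- r + int (k - j))))) \<in> H k"
    proof (intro cmult diff sum)
      show "(\<lambda>p. if k = 0 then 1 else 0) \<in> H k" by (cases "k = 0") (auto simp: const zero)
      fix j assume j: "j \<in> {1..k}"
      have "(\<lambda>p. fls_nth (f p) (r + int j) * fls_nth (inverse (f p)) (- r + int (k - j))) \<in> H (j + (k - j))"
        using f j less[of "k - j"] by (intro mult) (auto simp: G_def simp del: of_nat_diff)
      then show "(\<lambda>p. fls_nth (f p) (r + int j) * fls_nth (inverse (f p)) (- r + int (k - j))) \<in> H k"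
        using j by simp
    qed
    then show ?case by (rule cong) (simp only: eq)
  qed
  then show ?thesis using low by (auto simp: G_def)
qed

end

section \<open>Polynomials as Laurent series at infinity\<close>

lemma poly_at_inf_nth:
  "fls_nth (poly_at_inf p) n = (if n \<le> 0 then poly.coeff p (nat (- n)) else 0)"
proof -
  have "fls_nth (poly_at_inf p) n =
      (\<Sum>k\<le>degree p. poly.coeff p k * (if n = - int k then 1 else 0))"
    by (simp add: poly_at_inf_def fls_nth_sum)
  also have "\<dots> = (if n \<le> 0 then poly.coeff p (nat (- n)) else 0)"
  proof (cases "n \<le> 0")
    case True
    then have "(n = - int k) = (k = nat (- n))" for k by auto
    then show ?thesis using True by (simp add: coeff_eq_0 sum.delta if_distrib cong: if_cong)
  next
    case False
    then show ?thesis by (auto intro!: sum.neutral)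
  qed
  finally show ?thesis .
qed

lemma poly_at_inf_add [simp]: "poly_at_inf (p + q) = poly_at_inf p + poly_at_inf q"
  and poly_at_inf_diff [simp]: "poly_at_inf (p - q) = poly_at_inf p - poly_at_inf q"
  and poly_at_inf_uminus [simp]: "poly_at_inf (- p) = - poly_at_inf p"
  and poly_at_inf_smult [simp]: "poly_at_inf (Polynomial.smult c p) = fls_const c * poly_at_inf p"
  and poly_at_inf_0 [simp]: "poly_at_inf 0 = 0"
  and poly_at_inf_1 [simp]: "poly_at_inf 1 = 1"
  by (rule fls_eqI; simp add: poly_at_inf_nth)+

lemma poly_at_inf_const [simp]: "poly_at_inf [:c:] = fls_const c"
  by (rule fls_eqI) (auto simp: poly_at_inf_nth coeff_pCons split: nat.splits)

lemma poly_at_inf_sum [simp]: "poly_at_inf (\<Sum>i\<in>A. f i) = (\<Sum>i\<in>A. poly_at_inf (f i))"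
  by (induction A rule: infinite_finite_induct) auto

lemma poly_at_inf_pCons: "poly_at_inf (pCons a p) = fls_const a + fls_X_inv * poly_at_inf p"
proof (rule fls_eqI)
  fix n
  have "nat (- n) = Suc (nat (- n - 1))" if "n < 0" using that by auto
  then show "fls_nth (poly_at_inf (pCons a p)) n = fls_nth (fls_const a + fls_X_inv * poly_at_inf p) n"
    by (auto simp: poly_at_inf_nth fls_X_inv_times_conv_shift coeff_pCons split: nat.splits)
qed

lemma poly_at_inf_mult [simp]: "poly_at_inf (p * q) = poly_at_inf p * poly_at_inf q"
proof (induction p)
  case (pCons a p)
  have "poly_at_inf (pCons a p * q) = fls_const a * poly_at_inf q + poly_at_inf (pCons 0 (p * q))"
    by simp
  also have "\<dots> = (fls_const a + fls_X_inv * poly_at_inf p) * poly_at_inf q"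
    using pCons by (simp add: poly_at_inf_pCons algebra_simps)
  finally show ?case by (simp add: poly_at_inf_pCons)
qed simp

lemma poly_at_inf_prod [simp]: "poly_at_inf (\<Prod>i\<in>A. f i) = (\<Prod>i\<in>A. poly_at_inf (f i))"
  by (induction A rule: infinite_finite_induct) auto

lemma poly_at_inf_eq_iff [simp]: "poly_at_inf p = poly_at_inf q \<longleftrightarrow> p = q"
proof
  assume eq: "poly_at_inf p = poly_at_inf q"
  have "poly.coeff p k = poly.coeff q k" for k
    using arg_cong[OF eq, of "\<lambda>f. fls_nth f (- int k)"] by (simp add: poly_at_inf_nth)
  then show "p = q" by (rule poly_eqI)
qed simp

lemma poly_at_inf_eq_0_iff [simp]: "poly_at_inf p = 0 \<longleftrightarrow> p = 0"
  using poly_at_inf_eq_iff[of p 0] by (simp del: poly_at_inf_eq_iff)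

lemma du_poly_at_inf [simp]: "du (poly_at_inf p) = poly_at_inf (pderiv p)"
proof (rule fls_eqI)
  fix n
  have *: "nat (1 - n) = Suc (nat (- n))" if "n \<le> 0" using that by auto
  have "of_nat (Suc (nat (- n))) = (1 - of_int n :: complex)" if "n \<le> 0"
    using that by (simp add: of_nat_nat)
  then show "fls_nth (du (poly_at_inf p)) n = fls_nth (poly_at_inf (pderiv p)) n"
    using * by (auto simp: du_nth poly_at_inf_nth coeff_pderiv)
qed

lemma dupow_poly_at_inf [simp]: "(du ^^ k) (poly_at_inf p) = poly_at_inf ((pderiv ^^ k) p)"
  by (induction k) auto


section \<open>Leading terms\<close>

text \<open>The coefficient \<open>c\<close> may be 0. Products, differences and derivatives then
  obey plain formulas even if leading terms cancel, and nonvanishing is checked only where it is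
  used.\<close>

definition leads :: "complex fls \<Rightarrow> int \<Rightarrow> complex \<Rightarrow> bool" where
  "leads f r c \<longleftrightarrow> (\<forall>n<r. fls_nth f n = 0) \<and> fls_nth f r = c"

lemma leads_poly: "leads (poly_at_inf p) (- int (degree p)) (lead_coeff p)"
  by (auto simp: leads_def poly_at_inf_nth coeff_eq_0)

lemma leads_nonzero: "leads f r c \<Longrightarrow> c \<noteq> 0 \<Longrightarrow> f \<noteq> 0"
  by (auto simp: leads_def)

lemma leads_subdegree: "leads f r c \<Longrightarrow> c \<noteq> 0 \<Longrightarrow> fls_subdegree f = r"
  by (intro fls_subdegree_eqI) (auto simp: leads_def)

lemma leads_mult: "leads f r c \<Longrightarrow> leads g s d \<Longrightarrow> leads (f * g) (r + s) (c * d)"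
  unfolding leads_def using fls_times_nth_bounded[of r f s g] by auto

lemma leads_inverse:
  assumes "leads f r c" "c \<noteq> 0" shows "leads (inverse f) (- r) (inverse c)"
proof -
  have s: "fls_subdegree f = r" using assms by (rule leads_subdegree)
  show ?thesis unfolding leads_def
  proof safe
    show "fls_nth (inverse f) n = 0" if "n < - r" for n
      using that s by (intro fls_eq0_below_subdegree) simp
    show "fls_nth (inverse f) (- r) = inverse c"
      using fls_inverse_subdegree_base[of f] assms s by (simp add: leads_def)
  qed
qed

lemma leads_diff: "leads f r c \<Longrightarrow> leads g r d \<Longrightarrow> leads (f - g) r (c - d)"
  by (auto simp: leads_def)

lemma leads_du: "leads f r c \<Longrightarrow> leads (du f) (r + 1) (- of_int r * c)"
  by (auto simp: leads_def du_nth)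

definition dlog :: "complex fls \<Rightarrow> complex fls" where
  "dlog f = du f / f"

text \<open>For \<open>f\<close> starting with \<open>c u^(-r)\<close> the logarithmic derivative
  starts with \<open>-r / u\<close>. The constant cancels, so only degrees will enter the leading
  terms of the first-order factors.\<close>

lemma leads_dlog: "leads f r c \<Longrightarrow> c \<noteq> 0 \<Longrightarrow> leads (dlog f) 1 (- of_int r)"
proof -
  assume f: "leads f r c" "c \<noteq> 0"
  have "leads (du f * inverse f) (r + 1 + - r) (- of_int r * c * inverse c)"
    by (rule leads_mult[OF leads_du leads_inverse]) (use f in auto)
  moreover have "- of_int r * c * inverse c = - of_int r" using f(2) by (simp add: mult.assoc)
  ultimately show ?thesis unfolding dlog_def divide_inverse by (simp del: mult_minus_left)
qed

lemma dlog_mult: "f \<noteq> 0 \<Longrightarrow> g \<noteq> 0 \<Longrightarrow> dlog (f * g) = dlog f + dlog g"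
  by (simp add: dlog_def du_mult field_simps)

lemma dlog_divide:
  assumes "f \<noteq> 0" "g \<noteq> 0" shows "dlog (f / g) = dlog f - dlog g"
  using dlog_mult[of "f / g" g] assms by simp

lemma dlog_const [simp]: "dlog (fls_const c) = 0"
  and dlog_1 [simp]: "dlog 1 = 0"
  by (simp_all add: dlog_def)

lemma dlog_cmult: "c \<noteq> 0 \<Longrightarrow> f \<noteq> 0 \<Longrightarrow> dlog (fls_const c * f) = dlog f"
  by (simp add: dlog_mult)

lemma dlog_prod: "(\<And>i. i \<in> A \<Longrightarrow> f i \<noteq> 0) \<Longrightarrow> dlog (\<Prod>i\<in>A. f i) = (\<Sum>i\<in>A. dlog (f i))"
  by (induction A rule: infinite_finite_induct) (auto simp: dlog_mult)

text \<open>The coefficient of \<open>u^(-n)\<close> comes from \<open>u^(k - n)\<close>, and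
  \<open>k\<close> derivatives of that power produce a falling factorial of
  \<open>k - n\<close>.\<close>

lemma dupow_nth:
  "fls_nth ((du ^^ k) f) n = (\<Prod>i<k. of_int (int k - n) - of_nat i) * fls_nth f (n - int k)"
proof (induction k arbitrary: n)
  case (Suc k)
  have "fls_nth ((du ^^ Suc k) f) n =
      - of_int (n - 1) * ((\<Prod>i<k. of_int (int k - (n - 1)) - of_nat i) * fls_nth f (n - 1 - int k))"
    by (simp only: funpow.simps comp_apply du_nth Suc)
  also have "\<dots> = (\<Prod>i<Suc k. of_int (int (Suc k) - n) - of_nat i) * fls_nth f (n - int (Suc k))"
    by (simp add: algebra_simps)
  finally show ?case .
qed simp


section \<open>Differential operators\<close>

lemma diffop_apply_bound:
  assumes "degree A \<le> n"
  shows "diffop_apply A g = (\<Sum>k\<le>n. poly.coeff A k * (du ^^ k) g)"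
  unfolding diffop_apply_def
  by (rule sum.mono_neutral_left) (use assms in \<open>auto simp: coeff_eq_0\<close>)

lemma diffop_apply_less:
  assumes "\<And>k. k \<ge> n \<Longrightarrow> poly.coeff A k = 0"
  shows "diffop_apply A g = (\<Sum>k<n. poly.coeff A k * (du ^^ k) g)"
proof -
  have "diffop_apply A g = (\<Sum>k\<le>max n (degree A). poly.coeff A k * (du ^^ k) g)"
    by (rule diffop_apply_bound) simp
  also have "\<dots> = (\<Sum>k<n. poly.coeff A k * (du ^^ k) g)"
    by (rule sum.mono_neutral_right) (auto simp: assms)
  finally show ?thesis .
qed

lemma diffop_apply_add: "diffop_apply (A + B) g = diffop_apply A g + diffop_apply B g"
proof -
  let ?n = "max (degree A) (degree B)"
  have "degree (A + B) \<le> ?n" by (rule degree_add_le_max)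
  then show ?thesis
    by (simp add: diffop_apply_bound[of A ?n] diffop_apply_bound[of B ?n] diffop_apply_bound[of _ ?n]
        sum.distrib algebra_simps)
qed

lemma diffop_apply_smult: "diffop_apply (Polynomial.smult c A) g = c * diffop_apply A g"
proof -
  have "degree (Polynomial.smult c A) \<le> degree A" by (rule degree_smult_le)
  then show ?thesis
    by (simp add: diffop_apply_bound[of _ "degree A"] sum_distrib_left mult_ac)
qed

lemma diffop_apply_diff: "diffop_apply (A - B) g = diffop_apply A g - diffop_apply B g"
  using diffop_apply_add[of "A - B" B] by simp

lemma diffop_apply_1 [simp]: "diffop_apply 1 g = g"
  and diffop_apply_zero [simp]: "diffop_apply A 0 = 0"
  by (simp_all add: diffop_apply_def)

lemma diffop_apply_arg_add: "diffop_apply A (g + h) = diffop_apply A g + diffop_apply A h"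
  and diffop_apply_arg_cmult: "diffop_apply A (fls_const c * g) = fls_const c * diffop_apply A g"
  by (simp_all add: diffop_apply_def ring_distribs sum.distrib sum_distrib_left mult.left_commute)

lemma diffop_apply_arg_sum: "diffop_apply A (\<Sum>i\<in>I. g i) = (\<Sum>i\<in>I. diffop_apply A (g i))"
  by (induction I rule: infinite_finite_induct) (auto simp: diffop_apply_arg_add)

lemma coeff_d_times:
  "poly.coeff (d_times B) k = du (poly.coeff B k) + (if k = 0 then 0 else poly.coeff B (k - 1))"
  by (auto simp: d_times_def coeff_map_poly coeff_pCons split: nat.splits)

lemma diffop_apply_d_times: "diffop_apply (d_times B) g = du (diffop_apply B g)"
proof -
  let ?n = "Suc (degree B)"
  have "degree (d_times B) \<le> ?n"
    by (intro degree_le) (auto simp: coeff_d_times coeff_eq_0)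
  then have "diffop_apply (d_times B) g = (\<Sum>k\<le>?n. poly.coeff (d_times B) k * (du ^^ k) g)"
    by (rule diffop_apply_bound)
  also have "\<dots> = (\<Sum>k\<le>?n. du (poly.coeff B k) * (du ^^ k) g)
      + (\<Sum>k\<le>?n. (if k = 0 then 0 else poly.coeff B (k - 1)) * (du ^^ k) g)"
    by (simp add: coeff_d_times algebra_simps sum.distrib)
  also have "(\<Sum>k\<le>?n. (if k = 0 then 0 else poly.coeff B (k - 1)) * (du ^^ k) g)
      = (\<Sum>k\<le>degree B. poly.coeff B k * (du ^^ Suc k) g)"
    by (subst sum.atMost_Suc_shift) simp
  also have "(\<Sum>k\<le>?n. du (poly.coeff B k) * (du ^^ k) g)
      = (\<Sum>k\<le>degree B. du (poly.coeff B k) * (du ^^ k) g)"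
    by (simp add: coeff_eq_0)
  finally show ?thesis by (simp add: diffop_apply_def du_mult sum.distrib)
qed

text \<open>Composition of the first-order operator \<open>d/du - \<chi>\<close> with
  \<open>B\<close>, as \<open>diffop_mult_first_order\<close> confirms.\<close>

definition dfact :: "complex fls \<Rightarrow> diffop \<Rightarrow> diffop" where
  "dfact \<chi> B = d_times B - Polynomial.smult \<chi> B"

lemma coeff_dfact: "poly.coeff (dfact \<chi> B) k =
    du (poly.coeff B k) + (if k = 0 then 0 else poly.coeff B (k - 1)) - \<chi> * poly.coeff B k"
  by (simp add: dfact_def coeff_d_times)

lemma diffop_apply_dfact: "diffop_apply (dfact \<chi> B) g = du (diffop_apply B g) - \<chi> * diffop_apply B g"
  by (simp add: dfact_def diffop_apply_diff diffop_apply_d_times diffop_apply_smult)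

lemma diffop_mult_first_order: "diffop_mult (Polynomial.monom 1 1 - [:\<chi>:]) B = dfact \<chi> B"
proof -
  have d: "Polynomial.monom 1 1 - [:\<chi>:] = [:- \<chi>, 1:]" by (simp add: monom_altdef)
  have "diffop_mult [:- \<chi>, 1:] B = dfact \<chi> B"
    by (simp add: diffop_mult_def dfact_def)
  then show ?thesis unfolding d .
qed

lemma d_times_pow_1: "(d_times ^^ k) 1 = Polynomial.monom 1 k"
proof (induction k)
  case (Suc k)
  then show ?case
    by (auto simp: coeff_d_times intro!: poly_eqI)
qed simp

lemma diffop_mult_1_right: "diffop_mult A 1 = A"
  unfolding diffop_mult_def d_times_pow_1 by (simp add: smult_monom poly_as_sum_of_monoms)

lemma diffop_mult_const: "diffop_mult [:a:] B = [:a:] * B"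
  by (simp add: diffop_mult_def)

lemma diffop_prod_consts:
  "diffop_prod (map (\<lambda>i. [:c i:]) xs @ [L]) = (\<Prod>i\<leftarrow>xs. [:c i:]) * L"
  by (induction xs) (auto simp: diffop_prod_def diffop_mult_1_right diffop_mult_const mult_ac)

definition monic_op :: "nat \<Rightarrow> diffop \<Rightarrow> bool" where
  "monic_op m A \<longleftrightarrow> poly.coeff A m = 1 \<and> (\<forall>k>m. poly.coeff A k = 0)"

lemma monic_op_1: "monic_op 0 1"
  by (auto simp: monic_op_def)

lemma monic_op_dfact: "monic_op m A \<Longrightarrow> monic_op (Suc m) (dfact \<chi> A)"
  by (auto simp: monic_op_def coeff_dfact)

lemma leads_dfact:
  assumes "leads (diffop_apply A g) r c" "leads \<chi> 1 a"
  shows "leads (diffop_apply (dfact \<chi> A) g) (r + 1) ((- of_int r - a) * c)"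
  using leads_diff[OF leads_du[OF assms(1)] leads_mult[OF assms(2,1), unfolded add.commute[of 1 r]]]
  by (simp add: diffop_apply_dfact algebra_simps)

text \<open>Falling factorial: the \<open>k\<close>-th derivative of \<open>u^x\<close> is its value
  at \<open>x\<close> times \<open>u^(x - k)\<close>.\<close>

definition ffp :: "nat \<Rightarrow> complex poly" where
  "ffp k = (\<Prod>i<k. [:- of_nat i, 1:])"

lemma degree_ffp [simp]: "degree (ffp k) = k"
  by (simp add: ffp_def degree_prod_eq_sum_degree)

lemma lead_coeff_ffp [simp]: "poly.coeff (ffp k) k = 1"
proof -
  have "lead_coeff (ffp k) = 1"
    unfolding ffp_def lead_coeff_prod by simp
  then show ?thesis by simp
qed

lemma poly_ffp: "poly (ffp k) x = (\<Prod>i<k. x - of_nat i)"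
  by (simp add: ffp_def poly_prod)

(* The lowest-order part of A acts on powers of u through a nonzero polynomial of degree < m in the
   exponent, so it cannot vanish at m different exponents. *)
lemma diffop_eq_0I:
  assumes deg: "\<And>k. k \<ge> m \<Longrightarrow> poly.coeff A k = 0"
    and inj: "inj_on e {1..m}"
    and g: "\<And>i. i \<in> {1..m} \<Longrightarrow> \<exists>c. c \<noteq> 0 \<and> leads (g i) (- int (e i)) c"
    and kill: "\<And>i. i \<in> {1..m} \<Longrightarrow> diffop_apply A (g i) = 0"
  shows "A = 0"
proof (rule ccontr)
  assume A: "A \<noteq> 0"
  define K where "K = {k. poly.coeff A k \<noteq> 0}"
  have Km: "k < m" if "k \<in> K" for k
    using that deg[of k] by (force simp: K_def)
  then have "finite K" by (intro finite_subset[of K "{..<m}"]) auto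
  moreover have "K \<noteq> {}" using A leading_coeff_0_iff[of A] by (auto simp: K_def simp del: leading_coeff_0_iff)
  ultimately have K: "finite K" "K \<noteq> {}" by auto
  define val where "val k = fls_subdegree (poly.coeff A k) + int k" for k
  define r where "r = Min (val ` K)"
  have r_le: "r \<le> val k" if "k \<in> K" for k using that K by (auto simp: r_def)
  have "r \<in> val ` K" unfolding r_def using K by (intro Min_in) auto
  then obtain k0 where k0: "k0 \<in> K" "r = val k0" by auto
  define \<alpha> where "\<alpha> k = fls_nth (poly.coeff A k) (r - int k)" for k
  have lead: "leads (poly.coeff A k) (r - int k) (\<alpha> k)" for k
    using r_le[of k] by (cases "k \<in> K") (auto simp: leads_def \<alpha>_def K_def val_def)
  have \<alpha>0: "\<alpha> k0 \<noteq> 0" using k0 by (simp add: \<alpha>_def val_def K_def)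
  have \<alpha>m: "\<alpha> k = 0" if "k \<ge> m" for k using deg[OF that] by (simp add: \<alpha>_def)
  \<comment> \<open>On a series starting like \<open>u^x\<close> the lowest part multiplies the
    leading coefficient by \<open>Q(x)\<close>. Falling factorials have distinct degrees, so the
    coefficient of \<open>Q\<close> at the top index \<open>k1\<close> cannot cancel.\<close>
  define Q where "Q = (\<Sum>k<m. Polynomial.smult (\<alpha> k) (ffp k))"
  define k1 where "k1 = Max {k. \<alpha> k \<noteq> 0}"
  have fin: "finite {k. \<alpha> k \<noteq> 0}" 
  proof (rule finite_subset)
    have "k < m" if "\<alpha> k \<noteq> 0" for k
      by (rule ccontr) (use \<alpha>m[of k] that in auto)
    then show "{k. \<alpha> k \<noteq> 0} \<subseteq> {..<m}" by auto
  qed simp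
  have k1: "\<alpha> k1 \<noteq> 0" using Max_in[OF fin] \<alpha>0 by (auto simp: k1_def)
  have gt: "\<alpha> k = 0" if "k > k1" for k using Max_ge[OF fin, of k] that by (auto simp: k1_def)
  have k1m: "k1 < m" using k1 \<alpha>m not_le by blast
  have "poly.coeff Q k1 = (\<Sum>k<m. if k = k1 then \<alpha> k1 else 0)"
    unfolding Q_def coeff_sum
  proof (rule sum.cong)
    show "poly.coeff (Polynomial.smult (\<alpha> k) (ffp k)) k1 = (if k = k1 then \<alpha> k1 else 0)" for k
    proof (cases k k1 rule: linorder_cases)
      case less
      then show ?thesis by (simp add: coeff_eq_0)
    next
      case greater
      then show ?thesis using gt by simp
    qed simp
  qed simp
  then have "poly.coeff Q k1 \<noteq> 0" using k1 k1m by simp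
  then have Q0: "Q \<noteq> 0" by auto
  have "degree Q \<le> m - 1"
    unfolding Q_def by (rule degree_sum_le) (auto intro: order_trans[OF degree_smult_le])
  then have degQ: "degree Q < m" using k1m by linarith
  have root: "poly Q (of_nat (e i)) = 0" if i: "i \<in> {1..m}" for i
  proof -
    obtain c where c: "c \<noteq> 0" "leads (g i) (- int (e i)) c" using g[OF i] by auto
    have "fls_nth (poly.coeff A k * (du ^^ k) (g i)) (r - int (e i)) = \<alpha> k * (poly (ffp k) (of_nat (e i)) * c)" for k
    proof -
      have "leads ((du ^^ k) (g i)) (int k - int (e i)) (poly (ffp k) (of_nat (e i)) * c)"
        unfolding leads_def
      proof (intro conjI allI impI)
        fix n assume "n < int k - int (e i)"
        then have "fls_nth (g i) (n - int k) = 0" using c(2) by (auto simp: leads_def)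
        then show "fls_nth ((du ^^ k) (g i)) n = 0" by (simp only: dupow_nth mult_zero_right)
      next
        show "fls_nth ((du ^^ k) (g i)) (int k - int (e i)) = poly (ffp k) (of_nat (e i)) * c"
          using c(2) by (simp only: dupow_nth poly_ffp leads_def) simp
      qed
      from leads_mult[OF lead[of k] this] show ?thesis by (simp add: leads_def)
    qed
    note coeffs = this
    have "diffop_apply A (g i) = (\<Sum>k<m. poly.coeff A k * (du ^^ k) (g i))"
      by (rule diffop_apply_less) (rule deg)
    then have "fls_nth (diffop_apply A (g i)) (r - int (e i))
        = (\<Sum>k<m. fls_nth (poly.coeff A k * (du ^^ k) (g i)) (r - int (e i)))"
      by (simp only: fls_nth_sum)
    also have "\<dots> = (\<Sum>k<m. \<alpha> k * (poly (ffp k) (of_nat (e i)) * c))"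
      by (simp only: coeffs)
    also have "\<dots> = poly Q (of_nat (e i)) * c"
      by (simp add: Q_def poly_sum sum_distrib_right mult.assoc)
    finally have "fls_nth (diffop_apply A (g i)) (r - int (e i)) = poly Q (of_nat (e i)) * c" .
    then show ?thesis using kill[OF i] c(1) by simp
  qed
  have "card ((\<lambda>i. complex_of_nat (e i)) ` {1..m}) \<le> card {x. poly Q x = 0}"
    by (rule card_mono) (use root Q0 poly_roots_finite in auto)
  moreover have "inj_on (\<lambda>i. complex_of_nat (e i)) {1..m}"
    by (intro inj_onI) (use inj in \<open>simp add: inj_on_eq_iff\<close>)
  then have "card ((\<lambda>i. complex_of_nat (e i)) ` {1..m}) = m" by (simp add: card_image)
  moreover have "card {x. poly Q x = 0} \<le> degree Q" using Q0 by (rule card_poly_roots_bound)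
  ultimately show False using degQ by linarith
qed

text \<open>The leading terms cancel in \<open>A - B\<close>, so its order drops below the number of
  solutions of distinct degrees. Identifying monic operators thus reduces to comparing
  kernels.\<close>

lemma monic_op_eqI:
  assumes "monic_op m A" "monic_op m B" and inj: "inj_on e {1..m}"
    and g: "\<And>i. i \<in> {1..m} \<Longrightarrow> \<exists>c. c \<noteq> 0 \<and> leads (g i) (- int (e i)) c"
    and A: "\<And>i. i \<in> {1..m} \<Longrightarrow> diffop_apply A (g i) = 0"
    and B: "\<And>i. i \<in> {1..m} \<Longrightarrow> diffop_apply B (g i) = 0"
  shows "A = B"
proof -
  have "A - B = 0"
  proof (rule diffop_eq_0I[OF _ inj g])
    show "poly.coeff (A - B) k = 0" if "k \<ge> m" for k
      using that assms(1,2) by (cases "k = m") (auto simp: monic_op_def)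
  qed (use A B in \<open>auto simp: diffop_apply_diff\<close>)
  then show ?thesis by simp
qed

section \<open>Wronskians\<close>

text \<open>In each product, taken in the order of the rows, the first \<open>N\<close> factors are
  functions and the only genuine operator stands last. There the noncommutative product agrees with
  the product of type \<open>poly\<close>.\<close>

lemma rdet_eq_det:
  assumes "\<And>i j. i \<in> {1..N} \<Longrightarrow> A i j = [:c i j:]"
  shows "rdet (Suc N) A = det (mat (Suc N) (Suc N) (\<lambda>(i, j). A (Suc i) (Suc j)))"
proof -
  let ?P = "{0..<Suc N}" and ?Q = "{1..Suc N}"
  have bij: "bij_betw Suc ?P ?Q" "bij_betw (\<lambda>i. i - 1) ?Q ?P"
    by (rule bij_betw_byWitness[where f' = "\<lambda>i. i - 1"]; force)
       (rule bij_betw_byWitness[where f' = Suc]; force)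
  have prod: "diffop_prod (map (\<lambda>i. A i (\<sigma> i)) [1..<Suc (Suc N)]) = (\<Prod>i\<in>?Q. A i (\<sigma> i))" for \<sigma>
  proof -
    have "map (\<lambda>i. A i (\<sigma> i)) [1..<Suc (Suc N)]
        = map (\<lambda>i. [:c i (\<sigma> i):]) [1..<Suc N] @ [A (Suc N) (\<sigma> (Suc N))]"
      by (auto simp: assms)
    also have "diffop_prod \<dots> = (\<Prod>i\<leftarrow>[1..<Suc N]. [:c i (\<sigma> i):]) * A (Suc N) (\<sigma> (Suc N))"
      by (rule diffop_prod_consts)
    also have "(\<Prod>i\<leftarrow>[1..<Suc N]. [:c i (\<sigma> i):]) = (\<Prod>i\<in>{1..N}. A i (\<sigma> i))"
      by (subst prod.distinct_set_conv_list[symmetric]) (auto intro!: prod.cong simp: assms)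
    finally show ?thesis by (simp add: mult.commute)
  qed
  have "rdet (Suc N) A = (\<Sum>\<sigma> | \<sigma> permutes ?Q. of_int (sign \<sigma>) * (\<Prod>i\<in>?Q. A i (\<sigma> i)))"
    unfolding rdet_def prod ..
  \<comment> \<open>Permutations are transported along \<open>Suc\<close> from the 1-based rows to
    0-based matrix indices; this preserves signs.\<close>
  also have "\<dots> = (\<Sum>\<sigma> | \<sigma> permutes ?P. of_int (sign \<sigma>) * (\<Prod>i\<in>?P. A (Suc i) (Suc (\<sigma> i))))"
  proof (rule sum.reindex_bij_witness[of _ "map_permutation ?P Suc" "map_permutation ?Q (\<lambda>i. i - 1)"])
    fix \<sigma> assume \<sigma>: "\<sigma> \<in> {\<sigma>. \<sigma> permutes ?Q}"
    let ?\<tau> = "map_permutation ?Q (\<lambda>i. i - 1) \<sigma>"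
    show inv: "map_permutation ?P Suc ?\<tau> = \<sigma>"
      by (rule map_permutation_compose_inv[OF bij(2)]) (use \<sigma> in auto)
    show \<tau>: "?\<tau> \<in> {\<sigma>. \<sigma> permutes ?P}"
      using map_permutation_permutes[OF bij(2)] \<sigma> by auto
    have "sign ?\<tau> = sign \<sigma>"
      using evenperm_map_permutation[of "\<lambda>i. i - 1" ?Q \<sigma>] \<sigma> bij(2)
      by (simp add: sign_def bij_betw_def)
    moreover have "(\<Prod>i\<in>?P. A (Suc i) (Suc (?\<tau> i))) = (\<Prod>i\<in>?Q. A i (\<sigma> i))"
    proof (rule prod.reindex_bij_witness[of _ "\<lambda>i. i - 1" Suc])
      fix i assume i: "i \<in> ?P"
      have "Suc (?\<tau> i) = map_permutation ?P Suc ?\<tau> (Suc i)"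
        using i by (subst map_permutation_apply) auto
      then show "A (Suc i) (\<sigma> (Suc i)) = A (Suc i) (Suc (?\<tau> i))" unfolding inv by simp
    qed auto
    ultimately show "of_int (sign ?\<tau>) * (\<Prod>i\<in>?P. A (Suc i) (Suc (?\<tau> i)))
        = of_int (sign \<sigma>) * (\<Prod>i\<in>?Q. A i (\<sigma> i))" by simp
  next
    fix \<sigma> assume \<sigma>: "\<sigma> \<in> {\<sigma>. \<sigma> permutes ?P}"
    show "map_permutation ?Q (\<lambda>i. i - 1) (map_permutation ?P Suc \<sigma>) = \<sigma>"
      by (rule map_permutation_compose_inv[OF bij(1)]) (use \<sigma> in auto)
    show "map_permutation ?P Suc \<sigma> \<in> {\<sigma>. \<sigma> permutes ?Q}"
      using map_permutation_permutes[OF bij(1)] \<sigma> by auto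
  qed
  also have "\<dots> = det (mat (Suc N) (Suc N) (\<lambda>(i, j). A (Suc i) (Suc j)))"
  proof -
    have "\<sigma> i < Suc N" if "\<sigma> permutes ?P" "i < Suc N" for \<sigma> i
      using permutes_in_image[OF that(1), of i] that(2) by simp
    then show ?thesis unfolding det_def by (auto intro!: sum.cong prod.cong)
  qed
  finally show ?thesis .
qed

text \<open>The determinant with last row \<open>1, d/du, ..., (d/du)^m\<close>, expanded along that
  row and not yet divided by the Wronskian. The cofactors see only
  \<open>g 1, ..., g m\<close>.\<close>

definition wop :: "nat \<Rightarrow> (nat \<Rightarrow> complex fls) \<Rightarrow> diffop" where
  "wop m g = (\<Sum>k\<le>m. Polynomial.monom (cofactor (mat (Suc m) (Suc m) (\<lambda>(i, j). (du ^^ j) (g (Suc i)))) m k) k)"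

lemma wop_cong:
  assumes "\<And>i. i \<in> {1..m} \<Longrightarrow> g i = h i"
  shows "wop m g = wop m h"
proof -
  have "mat_delete (mat (Suc m) (Suc m) (\<lambda>(i, j). (du ^^ j) (g (Suc i)))) m k
      = mat_delete (mat (Suc m) (Suc m) (\<lambda>(i, j). (du ^^ j) (h (Suc i)))) m k" if "k \<le> m" for k
    unfolding mat_delete_def by (rule eq_matI) (use that assms in auto)
  then show ?thesis unfolding wop_def cofactor_def by (intro sum.cong) auto
qed

lemma wronskian_cong:
  assumes "\<And>i. i \<in> {1..m} \<Longrightarrow> g i = h i"
  shows "wronskian m g = wronskian m h"
  unfolding wronskian_def by (rule arg_cong[of _ _ det], rule eq_matI) (use assms in auto)

lemma coeff_wop: "poly.coeff (wop m g) k =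
   (if k \<le> m then cofactor (mat (Suc m) (Suc m) (\<lambda>(i, j). (du ^^ j) (g (Suc i)))) m k else 0)"
  by (simp add: wop_def coeff_sum)

lemma coeff_wop_top: "poly.coeff (wop m g) m = wronskian m g"
proof -
  have "mat_delete (mat (Suc m) (Suc m) (\<lambda>(i, j). (du ^^ j) (g (Suc i)))) m m
      = mat m m (\<lambda>(i, j). (du ^^ j) (g (Suc i)))"
    unfolding mat_delete_def by (rule eq_matI) auto
  then show ?thesis by (simp add: coeff_wop cofactor_def wronskian_def)
qed

text \<open>Applying the operator replaces the last row by the derivatives of \<open>h\<close>,
  which turns the Laplace expansion into that of a larger Wronskian.\<close>

lemma wop_apply: "diffop_apply (wop m g) h = wronskian (Suc m) (g(Suc m := h))"
proof -
  let ?g = "g(Suc m := h)"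
  let ?M = "mat (Suc m) (Suc m) (\<lambda>(i, j). (du ^^ j) (?g (Suc i)))"
  have "wop m g = wop m ?g" by (rule wop_cong) auto
  then have "diffop_apply (wop m g) h = (\<Sum>k<Suc m. poly.coeff (wop m ?g) k * (du ^^ k) h)"
    by (simp only:) (rule diffop_apply_less, auto simp: coeff_wop)
  also have "\<dots> = (\<Sum>k<Suc m. ?M $$ (m, k) * cofactor ?M m k)"
    by (rule sum.cong) (auto simp: coeff_wop)
  also have "\<dots> = det ?M"
    by (rule laplace_expansion_row[symmetric]) auto
  finally show ?thesis by (simp add: wronskian_def)
qed

lemma wronskian_Suc: "wronskian (Suc m) g = diffop_apply (wop m g) (g (Suc m))"
  by (simp add: wop_apply)

lemma wop_kills:
  assumes "i \<in> {1..m}" shows "diffop_apply (wop m g) (g i) = 0"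
  unfolding wop_apply wronskian_def
proof (rule det_identical_rows[of _ "Suc m" "i - 1" m])
  let ?g = "g(Suc m := g i)"
  show "row (mat (Suc m) (Suc m) (\<lambda>(i, j). (du ^^ j) (?g (Suc i)))) (i - 1)
      = row (mat (Suc m) (Suc m) (\<lambda>(i, j). (du ^^ j) (?g (Suc i)))) m"
    using assms by (intro eq_vecI) auto
qed (use assms in auto)

lemma rdet_eq_wop:
  "rdet (Suc N) (\<lambda>i j. if i \<le> N then [: (du ^^ (j - 1)) (f i) :] else Polynomial.monom 1 (j - 1)) = wop N f"
proof -
  let ?A = "\<lambda>i j. if i \<le> N then [: (du ^^ (j - 1)) (f i) :] else Polynomial.monom 1 (j - 1)"
  let ?M = "mat (Suc N) (Suc N) (\<lambda>(i, j). ?A (Suc i) (Suc j))"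
  let ?W = "mat (Suc N) (Suc N) (\<lambda>(i, j). (du ^^ j) (f (Suc i)))"
  interpret h: comm_ring_hom "\<lambda>a :: complex fls. [:a:]"
    by unfold_locales auto
  have "rdet (Suc N) ?A = det ?M"
    by (rule rdet_eq_det[where c = "\<lambda>i j. (du ^^ (j - 1)) (f i)"]) auto
  also have "\<dots> = (\<Sum>k<Suc N. ?M $$ (N, k) * cofactor ?M N k)"
    by (rule laplace_expansion_row) auto
  also have "\<dots> = (\<Sum>k<Suc N. Polynomial.monom (cofactor ?W N k) k)"
  proof (rule sum.cong[OF refl])
    fix k assume k: "k \<in> {..<Suc N}"
    have "mat_delete ?M N k = map_mat (\<lambda>a. [:a:]) (mat_delete ?W N k)"
      unfolding mat_delete_def by (rule eq_matI) (use k in auto)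
    then have "det (mat_delete ?M N k) = [:det (mat_delete ?W N k):]"
      by (simp only: h.hom_det)
    then have "cofactor ?M N k = [:cofactor ?W N k:]"
      unfolding cofactor_def by (cases "even (N + k)") (simp_all only: minus_one_power_iff, simp_all)
    then show "?M $$ (N, k) * cofactor ?M N k = Polynomial.monom (cofactor ?W N k) k"
      using k by (simp add: smult_monom mult.commute[of "Polynomial.monom 1 k"])
  qed
  finally show ?thesis by (simp add: wop_def lessThan_Suc_atMost)
qed

definition lop :: "nat \<Rightarrow> (nat \<Rightarrow> complex fls) \<Rightarrow> diffop" where
  "lop m g = Polynomial.smult (inverse (wronskian m g)) (wop m g)"

lemma D_W_eq: "D_W N lam X = lop N (\<lambda>i. poly_at_inf (flag_poly N lam X i))"
  by (simp add: D_W_def lop_def rdet_eq_wop Let_def)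

lemma monic_op_lop: "wronskian m g \<noteq> 0 \<Longrightarrow> monic_op m (lop m g)"
  by (auto simp: monic_op_def lop_def coeff_wop_top) (simp add: coeff_wop)

lemma lop_kills: "i \<in> {1..m} \<Longrightarrow> diffop_apply (lop m g) (g i) = 0"
  by (simp add: lop_def diffop_apply_smult wop_kills)

text \<open>A vector in the kernel of the Wronski matrix is the coefficient list of an operator of
  order below \<open>m\<close> that annihilates all the \<open>g i\<close>; distinct degrees exclude
  this.\<close>

lemma wronskian_nonzero:
  assumes inj: "inj_on e {1..m}"
    and g: "\<And>i. i \<in> {1..m} \<Longrightarrow> \<exists>c. c \<noteq> 0 \<and> leads (g i) (- int (e i)) c"
  shows "wronskian m g \<noteq> 0"
proof
  let ?M = "mat m m (\<lambda>(i, j). (du ^^ j) (g (Suc i)))"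
  assume "wronskian m g = 0"
  then have "\<exists>v. v \<in> carrier_vec m \<and> v \<noteq> 0\<^sub>v m \<and> ?M *\<^sub>v v = 0\<^sub>v m"
    unfolding wronskian_def by (subst det_0_iff_vec_prod_zero_field[symmetric]) auto
  then obtain v where v: "v \<in> carrier_vec m" "v \<noteq> 0\<^sub>v m" "?M *\<^sub>v v = 0\<^sub>v m" by auto
  define A where "A = (\<Sum>k<m. Polynomial.monom (v $ k) k)"
  have cA: "poly.coeff A k = (if k < m then v $ k else 0)" for k
    by (auto simp: A_def coeff_sum)
  have "A = 0"
  proof (rule diffop_eq_0I[OF _ inj g])
    fix i assume i: "i \<in> {1..m}"
    have "diffop_apply A (g i) = (\<Sum>k<m. poly.coeff A k * (du ^^ k) (g i))"
      by (rule diffop_apply_less) (simp add: cA)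
    also have "\<dots> = (?M *\<^sub>v v) $ (i - 1)"
      using i v(1) by (auto simp: cA scalar_prod_def lessThan_atLeast0 intro!: sum.cong)
    also have "\<dots> = 0" using v(3) i by auto
    finally show "diffop_apply A (g i) = 0" .
  qed (auto simp: cA)
  have "v = 0\<^sub>v m"
  proof (rule eq_vecI)
    fix i assume "i < dim_vec (0\<^sub>v m :: complex fls vec)"
    then show "v $ i = 0\<^sub>v m $ i" using cA[of i] \<open>A = 0\<close> by simp
  qed (use v in auto)
  then show False using v(2) by simp
qed

section \<open>Nested Wronskians of functions with increasing degrees\<close>

locale wronskian_chain =
  fixes N :: nat and g :: "nat \<Rightarrow> complex fls" and e :: "nat \<Rightarrow> nat"
  assumes e_mono: "\<And>i j. i \<in> {1..N} \<Longrightarrow> j \<in> {1..N} \<Longrightarrow> i < j \<Longrightarrow> e i < e j"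
    and g_lead: "\<And>i. i \<in> {1..N} \<Longrightarrow> leads (g i) (- int (e i)) 1"
begin

lemma inj_e: "m \<le> N \<Longrightarrow> inj_on e {1..m}"
proof (rule inj_onI)
  fix i j assume "m \<le> N" "i \<in> {1..m}" "j \<in> {1..m}" "e i = e j"
  then show "i = j" using e_mono[of i j] e_mono[of j i] by (cases i j rule: linorder_cases) auto
qed

lemma g_lead': "m \<le> N \<Longrightarrow> i \<in> {1..m} \<Longrightarrow> \<exists>c. c \<noteq> 0 \<and> leads (g i) (- int (e i)) c"
  using g_lead[of i] by (intro exI[of _ 1]) auto

abbreviation W :: "nat \<Rightarrow> complex fls" where "W m \<equiv> wronskian m g"

lemma W_nonzero: "m \<le> N \<Longrightarrow> W m \<noteq> 0"
  by (rule wronskian_nonzero[OF inj_e g_lead']) auto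

lemma W_0 [simp]: "W 0 = 1"
  by (simp add: wronskian_def)

lemma W_Suc: "m \<le> N \<Longrightarrow> diffop_apply (lop m g) (g (Suc m)) = W (Suc m) / W m"
  using W_nonzero[of m] by (simp add: lop_def diffop_apply_smult wronskian_Suc divide_inverse mult.commute)

lemma monic_lop: "m \<le> N \<Longrightarrow> monic_op m (lop m g)"
  by (rule monic_op_lop) (rule W_nonzero)

lemma lop_eqI:
  assumes "m \<le> N" "monic_op m A" "\<And>i. i \<in> {1..m} \<Longrightarrow> diffop_apply A (g i) = 0"
  shows "A = lop m g"
  by (rule monic_op_eqI[OF assms(2) monic_lop inj_e g_lead' assms(3) lop_kills]) (use assms in auto)

lemma lop_0: "lop 0 g = 1"
  by (rule sym, rule lop_eqI) (auto simp: monic_op_1)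

text \<open>The new factor is chosen to kill \<open>lop m g\<close> applied to
  \<open>g (Suc m)\<close>, which is \<open>W (Suc m) / W m\<close>. The earlier \<open>g i\<close>
  are killed already, and the kernel determines a monic operator.\<close>

lemma lop_Suc:
  assumes m: "m < N"
  shows "lop (Suc m) g = dfact (dlog (W (Suc m)) - dlog (W m)) (lop m g)"
proof (rule sym, rule lop_eqI)
  show "monic_op (Suc m) (dfact (dlog (W (Suc m)) - dlog (W m)) (lop m g))"
    using m by (intro monic_op_dfact monic_lop) auto
  fix i assume i: "i \<in> {1..Suc m}"
  show "diffop_apply (dfact (dlog (W (Suc m)) - dlog (W m)) (lop m g)) (g i) = 0"
  proof (cases "i = Suc m")
    case False
    then show ?thesis using i by (simp add: diffop_apply_dfact lop_kills)
  next
    case True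
    have nz: "W (Suc m) \<noteq> 0" "W m \<noteq> 0" using m W_nonzero by auto
    then have "dlog (W (Suc m)) - dlog (W m) = dlog (W (Suc m) / W m)" by (simp add: dlog_divide)
    then show ?thesis using True m nz by (simp add: diffop_apply_dfact W_Suc) (simp add: dlog_def)
  qed
qed (use m in auto)

text \<open>The degree of \<open>W m\<close> in \<open>u\<close>: the sum of the degrees of the
  functions, minus \<open>0 + 1 + ... + (m - 1)\<close> for the derivatives.\<close>

definition w :: "nat \<Rightarrow> int" where "w m = (\<Sum>i=1..m. int (e i) - int (i - 1))"

text \<open>Vandermonde determinant of the exponents; it is the leading coefficient of
  \<open>W m\<close>.\<close>

definition C :: "nat \<Rightarrow> complex" where
  "C m = (\<Prod>j=1..m. \<Prod>i=1..j - 1. of_nat (e j) - of_nat (e i))"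

lemma C_nonzero: "m \<le> N \<Longrightarrow> C m \<noteq> 0"
proof -
  assume m: "m \<le> N"
  have "(of_nat (e j) :: complex) \<noteq> of_nat (e i)" if "j \<in> {1..m}" "i \<in> {1..j - 1}" for i j
  proof -
    have "i \<in> {1..N}" "j \<in> {1..N}" "i < j" using that m by auto
    from e_mono[OF this] show ?thesis by simp
  qed
  then show ?thesis by (simp add: C_def)
qed

text \<open>The two claims need each other: the action of \<open>lop m g\<close> on leading terms,
  applied to \<open>g (Suc m)\<close>, gives the leading term of \<open>W (Suc m)\<close>, and this
  gives the next first-order factor. The product over \<open>e i\<close> is the indicial polynomial
  at infinity; its roots are the degrees of the solutions.\<close>

lemma leads_chain:
  "m \<le> N \<Longrightarrow> leads (W m) (- w m) (C m) \<and>
    (\<forall>h r c. leads h r c \<longrightarrow>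
      leads (diffop_apply (lop m g) h) (r + int m) ((\<Prod>i=1..m. - of_int r - of_nat (e i)) * c))"
proof (induction m)
  case 0
  show ?case by (auto simp: lop_0 leads_def w_def C_def)
next
  case (Suc m)
  then have m: "m < N" "m \<le> N" by auto
  note IH = Suc.IH[OF m(2)]
  have gS: "leads (g (Suc m)) (- int (e (Suc m))) 1" using m by (intro g_lead) auto
  have "W (Suc m) = W m * diffop_apply (lop m g) (g (Suc m))"
    using W_Suc[OF m(2)] W_nonzero[OF m(2)] by simp
  then have "leads (W (Suc m)) (- w m + (- int (e (Suc m)) + int m))
      (C m * ((\<Prod>i=1..m. - of_int (- int (e (Suc m))) - of_nat (e i)) * 1))"
    using leads_mult[OF conjunct1[OF IH] conjunct2[OF IH, rule_format, OF gS]] by simp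
  then have WS: "leads (W (Suc m)) (- w (Suc m)) (C (Suc m))"
    by (simp add: w_def C_def algebra_simps)
  \<comment> \<open>The degrees of the two Wronskians differ by \<open>e (Suc m) - m\<close>. The
    \<open>- m\<close> cancels against the order gained so far, and the factor contributes the root
    \<open>e (Suc m)\<close>.\<close>
  have \<chi>: "leads (dlog (W (Suc m)) - dlog (W m)) 1 (of_nat (e (Suc m)) - of_nat m)"
  proof -
    have "leads (dlog (W (Suc m)) - dlog (W m)) 1 (- of_int (- w (Suc m)) - (- of_int (- w m)))"
      by (intro leads_diff leads_dlog) (use WS IH C_nonzero Suc.prems m in auto)
    then show ?thesis by (simp add: w_def)
  qed
  have "leads (diffop_apply (lop (Suc m) g) h) (r + int (Suc m))
      ((\<Prod>i=1..Suc m. - of_int r - of_nat (e i)) * c)" if "leads h r c" for h r c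
  proof -
    have "leads (diffop_apply (lop m g) h) (r + int m) ((\<Prod>i=1..m. - of_int r - of_nat (e i)) * c)"
      using IH that by blast
    from leads_dfact[OF this \<chi>] show ?thesis
      unfolding lop_Suc[OF m(1)] by (simp add: algebra_simps)
  qed
  then show ?case using WS by blast
qed

text \<open>Abel's formula: each factor adds its \<open>- \<chi>\<close> to the subleading
  coefficient, and the logarithmic derivatives telescope.\<close>

lemma coeff_lop_pred:
  "Suc m \<le> N \<Longrightarrow> poly.coeff (lop (Suc m) g) m = - dlog (W (Suc m))"
proof (induction m)
  case 0
  then show ?case using lop_Suc[of 0] by (simp add: lop_0 coeff_dfact)
next
  case (Suc m)
  have "poly.coeff (lop (Suc m) g) (Suc m) = 1" using monic_lop[of "Suc m"] Suc.prems by (simp add: monic_op_def)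
  then show ?case using lop_Suc[of "Suc m"] Suc by (simp add: coeff_dfact)
qed

end

section \<open>Flag bases and Wronskian coordinates\<close>

interpretation poly_at_inf_hom: comm_ring_hom poly_at_inf
  by unfold_locales auto

definition poly_wronskian :: "nat \<Rightarrow> (nat \<Rightarrow> complex poly) \<Rightarrow> complex poly" where
  "poly_wronskian m f = det (mat m m (\<lambda>(i, j). (pderiv ^^ j) (f (Suc i))))"

lemma wronskian_poly_at_inf: "wronskian m (\<lambda>i. poly_at_inf (f i)) = poly_at_inf (poly_wronskian m f)"
proof -
  have "mat m m (\<lambda>(i, j). (du ^^ j) (poly_at_inf (f (Suc i))))
      = map_mat poly_at_inf (mat m m (\<lambda>(i, j). (pderiv ^^ j) (f (Suc i))))"
    by (rule eq_matI) auto
  then show ?thesis unfolding wronskian_def poly_wronskian_def by (simp only: poly_at_inf_hom.hom_det)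
qed

definition poly_cofactor :: "nat \<Rightarrow> (nat \<Rightarrow> complex poly) \<Rightarrow> nat \<Rightarrow> complex poly" where
  "poly_cofactor m f k =
     (if k \<le> m then cofactor (mat (Suc m) (Suc m) (\<lambda>(i, j). (pderiv ^^ j) (f (Suc i)))) m k else 0)"

lemma coeff_wop_poly_at_inf:
  "poly.coeff (wop m (\<lambda>i. poly_at_inf (f i))) k = poly_at_inf (poly_cofactor m f k)"
proof (cases "k \<le> m")
  case True
  have "mat_delete (mat (Suc m) (Suc m) (\<lambda>(i, j). (du ^^ j) (poly_at_inf (f (Suc i))))) m k
    = map_mat poly_at_inf (mat_delete (mat (Suc m) (Suc m) (\<lambda>(i, j). (pderiv ^^ j) (f (Suc i)))) m k)"
    unfolding mat_delete_def by (rule eq_matI) (use True in auto)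
  then show ?thesis using True
    by (cases "even (m + k)")
      (simp_all only: coeff_wop poly_cofactor_def cofactor_def poly_at_inf_hom.hom_det minus_one_power_iff,
        simp_all)
qed (simp add: coeff_wop poly_cofactor_def)

text \<open>A version of \<open>wop\<close> inside polynomials: the roots of Wronskians require
  values at points of the plane, which an expansion at infinity does not provide.\<close>

definition wopP :: "nat \<Rightarrow> (nat \<Rightarrow> complex poly) \<Rightarrow> complex poly \<Rightarrow> complex poly" where
  "wopP m f h = (\<Sum>k\<le>m. poly_cofactor m f k * (pderiv ^^ k) h)"

lemma poly_at_inf_wopP:
  "poly_at_inf (wopP m f h) = diffop_apply (wop m (\<lambda>i. poly_at_inf (f i))) (poly_at_inf h)"
proof -
  have "diffop_apply (wop m (\<lambda>i. poly_at_inf (f i))) (poly_at_inf h)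
     = (\<Sum>k<Suc m. poly.coeff (wop m (\<lambda>i. poly_at_inf (f i))) k * (du ^^ k) (poly_at_inf h))"
    by (rule diffop_apply_less) (auto simp: coeff_wop)
  also have "\<dots> = poly_at_inf (wopP m f h)"
    unfolding wopP_def by (simp add: coeff_wop_poly_at_inf lessThan_Suc_atMost)
  finally show ?thesis by simp
qed

section \<open>Coordinates of the cell and the operator attached to a quotient point\<close>

locale partition_data =
  fixes N :: nat and lam :: "nat \<Rightarrow> nat"
  assumes N_pos: "N > 0" and lam_mono: "\<forall>i\<in>{1..<N}. lam (Suc i) \<le> lam i"
begin

abbreviation d :: "nat \<Rightarrow> nat" where "d \<equiv> dexp N lam"
abbreviation P :: "nat set" where "P \<equiv> exponents N lam"
abbreviation l :: "nat \<Rightarrow> nat" where "l \<equiv> num_vars N lam"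
abbreviation IW :: "(nat \<times> nat) set" where "IW \<equiv> cell_index N lam"
abbreviation IC :: "(nat \<times> nat) set" where "IC \<equiv> crit_index N lam"

text \<open>Wronskians grow from the end of the flag basis, so the index \<open>m\<close> stands for \<open>N + 1 - m\<close>:
  \<open>e\<close> lists the exponents in increasing order.\<close>

definition e :: "nat \<Rightarrow> nat" where "e m = d (N + 1 - m)"

lemma lam_antimono: "1 \<le> i \<Longrightarrow> i \<le> j \<Longrightarrow> j \<le> N \<Longrightarrow> lam j \<le> lam i"
proof (induction j)
  case (Suc j)
  show ?case
  proof (cases "i = Suc j")
    case False
    then have "lam j \<le> lam i" using Suc by auto
    moreover have "lam (Suc j) \<le> lam j" using lam_mono Suc.prems False by auto
    ultimately show ?thesis by simp
  qed simp
qed simp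

lemma d_mono: "1 \<le> i \<Longrightarrow> i < j \<Longrightarrow> j \<le> N \<Longrightarrow> d j < d i"
  using lam_antimono[of i j] by (simp add: dexp_def)

lemma e_mono: "i \<in> {1..N} \<Longrightarrow> j \<in> {1..N} \<Longrightarrow> i < j \<Longrightarrow> e i < e j"
  unfolding e_def by (rule d_mono) auto

lemma e_altdef: "1 \<le> m \<Longrightarrow> m \<le> N \<Longrightarrow> e m = lam (N + 1 - m) + (m - 1)"
  by (simp add: e_def dexp_def)

lemma d_eq_e: "1 \<le> i \<Longrightarrow> i \<le> N \<Longrightarrow> d i = e (N + 1 - i)"
  by (simp add: e_def)

lemma P_eq_e: "P = e ` {1..N}"
proof -
  have "(\<lambda>i. N + 1 - i) ` {1..N} = {1..N}"
  proof
    show "{1..N} \<subseteq> (\<lambda>i. N + 1 - i) ` {1..N}"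
    proof
      fix j assume "j \<in> {1..N}"
      then show "j \<in> (\<lambda>i. N + 1 - i) ` {1..N}" by (intro image_eqI[of _ _ "N + 1 - j"]) auto
    qed
  qed auto
  then have "P = (\<lambda>i. d (N + 1 - i)) ` {1..N}"
    unfolding exponents_def by (metis image_image)
  then show ?thesis by (simp add: e_def)
qed

lemma finite_IC [simp]: "finite IC"
  by (rule finite_subset[of _ "SIGMA a:{..<N}. {..l a}"]) (auto simp: crit_index_def)

lemma l_N [simp]: "l N = 0"
  by (simp add: num_vars_def)

lemma l_step: "m < N \<Longrightarrow> l (N - Suc m) = l (N - m) + lam (N - m)"
  using sum.atLeast_Suc_atMost[of "N - m" N lam] by (simp add: num_vars_def Suc_diff_Suc)

text \<open>Total in \<open>x\<close>, so that points of the cell are handled as arbitrary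
  functions, without membership conditions.\<close>

definition fpoly :: "(nat \<times> nat \<Rightarrow> complex) \<Rightarrow> nat \<Rightarrow> complex poly" where
  "fpoly x i = (\<Sum>k\<le>d i. Polynomial.monom (if k = d i then 1 else if k \<in> P then 0 else x (i, d i - k)) k)"

lemma coeff_fpoly: "poly.coeff (fpoly x i) k =
   (if k = d i then 1 else if k < d i \<and> k \<notin> P then x (i, d i - k) else 0)"
  by (auto simp: fpoly_def coeff_sum)

lemma degree_fpoly [simp]: "degree (fpoly x i) = d i"
  by (rule antisym[OF degree_le le_degree]) (auto simp: coeff_fpoly)

lemma lead_coeff_fpoly [simp]: "poly.coeff (fpoly x i) (d i) = 1"
  by (simp add: coeff_fpoly)

lemma fpoly_cong: "(\<And>j. (i, j) \<in> IW \<Longrightarrow> x (i, j) = y (i, j)) \<Longrightarrow> i \<in> {1..N} \<Longrightarrow> fpoly x i = fpoly y i"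
  by (rule poly_eqI) (auto simp: coeff_fpoly cell_index_def)

definition F :: "(nat \<times> nat \<Rightarrow> complex) \<Rightarrow> nat \<Rightarrow> complex poly" where
  "F x m = fpoly x (N + 1 - m)"

lemma degree_F [simp]: "degree (F x m) = e m"
  by (simp add: F_def e_def)

lemma lead_coeff_F [simp]: "poly.coeff (F x m) (e m) = 1"
  by (simp add: F_def e_def)

abbreviation g :: "(nat \<times> nat \<Rightarrow> complex) \<Rightarrow> nat \<Rightarrow> complex fls" where
  "g x \<equiv> \<lambda>m. poly_at_inf (F x m)"

sublocale chain: wronskian_chain N "g x" e for x
  using e_mono leads_poly[of "F x i" for x i] by unfold_locales auto

definition Wp :: "(nat \<times> nat \<Rightarrow> complex) \<Rightarrow> nat \<Rightarrow> complex poly" where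
  "Wp x m = poly_wronskian m (F x)"

lemma W_eq: "wronskian m (g x) = poly_at_inf (Wp x m)"
  by (simp add: Wp_def wronskian_poly_at_inf)

lemma Wp_cong: "(\<And>i. i \<in> {1..m} \<Longrightarrow> F x i = F y i) \<Longrightarrow> Wp x m = Wp y m"
  unfolding Wp_def poly_wronskian_def by (rule arg_cong[of _ _ det], rule eq_matI) auto

abbreviation C :: "nat \<Rightarrow> complex" where "C \<equiv> chain.C"

text \<open>Since \<open>e i - (i - 1)\<close> is the part \<open>lam (N + 1 - i)\<close>, the
  degree of the Wronskian is the sum of the last \<open>m\<close> parts, which is the number of
  coordinates in group \<open>N - m\<close>.\<close>

lemma w_eq: "m \<le> N \<Longrightarrow> chain.w m = int (l (N - m))"
proof (induction m)
  case (Suc m)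
  then show ?case using l_step[of m] by (simp add: chain.w_def e_altdef)
qed (simp add: chain.w_def)

lemma leads_Wp: "m \<le> N \<Longrightarrow> leads (poly_at_inf (Wp x m)) (- int (l (N - m))) (C m)"
  using chain.leads_chain[of m x] by (simp add: W_eq w_eq)

lemma Wp_nonzero: "m \<le> N \<Longrightarrow> Wp x m \<noteq> 0"
  using chain.W_nonzero[of m x] by (simp add: W_eq)

lemma degree_lead_Wp:
  assumes "m \<le> N"
  shows "degree (Wp x m) = l (N - m)" "poly.coeff (Wp x m) (l (N - m)) = C m"
proof -
  have C: "C m \<noteq> 0" using chain.C_nonzero assms by simp
  have lc: "poly.coeff (Wp x m) (degree (Wp x m)) \<noteq> 0" using Wp_nonzero[OF assms] by simp
  have "fls_subdegree (poly_at_inf (Wp x m)) = - int (l (N - m))"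
    using leads_subdegree[OF leads_Wp[OF assms] C] .
  moreover have "fls_subdegree (poly_at_inf (Wp x m)) = - int (degree (Wp x m))"
    using leads_subdegree[OF leads_poly lc] .
  ultimately show "degree (Wp x m) = l (N - m)" by simp
  show "poly.coeff (Wp x m) (l (N - m)) = C m"
    using leads_Wp[OF assms, of x] by (simp add: leads_def poly_at_inf_nth)
qed

text \<open>Vieta's formula read backwards: the roots have the entries \<open>s (a, i)\<close> as
  elementary symmetric functions. It makes sense for every quotient point, without choosing
  roots.\<close>

definition cpoly :: "(nat \<times> nat \<Rightarrow> complex) \<Rightarrow> nat \<Rightarrow> complex poly" where
  "cpoly s a = (\<Sum>k\<le>l a. Polynomial.monom (if k = l a then 1 else (- 1) ^ (l a - k) * s (a, l a - k)) k)"

lemma coeff_cpoly: "poly.coeff (cpoly s a) k =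
   (if k = l a then 1 else if k < l a then (- 1) ^ (l a - k) * s (a, l a - k) else 0)"
  by (auto simp: cpoly_def coeff_sum)

lemma degree_cpoly [simp]: "degree (cpoly s a) = l a"
  by (rule antisym[OF degree_le le_degree]) (auto simp: coeff_cpoly)

lemma cpoly_nonzero [simp]: "cpoly s a \<noteq> 0"
  using coeff_cpoly[of s a "l a"] by auto

lemma cpoly_N [simp]: "cpoly s N = 1"
  by (rule poly_eqI) (auto simp: coeff_cpoly)

lemma leads_cpoly: "leads (poly_at_inf (cpoly s a)) (- int (l a)) 1"
  using leads_poly[of "cpoly s a"] by (simp add: coeff_cpoly)

lemma cpoly_inject:
  assumes "s \<in> affine_points IC" "s' \<in> affine_points IC" "\<And>a. a < N \<Longrightarrow> cpoly s a = cpoly s' a"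
  shows "s = s'"
proof (rule PiE_ext[of _ IC "\<lambda>_. UNIV"])
  fix v assume v: "v \<in> IC"
  obtain a i where ai: "v = (a, i)" by (cases v)
  then have "a < N" "1 \<le> i" "i \<le> l a" using v by (auto simp: crit_index_def)
  then have i: "l a - i \<noteq> l a" "l a - i < l a" "l a - (l a - i) = i" by auto
  then show "s v = s' v"
    using arg_cong[OF assms(3)[OF \<open>a < N\<close>], of "\<lambda>p. poly.coeff p (l a - i)"]
    unfolding coeff_cpoly i(3) ai using i(1,2) by simp
qed (use assms in \<open>auto simp: affine_points_def\<close>)

text \<open>\<open>psi\<close> is the inverse of \<open>\<iota>\<close> in coordinates.\<close>

definition psi :: "(nat \<times> nat \<Rightarrow> complex) \<Rightarrow> nat \<times> nat \<Rightarrow> complex" where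
  "psi x = (\<lambda>v\<in>IC. (- 1) ^ snd v * poly.coeff (Wp x (N - fst v)) (l (fst v) - snd v) / C (N - fst v))"

lemma psi_affine [simp]: "psi x \<in> affine_points IC"
  by (simp add: psi_def affine_points_def)

lemma cpoly_psi:
  assumes "a \<le> N"
  shows "cpoly (psi x) a = Polynomial.smult (inverse (C (N - a))) (Wp x (N - a))"
proof (cases "a = N")
  case True
  then show ?thesis by (simp add: Wp_def poly_wronskian_def chain.C_def)
next
  case False
  have C: "C (N - a) \<noteq> 0" using chain.C_nonzero by simp
  have deg: "degree (Wp x (N - a)) = l a" "poly.coeff (Wp x (N - a)) (l a) = C (N - a)"
    using degree_lead_Wp[of "N - a" x] assms by auto
  show ?thesis
  proof (rule poly_eqI)
    fix k
    consider "k = l a" | "k < l a" | "k > l a" by linarith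
    then show "poly.coeff (cpoly (psi x) a) k
      = poly.coeff (Polynomial.smult (inverse (C (N - a))) (Wp x (N - a))) k"
    proof cases
      case 2
      then have "(a, l a - k) \<in> IC" using False assms by (auto simp: crit_index_def)
      then show ?thesis using 2
        by (cases "even (l a - k)") (simp_all add: coeff_cpoly psi_def field_simps C)
    qed (auto simp: coeff_cpoly deg C coeff_eq_0)
  qed
qed

abbreviation PP :: "(nat \<times> nat \<Rightarrow> complex) \<Rightarrow> nat \<Rightarrow> complex fls" where
  "PP s m \<equiv> poly_at_inf (cpoly s (N - m))"

lemma PP_psi: "m \<le> N \<Longrightarrow> PP (psi x) m = fls_const (inverse (C m)) * wronskian m (g x)"
  by (simp add: cpoly_psi W_eq)

text \<open>The product of the last \<open>m\<close> factors of \<open>D_T\<close>, written in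
  quotient coordinates. The recursion is that of \<open>lop_Suc\<close>, with monic polynomials in
  place of Wronskians.\<close>

fun PD :: "(nat \<times> nat \<Rightarrow> complex) \<Rightarrow> nat \<Rightarrow> diffop" where
  "PD s 0 = 1"
| "PD s (Suc m) = dfact (dlog (PP s (Suc m)) - dlog (PP s m)) (PD s m)"

lemma monic_PD: "monic_op m (PD s m)"
  by (induction m) (auto intro: monic_op_1 monic_op_dfact)

lemma PD_psi: "m \<le> N \<Longrightarrow> PD (psi x) m = lop m (g x)"
proof (induction m)
  case (Suc m)
  have "dlog (PP (psi x) k) = dlog (wronskian k (g x))" if "k \<le> N" for k
    using that chain.C_nonzero[of k] chain.W_nonzero[of k x] by (simp only: PP_psi) (rule dlog_cmult, auto)
  then show ?case using Suc chain.lop_Suc[of m x] by simp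
qed (simp add: chain.lop_0)

lemma PD_psi_kills: "i \<in> {1..N} \<Longrightarrow> diffop_apply (PD (psi x) N) (g x i) = 0"
  using lop_kills[of i N "g x"] PD_psi[of N x] by simp

text \<open>Only the degrees of the polynomials \<open>cpoly s a\<close> enter, so the indicial
  polynomial at infinity is the same for every quotient point, critical or not.\<close>

lemma leads_PD:
  assumes "m \<le> N" "leads h r c"
  shows "leads (diffop_apply (PD s m) h) (r + int m) ((\<Prod>i=1..m. - of_int r - of_nat (e i)) * c)"
  using assms(1)
proof (induction m)
  case (Suc m)
  have "leads (dlog (PP s (Suc m)) - dlog (PP s m)) 1 (- of_int (- int (l (N - Suc m))) - (- of_int (- int (l (N - m)))))"
    by (intro leads_diff leads_dlog[OF leads_cpoly]) auto
  moreover have "- of_int (- int (l (N - Suc m))) - (- of_int (- int (l (N - m)))) = (of_nat (e (Suc m)) - of_nat m :: complex)"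
    using Suc.prems l_step[of m] by (simp add: e_altdef)
  ultimately have "leads (dlog (PP s (Suc m)) - dlog (PP s m)) 1 (of_nat (e (Suc m)) - of_nat m)" by simp
  from leads_dfact[OF Suc.IH this] Suc.prems show ?case by (simp add: algebra_simps)
qed (use assms(2) in simp)

lemma PD_eqI:
  assumes "\<And>i. i \<in> {1..N} \<Longrightarrow> diffop_apply A (g x i) = 0" "monic_op N A"
    "\<And>i. i \<in> {1..N} \<Longrightarrow> diffop_apply B (g x i) = 0" "monic_op N B"
  shows "A = B"
  using chain.lop_eqI[of N A x] chain.lop_eqI[of N B x] assms by simp

lemma g_kill_iff: "(\<forall>m\<in>{1..N}. diffop_apply A (g x m) = 0)
   \<longleftrightarrow> (\<forall>i\<in>{1..N}. diffop_apply A (poly_at_inf (fpoly x i)) = 0)"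
proof (intro iffI ballI)
  fix i assume *: "\<forall>m\<in>{1..N}. diffop_apply A (g x m) = 0" "i \<in> {1..N}"
  have "N + 1 - i \<in> {1..N}" "N + 1 - (N + 1 - i) = i" using *(2) by auto
  then show "diffop_apply A (poly_at_inf (fpoly x i)) = 0"
    using *(1) unfolding F_def by metis
next
  fix m assume *: "\<forall>i\<in>{1..N}. diffop_apply A (poly_at_inf (fpoly x i)) = 0" "m \<in> {1..N}"
  have "N + 1 - m \<in> {1..N}" using *(2) by auto
  then show "diffop_apply A (g x m) = 0"
    using *(1) unfolding F_def by blast
qed

text \<open>The left side lists the flag basis by decreasing degree and \<open>PD\<close> is built
  by increasing degree. Both operators are monic and kill the same \<open>N\<close>
  polynomials.\<close>

lemma lop_fpoly_eq_PD: "lop N (\<lambda>i. poly_at_inf (fpoly x i)) = PD (psi x) N"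
proof (rule PD_eqI[of _ x])
  let ?f = "\<lambda>i. poly_at_inf (fpoly x i)"
  have inj: "inj_on d {1..N}"
    by (rule inj_onI) (metis atLeastAtMost_iff d_mono linorder_neqE_nat nat_neq_iff)
  have "wronskian N ?f \<noteq> 0"
    using leads_poly[of "fpoly x i" for i] by (intro wronskian_nonzero[OF inj]) (auto intro!: exI[of _ 1])
  then show "monic_op N (lop N ?f)" by (rule monic_op_lop)
  show "diffop_apply (lop N ?f) (g x i) = 0" if "i \<in> {1..N}" for i
    using that lop_kills[of _ N ?f] by (intro bspec[OF g_kill_iff[THEN iffD2]]) auto
qed (auto simp: PD_psi_kills monic_PD)

text \<open>Expansion of the product over the sets \<open>Y\<close> of factors that contribute their
  constant term.\<close>

lemma cpoly_quotient_map:
  assumes "a < N"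
  shows "cpoly (quotient_map N lam T) a = (\<Prod>i=1..l a. [:- T (a, i), 1:])"
proof (rule poly_eqI)
  fix k
  let ?A = "{1..l a}"
  have "(\<Prod>i\<in>?A. [:- T (a, i), 1:]) = (\<Prod>i\<in>?A. [:- T (a, i):] + Polynomial.monom 1 1)"
    by (simp add: monom_altdef)
  also have "\<dots> = (\<Sum>Y\<in>Pow ?A. (\<Prod>i\<in>Y. [:- T (a, i):]) * (\<Prod>i\<in>?A - Y. Polynomial.monom 1 1))"
    by (rule prod_add) simp
  also have "\<dots> = (\<Sum>Y\<in>Pow ?A. Polynomial.monom ((- 1) ^ card Y * (\<Prod>i\<in>Y. T (a, i))) (l a - card Y))"
  proof (rule sum.cong[OF refl])
    fix Y assume Y: "Y \<in> Pow ?A"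
    then have fin: "finite Y" using finite_subset by auto
    have "(\<Prod>i\<in>Y. [:- T (a, i):]) = [:\<Prod>i\<in>Y. - T (a, i):]"
      using fin by (induction Y) (auto simp: one_pCons)
    moreover have "(\<Prod>i\<in>?A - Y. Polynomial.monom (1::complex) 1) = Polynomial.monom 1 (l a - card Y)"
      using Y fin by (simp add: card_Diff_subset monom_power)
    ultimately show "(\<Prod>i\<in>Y. [:- T (a, i):]) * (\<Prod>i\<in>?A - Y. Polynomial.monom 1 1)
       = Polynomial.monom ((- 1) ^ card Y * (\<Prod>i\<in>Y. T (a, i))) (l a - card Y)"
      by (simp add: prod_uminus smult_monom)
  qed
  finally have "poly.coeff (\<Prod>i\<in>?A. [:- T (a, i), 1:]) k
     = (\<Sum>Y\<in>Pow ?A. if l a - card Y = k then (- 1) ^ card Y * (\<Prod>i\<in>Y. T (a, i)) else 0)"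
    by (simp add: coeff_sum)
  also have "\<dots> = (\<Sum>Y | Y \<subseteq> ?A \<and> l a - card Y = k. (- 1) ^ card Y * (\<Prod>i\<in>Y. T (a, i)))"
    by (simp add: sum.If_cases Int_def Pow_def)
  also have "\<dots> = poly.coeff (cpoly (quotient_map N lam T) a) k"
  proof -
    have card: "card Y \<le> l a" "finite Y" if "Y \<subseteq> ?A" for Y
      using that card_mono[of ?A Y] finite_subset[of Y ?A] by auto
    \<comment> \<open>Subtraction is truncated, so \<open>l a - card Y = k\<close> is solved for
      \<open>card Y\<close> only after \<open>card Y \<le> l a\<close> is known. At
      \<open>k = l a\<close> the empty set alone remains.\<close>
    consider "k = l a" | "k < l a" | "k > l a" by linarith
    then show ?thesis
    proof cases
      case 1
      have "{Y. Y \<subseteq> ?A \<and> l a - card Y = k} = {{}}"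
      proof (rule equalityI; rule subsetI)
        fix Y assume "Y \<in> {Y. Y \<subseteq> ?A \<and> l a - card Y = k}"
        then have Y: "Y \<subseteq> ?A" "l a - card Y = l a" using 1 by auto
        have "card Y \<noteq> 0" if "Y \<noteq> {}" using card[OF Y(1)] that by auto
        then have "Y = {} \<or> l a = 0" using card[OF Y(1)] Y(2) by linarith
        then show "Y \<in> {{}}" using Y(1) by auto
      qed (use 1 in auto)
      then show ?thesis using 1 by (simp add: coeff_cpoly)
    next
      case 2
      have eq: "{Y. Y \<subseteq> ?A \<and> l a - card Y = k} = {Y. Y \<subseteq> ?A \<and> card Y = l a - k}"
      proof (rule Collect_cong, rule conj_cong[OF refl])
        fix Y assume "Y \<subseteq> ?A"
        then show "(l a - card Y = k) = (card Y = l a - k)" using card[of Y] 2 by auto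
      qed
      have "(a, l a - k) \<in> IC" using assms 2 by (auto simp: crit_index_def)
      then show ?thesis unfolding eq using 2
        by (simp add: coeff_cpoly quotient_map_def sum_distrib_left)
    next
      case 3
      then have "{Y. Y \<subseteq> ?A \<and> l a - card Y = k} = {}" by auto
      then show ?thesis using 3 by (simp only: coeff_cpoly) simp
    qed
  qed
  finally show "poly.coeff (cpoly (quotient_map N lam T) a) k = poly.coeff (\<Prod>i=1..l a. [:- T (a, i), 1:]) k" ..
qed

lemma quotient_map_affine [simp]: "quotient_map N lam T \<in> affine_points IC"
  by (simp add: quotient_map_def affine_points_def)

lemma dlog_linear_product:
  "dlog (poly_at_inf (\<Prod>i\<in>A. [:- c i, 1:])) = (\<Sum>i\<in>A. 1 / (fls_X_inv - fls_const (c i)))"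
proof -
  have lin: "poly_at_inf [:- c, 1:] = fls_X_inv - fls_const c" for c
    by (simp add: poly_at_inf_pCons)
  have "dlog (poly_at_inf [:- c, 1:]) = 1 / (fls_X_inv - fls_const c)" for c
    unfolding dlog_def by (subst lin[symmetric]) (simp add: pderiv_pCons)
  moreover have "poly_at_inf [:- c, 1:] \<noteq> 0" for c by simp
  ultimately show ?thesis unfolding poly_at_inf_prod by (subst dlog_prod) auto
qed

lemma dlog_cpoly:
  "a \<le> N \<Longrightarrow> dlog (poly_at_inf (cpoly (quotient_map N lam T) a))
     = (\<Sum>i=1..l a. 1 / (fls_X_inv - fls_const (T (a, i))))"
  by (cases "a = N") (simp_all add: cpoly_quotient_map dlog_linear_product del: poly_at_inf_prod)

lemma chi_eq: "a \<in> {1..N} \<Longrightarrow> chi N lam T a =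
    dlog (PP (quotient_map N lam T) (Suc (N - a))) - dlog (PP (quotient_map N lam T) (N - a))"
proof -
  assume a: "a \<in> {1..N}"
  then have "N - Suc (N - a) = a - 1" "N - (N - a) = a" "a - 1 \<le> N" "a \<le> N" by auto
  then show ?thesis unfolding chi_def by (simp only: dlog_cpoly)
qed

text \<open>The product is built from the right: the factor with index \<open>N - k\<close> is the
  one added in step \<open>Suc k\<close> of \<open>PD\<close>.\<close>

lemma D_T_eq: "D_T N lam T = PD (quotient_map N lam T) N"
proof -
  have "k \<le> N \<Longrightarrow> diffop_prod (map (\<lambda>a. Polynomial.monom 1 1 - [: chi N lam T a :]) [Suc (N - k)..<Suc N])
    = PD (quotient_map N lam T) k" for k
  proof (induction k)
    case (Suc k)
    then have "[Suc (N - Suc k)..<Suc N] = (N - k) # [Suc (N - k)..<Suc N]"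
      by (metis Suc_diff_Suc Suc_le_lessD diff_le_self less_Suc_eq_le upt_conv_Cons)
    moreover have "chi N lam T (N - k) = dlog (PP (quotient_map N lam T) (Suc k)) - dlog (PP (quotient_map N lam T) k)"
      using chi_eq[of "N - k" T] Suc.prems by simp
    ultimately show ?case using Suc diffop_mult_first_order
      by (simp add: diffop_prod_def del: upt_Suc One_nat_def)
  qed (simp add: diffop_prod_def)
  from this[of N] show ?thesis by (simp add: D_T_def)
qed

end

section \<open>Homogeneity\<close>

text \<open>A permutation only rearranges the column degrees, so all summands of the determinant
  have the same degree.\<close>

lemma (in graded_functions) G_det:
  assumes "\<And>i j. i < m \<Longrightarrow> j < m \<Longrightarrow> (\<lambda>p. M p i j) \<in> G (int j - a i)"
  shows "(\<lambda>p. det (mat m m (\<lambda>(i, j). M p i j))) \<in> G ((\<Sum>i<m. int i) - (\<Sum>i<m. a i))"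
proof -
  have "(\<lambda>p. \<Sum>\<sigma> | \<sigma> permutes {0..<m}. signof \<sigma> * (\<Prod>i = 0..<m. M p i (\<sigma> i)))
      \<in> G ((\<Sum>i<m. int i) - (\<Sum>i<m. a i))"
  proof (rule G_sum)
    fix \<sigma> assume \<sigma>: "\<sigma> \<in> {\<sigma>. \<sigma> permutes {0..<m}}"
    have \<sigma>m: "\<sigma> i < m" if "i < m" for i using permutes_in_image[of \<sigma> "{0..<m}" i] \<sigma> that by auto
    have "(\<Sum>i = 0..<m. int (\<sigma> i)) = (\<Sum>i = 0..<m. int i)"
      using \<sigma> by (intro sum.permute[symmetric, unfolded comp_def]) auto
    then have deg: "(\<Sum>i = 0..<m. int (\<sigma> i) - a i) = (\<Sum>i<m. int i) - (\<Sum>i<m. a i)"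
      by (simp add: sum_subtractf lessThan_atLeast0)
    have "(\<lambda>p. \<Prod>i = 0..<m. M p i (\<sigma> i)) \<in> G (\<Sum>i = 0..<m. int (\<sigma> i) - a i)"
      by (rule G_prod) (use assms \<sigma>m in auto)
    then have "(\<lambda>p. fls_const (of_int (sign \<sigma>)) * (\<Prod>i = 0..<m. M p i (\<sigma> i))) \<in> G (0 + ((\<Sum>i<m. int i) - (\<Sum>i<m. a i)))"
      unfolding deg by (intro G_mult G_const)
    then show "(\<lambda>p. signof \<sigma> * (\<Prod>i = 0..<m. M p i (\<sigma> i))) \<in> G ((\<Sum>i<m. int i) - (\<Sum>i<m. a i))"
      by (simp add: fls_of_int)
  qed
  moreover have "det (mat m m (\<lambda>(i, j). M p i j)) = (\<Sum>\<sigma> | \<sigma> permutes {0..<m}. signof \<sigma> * (\<Prod>i = 0..<m. M p i (\<sigma> i)))" for p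
  proof -
    have "\<sigma> i < m" if "\<sigma> permutes {0..<m}" "i < m" for \<sigma> i
      using permutes_in_image[OF that(1), of i] that(2) by simp
    then show ?thesis unfolding det_def by (auto intro!: sum.cong prod.cong)
  qed
  ultimately show ?thesis by simp
qed

lemma (in graded_functions) G_poly_at_inf:
  assumes deg: "\<And>p. p \<in> S \<Longrightarrow> degree (f p) \<le> n"
    and f: "\<And>k. k \<le> n \<Longrightarrow> (\<lambda>p. poly.coeff (f p) (n - k)) \<in> H k"
  shows "(\<lambda>p. poly_at_inf (f p)) \<in> G (- int n)"
  unfolding G_def
proof safe
  fix j p assume *: "j < - int n" "p \<in> S"
  then have "degree (f p) < nat (- j)" using deg[of p] by auto
  then show "fls_nth (poly_at_inf (f p)) j = 0" by (simp add: poly_at_inf_nth coeff_eq_0)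
next
  fix k
  show "(\<lambda>p. fls_nth (poly_at_inf (f p)) (- int n + int k)) \<in> H k"
  proof (cases "k \<le> n")
    case True
    have "nat (- (- int n + int k)) = n - k" by auto
    then show ?thesis using f[OF True] True by (simp add: poly_at_inf_nth)
  next
    case False
    then show ?thesis by (simp add: poly_at_inf_nth zero)
  qed
qed

lemma dupow_X_inv_power: "(du ^^ q) (fls_X_inv ^ k) = fls_const (poly (ffp q) (of_nat k)) * fls_shift (int k - int q) 1"
proof (rule fls_eqI)
  fix n
  show "fls_nth ((du ^^ q) (fls_X_inv ^ k)) n = fls_nth (fls_const (poly (ffp q) (of_nat k)) * fls_shift (int k - int q) 1) n"
  proof (cases "n = int q - int k")
    case True
    then show ?thesis by (simp add: dupow_nth poly_ffp)
  next
    case False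
    then show ?thesis by (auto simp: dupow_nth)
  qed
qed

lemma poly_at_inf_monom: "poly_at_inf (Polynomial.monom c k) = fls_const c * fls_X_inv ^ k"
proof (rule fls_eqI)
  fix n :: int
  have "(n \<le> 0 \<and> k = nat (- n)) = (n = - int k)" by auto
  then show "fls_nth (poly_at_inf (Polynomial.monom c k)) n = fls_nth (fls_const c * fls_X_inv ^ k) n"
    by (auto simp: poly_at_inf_nth)
qed

lemma diffop_apply_X_inv_power:
  assumes "\<And>q. q > N \<Longrightarrow> poly.coeff A q = 0"
  shows "fls_nth (diffop_apply A (fls_X_inv ^ k)) n
    = (\<Sum>q\<le>N. poly (ffp q) (of_nat k) * fls_nth (poly.coeff A q) (n + int k - int q))"
proof -
  have "diffop_apply A (fls_X_inv ^ k) = (\<Sum>q<Suc N. poly.coeff A q * (du ^^ q) (fls_X_inv ^ k))"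
    by (rule diffop_apply_less) (simp add: assms)
  moreover have "poly.coeff A q * (du ^^ q) (fls_X_inv ^ k)
     = fls_const (poly (ffp q) (of_nat k)) * fls_shift (int k - int q) (poly.coeff A q)" for q
    by (simp add: dupow_X_inv_power fls_shifted_times_simps mult.commute)
  ultimately show ?thesis by (simp add: fls_nth_sum lessThan_Suc_atMost algebra_simps)
qed

context partition_data begin

lemma coeff_fpoly_graded:
  assumes "graded_functions S H" and x: "\<And>v. v \<in> IW \<Longrightarrow> (\<lambda>p. x p v) \<in> H (snd v)"
    and i: "i \<in> {1..N}" and k: "k \<le> d i"
  shows "(\<lambda>p. poly.coeff (fpoly (x p) i) (d i - k)) \<in> H k"
proof -
  interpret graded_functions S H by fact
  consider "k = 0" | "k > 0" "d i - k \<in> P" | "k > 0" "d i - k \<notin> P" by blast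
  then show ?thesis
  proof cases
    case 1
    then show ?thesis by (simp add: coeff_fpoly const)
  next
    case 2
    then have "poly.coeff (fpoly (x p) i) (d i - k) = 0" for p using k by (simp add: coeff_fpoly)
    then show ?thesis by (simp add: zero)
  next
    case 3
    then have v: "(i, k) \<in> IW" using i k by (auto simp: cell_index_def)
    have "poly.coeff (fpoly (x p) i) (d i - k) = x p (i, k)" for p
      using 3 k by (simp add: coeff_fpoly)
    then show ?thesis using x[OF v] by simp
  qed
qed

lemma W_graded:
  assumes "graded_functions S H" and x: "\<And>v. v \<in> IW \<Longrightarrow> (\<lambda>p. x p v) \<in> H (snd v)"
    and m: "m \<le> N"
  shows "(\<lambda>p. poly_at_inf (Wp (x p) m)) \<in> graded_functions.G S H (- int (l (N - m)))"
proof -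
  interpret graded_functions S H by fact
  have gG: "(\<lambda>p. g (x p) i) \<in> G (- int (e i))" if "i \<in> {1..N}" for i
  proof (rule G_poly_at_inf)
    fix k assume "k \<le> e i"
    then have "k \<le> d (N + 1 - i)" by (simp add: e_def)
    then show "(\<lambda>p. poly.coeff (F (x p) i) (e i - k)) \<in> H k"
      unfolding F_def e_def using that by (intro coeff_fpoly_graded[OF assms(1) x]) auto
  qed simp
  have "(\<lambda>p. det (mat m m (\<lambda>(i, j). (du ^^ j) (g (x p) (Suc i))))) \<in> G ((\<Sum>i<m. int i) - (\<Sum>i<m. int (e (Suc i))))"
  proof (rule G_det)
    fix i j assume ij: "i < m" "j < m"
    have "(\<lambda>p. (du ^^ j) (g (x p) (Suc i))) \<in> G (- int (e (Suc i)) + int j)"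
      by (rule G_dupow[OF gG]) (use ij m in auto)
    then show "(\<lambda>p. (du ^^ j) (g (x p) (Suc i))) \<in> G (int j - int (e (Suc i)))" by simp
  qed
  moreover have "(\<Sum>i<m. int i) - (\<Sum>i<m. int (e (Suc i))) = - int (l (N - m))"
  proof -
    have "(\<Sum>i<m. int i) - (\<Sum>i<m. int (e (Suc i))) = - (\<Sum>i<m. int (e (Suc i)) - int i)"
      by (simp add: sum_subtractf)
    also have "(\<Sum>i<m. int (e (Suc i)) - int i) = chain.w m"
      unfolding chain.w_def by (rule sum.reindex_bij_witness[of _ "\<lambda>i. i - 1" Suc]) auto
    finally show ?thesis using w_eq[OF m] by simp
  qed
  ultimately show ?thesis unfolding W_eq[symmetric] wronskian_def by simp
qed

lemma psi_graded:
  assumes "graded_functions S H" and x: "\<And>v. v \<in> IW \<Longrightarrow> (\<lambda>p. x p v) \<in> H (snd v)"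
    and v: "v \<in> IC"
  shows "(\<lambda>p. psi (x p) v) \<in> H (snd v)"
proof -
  interpret graded_functions S H by fact
  obtain a i where ai: "v = (a, i)" "a < N" "1 \<le> i" "i \<le> l a"
    using v by (auto simp: crit_index_def)
  have "(\<lambda>p. poly_at_inf (Wp (x p) (N - a))) \<in> G (- int (l a))"
    using W_graded[OF assms(1) x, of "N - a"] ai(2) by simp
  then have "(\<lambda>p. fls_nth (poly_at_inf (Wp (x p) (N - a))) (- int (l a) + int i)) \<in> H i"
    unfolding G_def by blast
  moreover have "fls_nth (poly_at_inf (Wp (x p) (N - a))) (- int (l a) + int i) = poly.coeff (Wp (x p) (N - a)) (l a - i)" for p
    using ai by (simp add: poly_at_inf_nth nat_diff_distrib)
  ultimately have "(\<lambda>p. ((- 1) ^ i / C (N - a)) * poly.coeff (Wp (x p) (N - a)) (l a - i)) \<in> H i"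
    by (intro cmult) simp
  then show ?thesis using v by (simp add: psi_def ai(1))
qed

text \<open>Differentiation and multiplication by a \<open>dlog\<close> both raise the order in
  \<open>1/u\<close> by one, while a power of \<open>d/du\<close> absorbs one factor without raising
  it. The denominators are monic, as \<open>G_inverse\<close> requires.\<close>

lemma PD_graded:
  assumes "graded_functions S H" and s: "\<And>v. v \<in> IC \<Longrightarrow> (\<lambda>p. s p v) \<in> H (snd v)"
    and m: "m \<le> N"
  shows "(\<lambda>p. poly.coeff (PD (s p) m) k) \<in> graded_functions.G S H (int m - int k)"
  using m
proof (induction m arbitrary: k)
  case 0
  interpret graded_functions S H by fact
  show ?case using G_one G_zero by (cases k) auto
next
  case (Suc m)
  interpret graded_functions S H by fact
  have PPG: "(\<lambda>p. PP (s p) j) \<in> G (- int (l (N - j)))" for j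
  proof (rule G_poly_at_inf)
    fix k assume k: "k \<le> l (N - j)"
    show "(\<lambda>p. poly.coeff (cpoly (s p) (N - j)) (l (N - j) - k)) \<in> H k"
    proof (cases "k = 0")
      case False
      then have "l (N - j) \<noteq> 0" using k by auto
      then have "N - j < N" by (cases "N - j = N") auto
      then have v: "(N - j, k) \<in> IC" using False k by (auto simp: crit_index_def)
      have "poly.coeff (cpoly (s p) (N - j)) (l (N - j) - k) = (- 1) ^ k * s p (N - j, k)" for p
        using False k by (simp add: coeff_cpoly)
      then show ?thesis using cmult[OF s[OF v]] by simp
    qed (simp add: coeff_cpoly const)
  qed simp
  have dl: "(\<lambda>p. dlog (PP (s p) j)) \<in> G 1" for j
  proof -
    have "(\<lambda>p. inverse (PP (s p) j)) \<in> G (- (- int (l (N - j))))"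
    proof (rule G_inverse[OF PPG])
      show "fls_nth (PP (s p) j) (- int (l (N - j))) = 1" for p
        using leads_cpoly[of "s p" "N - j"] by (simp add: leads_def)
    qed simp
    from G_mult[OF G_du[OF PPG] this, of j] show ?thesis
      by (simp add: dlog_def divide_inverse)
  qed
  have IH: "(\<lambda>p. poly.coeff (PD (s p) m) k) \<in> G (int m - int k)" for k using Suc by simp
  have "(\<lambda>p. du (poly.coeff (PD (s p) m) k)) \<in> G (int m - int k + 1)" by (rule G_du[OF IH])
  moreover have "(\<lambda>p. (dlog (PP (s p) (Suc m)) - dlog (PP (s p) m)) * poly.coeff (PD (s p) m) k) \<in> G (1 + (int m - int k))"
    by (intro G_mult G_diff dl IH)
  moreover have "(\<lambda>p. if k = 0 then 0 else poly.coeff (PD (s p) m) (k - 1)) \<in> G (int m - int k + 1)"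
    using IH[of "k - 1"] G_zero by (cases k) (auto simp: algebra_simps)
  ultimately have "(\<lambda>p. du (poly.coeff (PD (s p) m) k) + (if k = 0 then 0 else poly.coeff (PD (s p) m) (k - 1))
      - (dlog (PP (s p) (Suc m)) - dlog (PP (s p) m)) * poly.coeff (PD (s p) m) k) \<in> G (int m - int k + 1)"
    by (intro G_add G_diff) (simp_all add: add.commute)
  then show ?case by (simp add: coeff_dfact algebra_simps)
qed

abbreviation B :: "(nat \<times> nat \<Rightarrow> complex) \<Rightarrow> nat \<Rightarrow> nat \<Rightarrow> complex" where
  "B s i j \<equiv> fls_nth (poly.coeff (PD s N) (N - i)) (int j)"

lemma B_graded:
  assumes "graded_functions S H" and s: "\<And>v. v \<in> IC \<Longrightarrow> (\<lambda>p. s p v) \<in> H (snd v)"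
    and i: "i \<le> N"
  shows "(\<lambda>p. B (s p) i (i + k)) \<in> H k"
proof -
  interpret graded_functions S H by fact
  have "(\<lambda>p. fls_nth (poly.coeff (PD (s p) N) (N - i)) (int N - int (N - i) + int k)) \<in> H k"
    using PD_graded[OF assms(1) s, of N "N - i"] unfolding G_def by blast
  then show ?thesis using i by simp
qed

text \<open>The equation \<open>D f_i = 0\<close> is triangular: at \<open>u^(d_i - N - k)\<close>
  it involves only the coefficients of \<open>f_i\<close> at \<open>u^(d_i - k')\<close> with
  \<open>k' \<le> k\<close>, and for \<open>k' = k\<close> the multiplier is a value of the indicial
  polynomial. The functions \<open>s\<close> and \<open>x\<close> on \<open>S\<close> are linked
  only by the kernel condition, so the lemma serves both to invert \<open>psi\<close> and to
  generate the algebra.\<close>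

lemma coords_graded:
  assumes "graded_functions S H"
    and B: "\<And>i k. i \<in> {1..N} \<Longrightarrow> (\<lambda>p. B (s p) i (i + k)) \<in> H k"
    and kill: "\<And>p i. p \<in> S \<Longrightarrow> i \<in> {1..N} \<Longrightarrow> diffop_apply (PD (s p) N) (poly_at_inf (fpoly (x p) i)) = 0"
    and v: "v \<in> IW"
  shows "(\<lambda>p. x p v) \<in> H (snd v)"
proof -
  interpret graded_functions S H by fact
  obtain i j where ij: "v = (i, j)" "i \<in> {1..N}" "1 \<le> j" "j \<le> d i" "d i - j \<notin> P"
    using v by (auto simp: cell_index_def)
  define c where "c k p = poly.coeff (fpoly (x p) i) (d i - k)" for k p
  define A where "A k n p = fls_nth (diffop_apply (PD (s p) N) (fls_X_inv ^ (d i - k))) n" for k n p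
  have B0: "(\<lambda>p. B (s p) i (i + k)) \<in> H k" if "i \<le> N" for i k
  proof (cases "i = 0")
    case True
    have "poly.coeff (PD s N) N = 1" for s using monic_PD[of N] by (simp add: monic_op_def)
    then show ?thesis using const[of 1] zero by (cases k) (auto simp: True)
  qed (use B that in auto)
  have A: "A k' (int N - int (d i) + int k) \<in> H (k - k')" if "k' \<le> k" "k' \<le> d i" for k k'
  proof -
    have "A k' (int N - int (d i) + int k) p
        = (\<Sum>q\<le>N. poly (ffp q) (of_nat (d i - k')) * B (s p) (N - q) ((N - q) + (k - k')))" for p
      unfolding A_def
    proof (subst diffop_apply_X_inv_power[of N])
      show "poly.coeff (PD (s p) N) q = 0" if "q > N" for q
        using monic_PD[of N "s p"] that by (simp add: monic_op_def)
      have "int N - int (d i) + int k + int (d i - k') - int q = int ((N - q) + (k - k'))" if "q \<le> N" for q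
        using that \<open>k' \<le> k\<close> \<open>k' \<le> d i\<close> by auto
      then show "(\<Sum>q\<le>N. poly (ffp q) (of_nat (d i - k')) *
          fls_nth (poly.coeff (PD (s p) N) q) (int N - int (d i) + int k + int (d i - k') - int q))
        = (\<Sum>q\<le>N. poly (ffp q) (of_nat (d i - k')) * B (s p) (N - q) ((N - q) + (k - k')))"
        by (intro sum.cong refl) (simp only: atMost_iff diff_diff_cancel)
    qed
    note eq = this
    have "(\<lambda>p. \<Sum>q\<le>N. poly (ffp q) (of_nat (d i - k')) * B (s p) (N - q) ((N - q) + (k - k'))) \<in> H (k - k')"
      by (intro sum cmult B0) auto
    then show ?thesis by (rule cong) (simp only: eq)
  qed
  have lead: "leads (fls_X_inv ^ q) (- int q) 1" for q by (auto simp: leads_def)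
  \<comment> \<open>The power \<open>u^(d_i - k')\<close> is sent to a series of order at least
    \<open>N - d_i + k'\<close> in \<open>1/u\<close>, so larger \<open>k'\<close> do not reach the
    coefficient in question.\<close>
  have Ahigh: "A k' (int N - int (d i) + int k) p = 0" if "k < k'" "k' \<le> d i" for k k' p
    using leads_PD[OF order_refl lead, of "s p" "d i - k'"] that by (auto simp: A_def leads_def)
  \<comment> \<open>The value of the indicial polynomial at \<open>d i - k\<close>. It vanishes only
    at exponents in \<open>P\<close>, where the coefficient of \<open>f_i\<close> is
    prescribed.\<close>
  define a0 where "a0 k = (\<Prod>m=1..N. of_nat (d i - k) - complex_of_nat (e m))" for k
  have Adiag: "A k (int N - int (d i) + int k) p = a0 k" if "k \<le> d i" for k p
    using leads_PD[OF order_refl lead, of "s p" "d i - k"] that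
    by (auto simp: A_def leads_def a0_def algebra_simps of_nat_diff)
  have a0: "a0 k \<noteq> 0" if "d i - k \<notin> P" for k
  proof -
    have "d i - k \<noteq> e m" if "m \<in> {1..N}" for m using \<open>d i - k \<notin> P\<close> that unfolding P_eq_e by blast
    then show ?thesis by (auto simp: a0_def)
  qed
  have eq: "(\<Sum>k'\<le>d i. c k' p * A k' n p) = 0" if "p \<in> S" for p n
  proof -
    have "fpoly (x p) i = (\<Sum>k\<le>d i. Polynomial.monom (poly.coeff (fpoly (x p) i) k) k)"
      using poly_as_sum_of_monoms[of "fpoly (x p) i"] by simp
    also have "\<dots> = (\<Sum>k'\<le>d i. Polynomial.monom (c k' p) (d i - k'))"
      unfolding c_def by (rule sum.reindex_bij_witness[of _ "\<lambda>k. d i - k" "\<lambda>k. d i - k"]) auto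
    finally have "poly_at_inf (fpoly (x p) i) = (\<Sum>k'\<le>d i. fls_const (c k' p) * fls_X_inv ^ (d i - k'))"
      by (simp add: poly_at_inf_monom)
    then have "(\<Sum>k'\<le>d i. fls_const (c k' p) * diffop_apply (PD (s p) N) (fls_X_inv ^ (d i - k'))) = 0"
      using kill[OF that ij(2)] by (simp add: diffop_apply_arg_sum diffop_apply_arg_cmult)
    from arg_cong[OF this, of "\<lambda>f. fls_nth f n"] show ?thesis
      by (simp add: fls_nth_sum A_def)
  qed
  have "k \<le> d i \<Longrightarrow> c k \<in> H k" for k
  proof (induction k rule: less_induct)
    case (less k)
    consider "k = 0" | "k > 0" "d i - k \<in> P" | "d i - k \<notin> P" by blast
    then show ?case
    proof cases
      case 1
      then show ?thesis by (simp add: c_def[abs_def] coeff_fpoly const)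
    next
      case 2
      then have "c k p = 0" for p using less.prems by (simp add: c_def coeff_fpoly)
      then have "c k = (\<lambda>_. 0)" by auto
      then show ?thesis by (simp add: zero)
    next
      case 3
      let ?n = "int N - int (d i) + int k"
      have ck: "c k p = (- inverse (a0 k)) * (\<Sum>k'<k. c k' p * A k' ?n p)" if "p \<in> S" for p
      proof -
        have "0 = (\<Sum>k'\<le>d i. c k' p * A k' ?n p)" using eq[OF that] by simp
        also have "\<dots> = (\<Sum>k'\<le>k. c k' p * A k' ?n p)"
          by (rule sum.mono_neutral_right) (use less.prems Ahigh in auto)
        also have "\<dots> = c k p * a0 k + (\<Sum>k'<k. c k' p * A k' ?n p)"
          using Adiag[OF less.prems] by (simp add: lessThan_Suc_atMost[symmetric])
        finally show ?thesis using a0[OF 3] by (simp add: field_simps eq_neg_iff_add_eq_0)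
      qed
      have "(\<lambda>p. c k' p * A k' ?n p) \<in> H k" if "k' < k" for k'
        using mult[OF less.IH[OF that] A[of k' k]] that less.prems by simp
      then have "(\<lambda>p. (- inverse (a0 k)) * (\<Sum>k'<k. c k' p * A k' ?n p)) \<in> H k"
        by (intro cmult sum) auto
      then show ?thesis by (rule cong) (simp add: ck)
    qed
  qed
  moreover have "c j = (\<lambda>p. x p v)"
    using ij by (auto simp: c_def coeff_fpoly fun_eq_iff)
  ultimately show ?thesis using ij(4) by (metis ij(1) snd_conv)
qed

end

section \<open>The cell as an affine space\<close>

interpretation pv: vector_space "Polynomial.smult :: complex \<Rightarrow> complex poly \<Rightarrow> complex poly"
  by unfold_locales (auto simp: smult_add_left smult_add_right)

lemma independent_distinct_degrees:
  assumes fin: "finite A" and inj: "inj_on degree A" and nz: "0 \<notin> A"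
  shows "pv.independent A"
proof
  assume "pv.dependent A"
  then obtain u where u: "\<exists>v\<in>A. u v \<noteq> 0" "(\<Sum>v\<in>A. Polynomial.smult (u v) v) = 0"
    using pv.dependent_finite[OF fin] by auto
  define A' where "A' = {v \<in> A. u v \<noteq> 0}"
  have A': "finite A'" "A' \<noteq> {}" using fin u by (auto simp: A'_def)
  define D where "D = Max (degree ` A')"
  have "D \<in> degree ` A'" unfolding D_def using A' by (intro Max_in) auto
  then obtain v0 where v0: "v0 \<in> A'" "degree v0 = D" by auto
  have "poly.coeff (Polynomial.smult (u v) v) D = (if v = v0 then u v0 * lead_coeff v0 else 0)" if v: "v \<in> A" for v
  proof (cases "v \<in> A' \<and> v \<noteq> v0")
    case True
    then have "degree v \<le> D" using A' by (auto simp: D_def)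
    moreover have "degree v \<noteq> D" using inj_onD[OF inj, of v v0] True v v0 by (auto simp: A'_def)
    ultimately show ?thesis using True by (simp add: coeff_eq_0)
  qed (use v v0 in \<open>auto simp: A'_def\<close>)
  then have "poly.coeff (\<Sum>v\<in>A. Polynomial.smult (u v) v) D = (\<Sum>v\<in>A. if v = v0 then u v0 * lead_coeff v0 else 0)"
    unfolding coeff_sum by (intro sum.cong) auto
  also have "\<dots> = u v0 * lead_coeff v0" using fin v0 by (auto simp: A'_def)
  also have "\<dots> \<noteq> 0" using v0 nz by (auto simp: A'_def)
  finally show False using u(2) by simp
qed

text \<open>The largest index is cleared first; the remaining \<open>h r\<close> have smaller degree
  and cannot disturb it.\<close>

lemma echelon_reduction:
  assumes "finite Q" "\<And>q. q \<in> Q \<Longrightarrow> degree (h q) = q" "\<And>q. q \<in> Q \<Longrightarrow> poly.coeff (h q) q = 1"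
  shows "\<exists>c. \<forall>q\<in>Q. poly.coeff (p - (\<Sum>r\<in>Q. Polynomial.smult (c r) (h r))) q = (0 :: complex)"
  using assms
proof (induction Q arbitrary: p rule: finite_linorder_max_induct)
  case empty
  then show ?case by simp
next
  case (insert b Q)
  define p1 where "p1 = p - Polynomial.smult (poly.coeff p b) (h b)"
  obtain c where c: "\<forall>q\<in>Q. poly.coeff (p1 - (\<Sum>r\<in>Q. Polynomial.smult (c r) (h r))) q = 0"
    using insert.IH[of p1] insert.prems by auto
  define c' where "c' = c(b := poly.coeff p b)"
  have b: "b \<notin> Q" using insert.hyps by auto
  have eq: "p - (\<Sum>r\<in>insert b Q. Polynomial.smult (c' r) (h r)) = p1 - (\<Sum>r\<in>Q. Polynomial.smult (c r) (h r))"
  proof -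
    have "(\<Sum>r\<in>Q. Polynomial.smult (c' r) (h r)) = (\<Sum>r\<in>Q. Polynomial.smult (c r) (h r))"
      using b by (intro sum.cong) (auto simp: c'_def)
    then show ?thesis using b insert.hyps by (simp add: p1_def c'_def algebra_simps)
  qed
  have "poly.coeff (h r) b = 0" if "r \<in> Q" for r
    using that insert.hyps insert.prems(1)[of r] by (intro coeff_eq_0) auto
  then have "poly.coeff (p1 - (\<Sum>r\<in>Q. Polynomial.smult (c r) (h r))) b = 0"
    using insert.prems(2)[of b] by (simp add: p1_def coeff_sum)
  then have "\<forall>q\<in>insert b Q. poly.coeff (p - (\<Sum>r\<in>insert b Q. Polynomial.smult (c' r) (h r))) q = 0"
    unfolding eq using c by simp
  then show ?case by blast
qed

text \<open>A reduced member of \<open>Y\<close> has no coefficients at \<open>Q\<close>, whereas a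
  nonzero one would have its degree in \<open>Q\<close>.\<close>

lemma subspace_eq_span:
  assumes sub: "pv.subspace Y" and Q: "finite Q"
    and h: "\<And>q. q \<in> Q \<Longrightarrow> h q \<in> Y" "\<And>q. q \<in> Q \<Longrightarrow> degree (h q) = q" "\<And>q. q \<in> Q \<Longrightarrow> poly.coeff (h q) q = 1"
    and deg: "\<And>p. p \<in> Y \<Longrightarrow> p \<noteq> 0 \<Longrightarrow> degree p \<in> Q"
  shows "Y = pv.span (h ` Q)"
proof
  show "pv.span (h ` Q) \<subseteq> Y" using sub h by (intro pv.span_minimal) auto
  show "Y \<subseteq> pv.span (h ` Q)"
  proof
    fix p assume p: "p \<in> Y"
    obtain c where c: "\<forall>q\<in>Q. poly.coeff (p - (\<Sum>r\<in>Q. Polynomial.smult (c r) (h r))) q = 0"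
      using echelon_reduction[OF Q h(2,3)] by blast
    have "p - (\<Sum>r\<in>Q. Polynomial.smult (c r) (h r)) \<in> Y"
      using sub p h(1) by (intro pv.subspace_diff pv.subspace_sum pv.subspace_scale) auto
    then have "p - (\<Sum>r\<in>Q. Polynomial.smult (c r) (h r)) = 0"
      using deg c leading_coeff_0_iff by blast
    then have "p = (\<Sum>r\<in>Q. Polynomial.smult (c r) (h r))" by simp
    also have "\<dots> \<in> pv.span (h ` Q)"
      by (intro pv.span_sum pv.span_scale pv.span_base) auto
    finally show "p \<in> pv.span (h ` Q)" .
  qed
qed

context partition_data begin

definition cellspace :: "(nat \<times> nat \<Rightarrow> complex) \<Rightarrow> complex poly set" where
  "cellspace x = pv.span (fpoly x ` {1..N})"

lemma cellspace_cong: "(\<And>v. v \<in> IW \<Longrightarrow> x v = y v) \<Longrightarrow> cellspace x = cellspace y"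
  unfolding cellspace_def by (rule arg_cong[of _ _ pv.span], rule image_cong) (auto intro: fpoly_cong)

lemma inj_d: "inj_on d {1..N}"
proof (rule inj_onI)
  fix i j assume "i \<in> {1..N}" "j \<in> {1..N}" "d i = d j"
  then show "i = j" using d_mono[of i j] d_mono[of j i] by (cases i j rule: linorder_cases) auto
qed

lemma finite_P [simp]: "finite P"
  by (simp add: exponents_def)

lemma d_in_P: "i \<in> {1..N} \<Longrightarrow> d i \<in> P"
  by (simp add: exponents_def)

lemma coeff_fpoly_P:
  "i \<in> {1..N} \<Longrightarrow> j \<in> {1..N} \<Longrightarrow> poly.coeff (fpoly x i) (d j) = (if i = j then 1 else 0)"
  using inj_onD[OF inj_d, of i j] d_in_P[of j] by (auto simp: coeff_fpoly)

text \<open>The coefficients of the \<open>f_i\<close> at the \<open>d_j\<close> form the identity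
  matrix, so in a linear combination the largest \<open>d i\<close> with nonzero multiplier survives
  as the degree.\<close>

lemma cellspace_degree:
  assumes "p \<in> cellspace x" "p \<noteq> 0" shows "degree p \<in> P"
proof -
  have "p \<in> range (\<lambda>c. \<Sum>v\<in>fpoly x ` {1..N}. Polynomial.smult (c v) v)"
    using assms(1) pv.span_finite[of "fpoly x ` {1..N}"] by (simp add: cellspace_def)
  then obtain u where "p = (\<Sum>v\<in>fpoly x ` {1..N}. Polynomial.smult (u v) v)" by auto
  also have "\<dots> = (\<Sum>i\<in>{1..N}. Polynomial.smult (u (fpoly x i)) (fpoly x i))"
  proof (rule sum.reindex[unfolded comp_def])
    show "inj_on (fpoly x) {1..N}"
      using inj_d by (intro inj_onI) (metis degree_fpoly inj_onD)
  qed
  finally have p: "p = (\<Sum>i\<in>{1..N}. Polynomial.smult (u (fpoly x i)) (fpoly x i))" .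
  define J where "J = {i \<in> {1..N}. u (fpoly x i) \<noteq> 0}"
  have "J \<noteq> {}"
  proof
    assume "J = {}"
    then have "p = 0" unfolding p by (intro sum.neutral) (auto simp: J_def)
    then show False using assms by simp
  qed
  define D where "D = Max (d ` J)"
  have "D \<in> d ` J" unfolding D_def using \<open>J \<noteq> {}\<close> by (intro Max_in) (auto simp: J_def)
  then obtain i0 where i0: "i0 \<in> J" "D = d i0" by auto
  have "poly.coeff p D = (\<Sum>i\<in>{1..N}. if i = i0 then u (fpoly x i) else 0)"
    unfolding p coeff_sum i0(2) using i0(1) by (intro sum.cong) (auto simp: coeff_fpoly_P J_def)
  also have "\<dots> = u (fpoly x i0)" using i0(1) by (subst sum.delta) (auto simp: J_def)
  also have "\<dots> \<noteq> 0" using i0(1) by (auto simp: J_def)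
  finally have c: "poly.coeff p D \<noteq> 0" .
  have "degree p \<le> D"
    unfolding p
  proof (rule degree_sum_le)
    fix i assume i: "i \<in> {1..N}"
    show "degree (Polynomial.smult (u (fpoly x i)) (fpoly x i)) \<le> D"
    proof (cases "i \<in> J")
      case True
      then have "d i \<le> D" unfolding D_def by (intro Max_ge) (auto simp: J_def)
      then show ?thesis by simp
    qed (use i in \<open>auto simp: J_def\<close>)
  qed simp
  then have "degree p = D" using le_degree[OF c] by simp
  then show ?thesis using i0 d_in_P by (auto simp: J_def)
qed

lemma fpoly_in_cellspace: "i \<in> {1..N} \<Longrightarrow> fpoly x i \<in> cellspace x"
  unfolding cellspace_def by (rule pv.span_base) auto

lemma flag_poly_cellspace:
  assumes i: "i \<in> {1..N}" shows "flag_poly N lam (cellspace x) i = fpoly x i"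
  unfolding flag_poly_def
proof (rule the_equality)
  show "fpoly x i \<in> cellspace x \<and> degree (fpoly x i) = d i \<and> lead_coeff (fpoly x i) = 1 \<and>
    (\<forall>k<d i. k \<in> P \<longrightarrow> poly.coeff (fpoly x i) k = 0)"
    using fpoly_in_cellspace[OF i] by (auto simp: coeff_fpoly)
  fix f assume f: "f \<in> cellspace x \<and> degree f = d i \<and> lead_coeff f = 1 \<and>
    (\<forall>k<d i. k \<in> P \<longrightarrow> poly.coeff f k = 0)"
  have "f - fpoly x i \<in> cellspace x"
    using f fpoly_in_cellspace[OF i] unfolding cellspace_def by (intro pv.span_diff) auto
  moreover have "poly.coeff (f - fpoly x i) k = 0" if k: "k \<in> P" for k
  proof (cases k "d i" rule: linorder_cases)
    case less
    then show ?thesis using f k by (simp add: coeff_fpoly)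
  next
    case equal
    then show ?thesis using f by (auto simp: coeff_fpoly)
  next
    case greater
    then show ?thesis using f by (simp add: coeff_eq_0)
  qed
  ultimately have "f - fpoly x i = 0"
    using cellspace_degree leading_coeff_0_iff by blast
  then show "f = fpoly x i" by simp
qed

lemma cell_coord_cellspace: "v \<in> IW \<Longrightarrow> cell_coord N lam (cellspace x) v = x v"
  by (auto simp: cell_coord_def cell_index_def flag_poly_cellspace coeff_fpoly)

lemma cellspace_cell:
  assumes "lam 1 + N \<le> dd" shows "cellspace x \<in> cell dd N lam"
proof -
  have "pv.independent (fpoly x ` {1..N})"
  proof (rule independent_distinct_degrees)
    show "inj_on degree (fpoly x ` {1..N})"
    proof (rule inj_onI)
      fix p q assume "p \<in> fpoly x ` {1..N}" "q \<in> fpoly x ` {1..N}" "degree p = degree q"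
      then obtain i j where "p = fpoly x i" "q = fpoly x j" "i \<in> {1..N}" "j \<in> {1..N}" "d i = d j" by auto
      then show "p = q" using inj_onD[OF inj_d, of i j] by simp
    qed
    show "0 \<notin> fpoly x ` {1..N}"
    proof
      assume "0 \<in> fpoly x ` {1..N}"
      then obtain i where "fpoly x i = 0" by auto
      then show False using lead_coeff_fpoly[of x i] by simp
    qed
  qed simp
  then have "pv.dim (cellspace x) = card (fpoly x ` {1..N})"
    unfolding cellspace_def by (rule pv.dim_span_eq_card_independent)
  also have "\<dots> = N"
  proof -
    have "inj_on (fpoly x) {1..N}"
      using inj_d by (intro inj_onI) (metis degree_fpoly inj_onD)
    then show ?thesis by (simp add: card_image)
  qed
  finally have dim: "pv.dim (cellspace x) = N" .
  have "degree p < dd" if "p \<in> cellspace x" "p \<noteq> 0" for p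
  proof -
    obtain i where i: "i \<in> {1..N}" "degree p = d i" 
      using cellspace_degree[OF \<open>p \<in> cellspace x\<close> \<open>p \<noteq> 0\<close>] by (auto simp: exponents_def)
    have "d i \<le> d 1" using d_mono[of 1 i] i(1) by (cases "i = 1") auto
    moreover have "d 1 < dd" using assms N_pos by (simp add: dexp_def)
    ultimately show ?thesis using i by linarith
  qed
  moreover have "fpoly x i \<noteq> 0" for i
    using lead_coeff_fpoly[of x i] by (metis coeff_0 zero_neq_one)
  then have "\<forall>i\<in>{1..N}. \<exists>p\<in>cellspace x. p \<noteq> 0 \<and> degree p = d i"
    using fpoly_in_cellspace degree_fpoly by blast
  ultimately show ?thesis using dim
    unfolding cell_def by (auto simp: cellspace_def)
qed

text \<open>Phrased through degrees of elements instead of a dimension, so that it also applies to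
  kernels of operators. Reducing an element of degree \<open>d i\<close> against those of smaller
  degree produces the flag basis.\<close>

lemma subspace_cellspace:
  assumes sub: "pv.subspace X"
    and ex: "\<forall>i\<in>{1..N}. \<exists>p\<in>X. p \<noteq> 0 \<and> degree p = d i"
    and degX: "\<And>p. p \<in> X \<Longrightarrow> p \<noteq> 0 \<Longrightarrow> degree p \<in> P"
  shows "\<exists>x. X = cellspace x"
proof -
  have "\<exists>p\<in>X. degree p = q \<and> lead_coeff p = 1" if q: "q \<in> P" for q
  proof -
    obtain i where i: "i \<in> {1..N}" "q = d i" using q by (auto simp: exponents_def)
    then have "\<exists>p\<in>X. p \<noteq> 0 \<and> degree p = q" using ex by blast
    then obtain p where "p \<in> X" "p \<noteq> 0" "degree p = q" by blast
    then show ?thesis using sub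
      by (intro bexI[of _ "Polynomial.smult (inverse (lead_coeff p)) p"]) (auto intro: pv.subspace_scale)
  qed
  then obtain h where h: "\<And>q. q \<in> P \<Longrightarrow> h q \<in> X" "\<And>q. q \<in> P \<Longrightarrow> degree (h q) = q"
    "\<And>q. q \<in> P \<Longrightarrow> lead_coeff (h q) = 1" by metis
  then have h1: "\<And>q. q \<in> P \<Longrightarrow> poly.coeff (h q) q = 1" by metis
  have "\<exists>f\<in>X. degree f = d i \<and> poly.coeff f (d i) = 1 \<and> (\<forall>k<d i. k \<in> P \<longrightarrow> poly.coeff f k = 0)" if i: "i \<in> {1..N}" for i
  proof -
    let ?Q = "{q \<in> P. q < d i}"
    obtain c where c: "\<forall>q\<in>?Q. poly.coeff (h (d i) - (\<Sum>r\<in>?Q. Polynomial.smult (c r) (h r))) q = 0"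
      using echelon_reduction[of ?Q h "h (d i)"] h(2) h1 by auto
    let ?r = "\<Sum>r\<in>?Q. Polynomial.smult (c r) (h r)"
    have dP: "d i \<in> P" using i by (rule d_in_P)
    have cr: "poly.coeff ?r k = 0" if "k \<ge> d i" for k
      unfolding coeff_sum by (rule sum.neutral) (use that h(2) in \<open>auto simp: coeff_eq_0\<close>)
    have c1: "poly.coeff (h (d i) - ?r) (d i) = 1" using h1[OF dP] cr[of "d i"] by simp
    have "degree (h (d i) - ?r) \<le> d i"
      by (rule degree_le) (use h(2)[OF dP] cr in \<open>auto simp: coeff_eq_0\<close>)
    moreover have "d i \<le> degree (h (d i) - ?r)" by (rule le_degree) (simp only: c1, simp)
    ultimately have "degree (h (d i) - ?r) = d i" by simp
    moreover have "h (d i) - ?r \<in> X"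
      using sub h(1) dP by (intro pv.subspace_diff pv.subspace_sum pv.subspace_scale) auto
    ultimately show ?thesis using c c1 by (intro bexI[of _ "h (d i) - ?r"]) auto
  qed
  then obtain f where f: "\<And>i. i \<in> {1..N} \<Longrightarrow> f i \<in> X" "\<And>i. i \<in> {1..N} \<Longrightarrow> degree (f i) = d i"
    "\<And>i. i \<in> {1..N} \<Longrightarrow> poly.coeff (f i) (d i) = 1"
    "\<And>i k. i \<in> {1..N} \<Longrightarrow> k < d i \<Longrightarrow> k \<in> P \<Longrightarrow> poly.coeff (f i) k = 0" by metis
  define x where "x = (\<lambda>(i, j). poly.coeff (f i) (d i - j))"
  have fx: "fpoly x i = f i" if i: "i \<in> {1..N}" for i
  proof (rule poly_eqI)
    fix k
    consider "k = d i" | "k < d i" "k \<in> P" | "k < d i" "k \<notin> P" | "k > d i" by linarith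
    then show "poly.coeff (fpoly x i) k = poly.coeff (f i) k"
      by cases (auto simp: coeff_fpoly x_def f(2-4)[OF i] coeff_eq_0)
  qed
  define idx where "idx q = inv_into {1..N} d q" for q
  have idx: "idx q \<in> {1..N}" "d (idx q) = q" if "q \<in> P" for q
    using that unfolding exponents_def idx_def by (rule inv_into_into, rule f_inv_into_f)
  have "X = pv.span ((\<lambda>q. fpoly x (idx q)) ` P)"
  proof (rule subspace_eq_span[OF sub])
    fix q assume "q \<in> P"
    then show "fpoly x (idx q) \<in> X" "degree (fpoly x (idx q)) = q" "poly.coeff (fpoly x (idx q)) q = 1"
      using idx[of q] f(1-3)[of "idx q"] fx[of "idx q"] by auto
  qed (use degX in auto)
  also have "(\<lambda>q. fpoly x (idx q)) ` P = fpoly x ` {1..N}"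
  proof -
    have "idx ` P = {1..N}"
    proof
      show "{1..N} \<subseteq> idx ` P"
      proof
        fix i assume i: "i \<in> {1..N}"
        then have "idx (d i) = i" unfolding idx_def by (rule inv_into_f_f[OF inj_d])
        then show "i \<in> idx ` P" using d_in_P[OF i] by force
      qed
    qed (use idx in auto)
    then show ?thesis by (metis image_image)
  qed
  finally show ?thesis unfolding cellspace_def by blast
qed

text \<open>An element whose degree is not an exponent would, together with elements of the
  \<open>N\<close> prescribed degrees, give \<open>N + 1\<close> independent vectors.\<close>

lemma cell_cellspace:
  assumes X: "X \<in> cell dd N lam"
  shows "\<exists>x. X = cellspace x"
proof (rule subspace_cellspace)
  show sub: "pv.subspace X" and ex: "\<forall>i\<in>{1..N}. \<exists>p\<in>X. p \<noteq> 0 \<and> degree p = d i"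
    using X by (auto simp: cell_def)
  have dim: "pv.dim X = N" using X by (auto simp: cell_def)
  have "\<exists>p\<in>X. p \<noteq> 0 \<and> degree p = q" if "q \<in> P" for q
    using that ex unfolding exponents_def by blast
  then obtain h where h: "\<And>q. q \<in> P \<Longrightarrow> h q \<in> X" "\<And>q. q \<in> P \<Longrightarrow> degree (h q) = q"
    and hnz: "\<And>q. q \<in> P \<Longrightarrow> h q \<noteq> 0" by metis
  have cardP: "card P = N" unfolding exponents_def using card_image[OF inj_d] by simp
  show "degree p \<in> P" if p: "p \<in> X" "p \<noteq> 0" for p
  proof (rule ccontr)
    assume np: "degree p \<notin> P"
    have pn: "p \<notin> h ` P" using np h(2) by auto
    have injh: "inj_on h P" using h(2) by (intro inj_onI) metis
    have "pv.independent (insert p (h ` P))"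
    proof (rule independent_distinct_degrees)
      show "inj_on degree (insert p (h ` P))"
        using np h(2) by (auto simp: inj_on_def)
      show "0 \<notin> insert p (h ` P)" using p hnz by force
    qed simp
    moreover obtain Bs where Bs: "Bs \<subseteq> X" "pv.independent Bs" "X \<subseteq> pv.span Bs" "card Bs = pv.dim X"
      using pv.basis_exists[of X] by blast
    have "finite Bs" using Bs(4) dim N_pos card.infinite by fastforce
    moreover have "insert p (h ` P) \<subseteq> pv.span Bs" using Bs(3) p h(1) by auto
    ultimately have "card (insert p (h ` P)) \<le> card Bs"
      using pv.independent_span_bound by blast
    then show False using pn injh cardP Bs(4) dim by (simp add: card_image)
  qed
qed

lemma cell_eq_cellspace_coord:
  assumes "X \<in> cell dd N lam" shows "X = cellspace (cell_coord N lam X)"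
proof -
  obtain x where x: "X = cellspace x" using cell_cellspace[OF assms] by auto
  show ?thesis unfolding x by (rule cellspace_cong) (simp add: cell_coord_cellspace)
qed

text \<open>The indicial polynomial excludes kernel elements of degree outside \<open>P\<close>,
  which leaves no room beyond the span of the flag basis.\<close>

lemma kernel_eq_cellspace:
  assumes kill: "\<And>i. i \<in> {1..N} \<Longrightarrow> diffop_apply (PD s N) (poly_at_inf (fpoly x i)) = 0"
  shows "{p. diffop_apply (PD s N) (poly_at_inf p) = 0} = cellspace x"
proof -
  let ?Y = "{p. diffop_apply (PD s N) (poly_at_inf p) = 0}"
  have sub: "pv.subspace ?Y"
    by (rule pv.subspaceI) (auto simp: diffop_apply_arg_add diffop_apply_arg_cmult)
  have deg: "degree p \<in> P" if p: "p \<in> ?Y" "p \<noteq> 0" for p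
  proof (rule ccontr)
    assume np: "degree p \<notin> P"
    have "leads (diffop_apply (PD s N) (poly_at_inf p)) (- int (degree p) + int N)
       ((\<Prod>i=1..N. - of_int (- int (degree p)) - of_nat (e i)) * lead_coeff p)"
      by (rule leads_PD[OF order_refl leads_poly])
    moreover have "(\<Prod>i=1..N. - of_int (- int (degree p)) - of_nat (e i)) * lead_coeff p \<noteq> 0"
      using p np by (auto simp: P_eq_e)
    ultimately show False using p leads_nonzero by blast
  qed
  define idx where "idx q = inv_into {1..N} d q" for q
  have idx: "idx q \<in> {1..N}" "d (idx q) = q" if "q \<in> P" for q
    using that unfolding exponents_def idx_def by (rule inv_into_into, rule f_inv_into_f)
  have "?Y \<subseteq> cellspace x"
  proof -
    have "?Y = pv.span ((\<lambda>q. fpoly x (idx q)) ` P)"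
    proof (rule subspace_eq_span[OF sub])
      fix q assume "q \<in> P"
      then show "fpoly x (idx q) \<in> ?Y" "degree (fpoly x (idx q)) = q" "poly.coeff (fpoly x (idx q)) q = 1"
        using idx[of q] kill[of "idx q"] lead_coeff_fpoly[of x "idx q"] by auto
    qed (use deg in auto)
    also have "\<dots> \<subseteq> cellspace x"
      unfolding cellspace_def by (rule pv.span_mono) (use idx in auto)
    finally show ?thesis .
  qed
  moreover have "cellspace x \<subseteq> ?Y"
    unfolding cellspace_def by (rule pv.span_minimal[OF _ sub]) (use kill in auto)
  ultimately show ?thesis by blast
qed

lemma D_W_cellspace: "D_W N lam (cellspace x) = PD (psi x) N"
proof -
  have "lop N (\<lambda>i. poly_at_inf (flag_poly N lam (cellspace x) i)) = lop N (\<lambda>i. poly_at_inf (fpoly x i))"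
    unfolding lop_def
    by (rule arg_cong2[of _ _ _ _ "\<lambda>a. Polynomial.smult (inverse a)"]; rule wronskian_cong wop_cong)
      (simp_all add: flag_poly_cellspace)
  then show ?thesis by (simp add: D_W_eq lop_fpoly_eq_PD)
qed

end

section \<open>Polynomial solutions of first-order Wronskian equations\<close>

definition wr :: "complex poly \<Rightarrow> complex poly \<Rightarrow> complex poly" where
  "wr p q = p * pderiv q - pderiv p * q"

lemma wr_diff_smult: "wr p (q - Polynomial.smult c p) = wr p q"
  by (simp add: wr_def pderiv_diff pderiv_smult algebra_simps)

text \<open>The product of the leading coefficients is multiplied by the difference of the degrees,
  so nothing cancels.\<close>

lemma degree_wr:
  assumes "p \<noteq> 0" "q \<noteq> 0" "degree p \<noteq> degree q"
  shows "wr p q \<noteq> 0" "Suc (degree (wr p q)) = degree p + degree q"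
proof -
  let ?c = "(of_nat (degree q) - of_nat (degree p)) * (lead_coeff p * lead_coeff q)"
  have c: "?c \<noteq> 0" using assms by auto
  have "leads (poly_at_inf p * du (poly_at_inf q)) (- int (degree p) + (- int (degree q) + 1))
      (lead_coeff p * (- of_int (- int (degree q)) * lead_coeff q))"
    by (intro leads_mult leads_du leads_poly)
  moreover have "leads (du (poly_at_inf p) * poly_at_inf q) (- int (degree p) + 1 + (- int (degree q)))
      (- of_int (- int (degree p)) * lead_coeff p * lead_coeff q)"
    by (intro leads_mult leads_du leads_poly)
  ultimately have "leads (poly_at_inf (wr p q)) (1 - int (degree p) - int (degree q)) ?c"
    using leads_diff[of _ "1 - int (degree p) - int (degree q)"] by (simp add: wr_def algebra_simps)
  note L = this
  show nz: "wr p q \<noteq> 0" using leads_nonzero[OF L c] by auto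
  have "fls_subdegree (poly_at_inf (wr p q)) = - int (degree (wr p q))"
    by (rule leads_subdegree[OF leads_poly]) (use nz in simp)
  moreover have "fls_subdegree (poly_at_inf (wr p q)) = 1 - int (degree p) - int (degree q)"
    by (rule leads_subdegree[OF L c])
  ultimately show "Suc (degree (wr p q)) = degree p + degree q" by linarith
qed

lemma poly_interpolation:
  assumes "finite S" shows "\<exists>q. \<forall>t\<in>S. poly q t = (v t :: complex)"
  using assms
proof induction
  case (insert s S)
  then obtain q where q: "\<forall>t\<in>S. poly q t = v t" by blast
  define z where "z = (\<Prod>t\<in>S. [:- t, 1:])"
  have z: "poly z t = 0" if "t \<in> S" for t using that insert by (auto simp: z_def poly_prod)
  have zs: "poly z s \<noteq> 0" using insert by (auto simp: z_def poly_prod)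
  have "\<forall>t\<in>insert s S. poly (q + Polynomial.smult ((v s - poly q s) / poly z s) z) t = v t"
    using q z zs by auto
  then show ?case by blast
qed simp

lemma linear_product_dvd:
  assumes "finite S" "\<forall>t\<in>S. poly p t = (0 :: complex)"
  shows "(\<Prod>t\<in>S. [:- t, 1:]) dvd p"
  using assms
proof (induction S arbitrary: p)
  case (insert s S)
  then have "[:- s, 1:] dvd p" by (simp add: poly_eq_0_iff_dvd)
  then obtain r where r: "p = [:- s, 1:] * r" by (elim dvdE)
  have "poly r t = 0" if "t \<in> S" for t
  proof -
    have "poly p t = 0" "t \<noteq> s" using that insert by auto
    then show ?thesis by (simp add: r)
  qed
  then have "(\<Prod>t\<in>S. [:- t, 1:]) dvd r" using insert by blast
  then show ?case unfolding r prod.insert[OF insert.hyps] by (rule mult_dvd_mono[OF dvd_refl])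
qed simp

lemma rsquarefree_dvdI:
  fixes p :: "complex poly"
  assumes p: "rsquarefree p" and q: "\<And>t. poly p t = 0 \<Longrightarrow> poly q t = 0"
  shows "p dvd q"
proof -
  have p0: "p \<noteq> 0" using p by (auto simp: rsquarefree_def)
  have "(\<Prod>t | poly p t = 0. [:- t, 1:]) dvd q"
    by (rule linear_product_dvd) (use q p0 poly_roots_finite in auto)
  then have "Polynomial.smult (lead_coeff p) (\<Prod>t | poly p t = 0. [:- t, 1:]) dvd q"
    using p0 by (simp add: smult_dvd)
  then show ?thesis by (simp only: complex_poly_decompose_rsquarefree[OF p])
qed

lemma pderiv_surj: "\<exists>v. pderiv v = (w :: complex poly)"
proof -
  define v where "v = (\<Sum>k\<le>degree w. Polynomial.monom (poly.coeff w k / of_nat (Suc k)) (Suc k))"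
  have "pderiv v = (\<Sum>k\<le>degree w. Polynomial.monom (poly.coeff w k) k)"
    unfolding v_def higher_pderiv_sum[of 1, simplified]
    by (rule sum.cong) (auto simp: pderiv_monom simp del: of_nat_Suc)
  then show ?thesis by (auto simp: poly_as_sum_of_monoms)
qed

text \<open>The equation says \<open>(q/p)' = r/p^2\<close>. At a simple root of \<open>p\<close>
  the right side has at most a double pole, and \<open>res\<close> states that its residue is 0;
  hence there is a rational primitive with denominator \<open>p\<close>.\<close>

lemma wr_solvable:
  assumes p: "rsquarefree p" and r0: "r \<noteq> 0"
    and res: "\<And>t. poly p t = 0 \<Longrightarrow>
       poly (pderiv r) t * poly (pderiv p) t = poly r t * poly (pderiv (pderiv p)) t"
  shows "\<exists>q. q \<noteq> 0 \<and> wr p q = r \<and> degree p + degree q = Suc (degree r)"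
proof -
  have p0: "p \<noteq> 0" using p by (auto simp: rsquarefree_def)
  have simple: "poly (pderiv p) t \<noteq> 0" if "poly p t = 0" for t
    using p that by (auto simp: rsquarefree_roots)
  \<comment> \<open>At a root of \<open>p\<close> the equation forces the value
    \<open>- r / p'\<close> on \<open>q\<close>; interpolation supplies a polynomial with these
    values.\<close>
  obtain q0 where q0: "\<forall>t\<in>{t. poly p t = 0}. poly q0 t = - poly r t / poly (pderiv p) t"
    
    using poly_interpolation[OF poly_roots_finite[OF p0], of "\<lambda>t. - poly r t / poly (pderiv p) t"] by blast
  have "p dvd r + pderiv p * q0"
    by (rule rsquarefree_dvdI[OF p]) (use q0 simple in auto)
  then obtain s where "r + pderiv p * q0 = p * s" by (elim dvdE)
  then have r: "r = p * s - pderiv p * q0" by (simp add: algebra_simps)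
  \<comment> \<open>A candidate \<open>q0 + p * v\<close> solves the equation iff
    \<open>s - q0' = p * v'\<close>. This divisibility is where the residue condition is
    spent.\<close>
  have "p dvd s - pderiv q0"
  proof (rule rsquarefree_dvdI[OF p])
    fix t assume t: "poly p t = 0"
    have "poly (pderiv p) t ^ 2 * (poly s t - poly (pderiv q0) t) = 0"
      using res[OF t] t unfolding r
      by (simp add: pderiv_mult pderiv_diff algebra_simps power2_eq_square)
    then show "poly (s - pderiv q0) t = 0" using simple[OF t] by simp
  qed
  then obtain w where w: "s - pderiv q0 = p * w" by (elim dvdE)
  obtain v where v: "pderiv v = w" using pderiv_surj by blast
  define q1 where "q1 = q0 + p * v"
  have s: "s = pderiv q0 + p * w" using w by (simp add: algebra_simps)
  have q1: "wr p q1 = r"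
    unfolding r s by (simp add: q1_def wr_def pderiv_add pderiv_mult v algebra_simps)
  \<comment> \<open>Solutions may be changed by multiples of \<open>p\<close>. Subtracting one rules
    out equal degrees, which makes the degree count exact.\<close>
  define q where "q = (if degree q1 = degree p then q1 - Polynomial.smult (lead_coeff q1 / lead_coeff p) p else q1)"
  have q: "wr p q = r" using q1 by (simp add: q_def wr_diff_smult)
  have qnz: "q \<noteq> 0" using q r0 by (auto simp: wr_def)
  have "degree p \<noteq> degree q"
  proof
    assume eq: "degree p = degree q"
    show False
    proof (cases "degree q1 = degree p")
      case True
      then have "poly.coeff q (degree p) = 0" using p0 by (simp add: q_def)
      then show False using eq qnz by simp
    next
      case False
      then have "q = q1" by (simp only: q_def if_False)
      then show False using eq False by simp
    qed
  qed
  then show ?thesis using degree_wr[of p q] p0 qnz q by auto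
qed

text \<open>This recovers a monic polynomial from its logarithmic derivative. If
  \<open>q - p\<close> were nonzero, it would have a vanishing Wronskian with \<open>p\<close> and
  hence the degree of \<open>p\<close>, but monicity cancels that coefficient.\<close>

lemma wr_eq_0_monic:
  assumes "wr p q = 0" "lead_coeff p = 1" "lead_coeff q = 1"
  shows "p = q"
proof (rule ccontr)
  assume "p \<noteq> q"
  have nz: "p \<noteq> 0" "q \<noteq> 0" using assms by auto
  have deg: "degree p = degree q" using degree_wr(1)[OF nz] assms(1) by auto
  define r where "r = q - p"
  have "r \<noteq> 0" using \<open>p \<noteq> q\<close> by (simp add: r_def)
  have "wr p r = 0" using assms(1) wr_diff_smult[of p q 1] by (simp add: r_def)
  then have "degree p = degree r" using degree_wr(1)[OF nz(1) \<open>r \<noteq> 0\<close>] by auto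
  moreover have "poly.coeff r (degree p) = 0" using assms deg by (simp add: r_def)
  ultimately show False using \<open>r \<noteq> 0\<close> by simp
qed


section \<open>Critical points\<close>

text \<open>The critical point equations for the roots of \<open>p\<close>, where \<open>q\<close> and \<open>r\<close> have the neighbouring groups
  of coordinates as their roots, with denominators cleared.\<close>

definition bethe_polys :: "complex poly \<Rightarrow> complex poly \<Rightarrow> complex poly \<Rightarrow> bool" where
  "bethe_polys q p r \<longleftrightarrow> rsquarefree p \<and>
     (\<forall>t. poly p t = 0 \<longrightarrow> poly q t \<noteq> 0 \<and> poly r t \<noteq> 0 \<and>
        poly (pderiv (pderiv p)) t * poly (q * r) t = poly (pderiv p) t * poly (pderiv (q * r)) t)"

lemma pderiv_linear_mult: "pderiv ([:- a, 1:] * r) = r + [:- a, 1:] * pderiv (r :: complex poly)"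
proof -
  have "pderiv [:- a, 1:] = 1" by (simp add: pderiv_pCons)
  then show ?thesis by (simp only: pderiv_mult) simp
qed

lemma poly_pderiv_linear_product:
  assumes "finite A" "\<And>j. j \<in> A \<Longrightarrow> t \<noteq> c j"
  shows "poly (pderiv (\<Prod>j\<in>A. [:- c j, 1:])) t = poly (\<Prod>j\<in>A. [:- c j, 1:]) t * (\<Sum>j\<in>A. 1 / (t - c j :: complex))"
  using assms
proof induction
  case (insert a A)
  then have "t - c a \<noteq> 0" by auto
  moreover have "poly (pderiv (\<Prod>j\<in>A. [:- c j, 1:])) t
      = poly (\<Prod>j\<in>A. [:- c j, 1:]) t * (\<Sum>j\<in>A. 1 / (t - c j))"
    using insert by blast
  ultimately show ?case
    by (simp only: prod.insert[OF insert.hyps] sum.insert[OF insert.hyps] pderiv_linear_mult poly_add poly_mult)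
      (simp add: field_simps)
qed simp

lemma poly_pderiv_linear_product_root:
  assumes "finite A" "i \<in> A"
  shows "poly (pderiv (\<Prod>j\<in>A. [:- c j, 1:])) (c i) = poly (\<Prod>j\<in>A - {i}. [:- c j, 1:]) (c i :: complex)"
    "poly (pderiv (pderiv (\<Prod>j\<in>A. [:- c j, 1:]))) (c i) = 2 * poly (pderiv (\<Prod>j\<in>A - {i}. [:- c j, 1:])) (c i)"
proof -
  have "(\<Prod>j\<in>A. [:- c j, 1:]) = [:- c i, 1:] * (\<Prod>j\<in>A - {i}. [:- c j, 1:])"
    using assms by (rule prod.remove)
  then show "poly (pderiv (\<Prod>j\<in>A. [:- c j, 1:])) (c i) = poly (\<Prod>j\<in>A - {i}. [:- c j, 1:]) (c i)"
    "poly (pderiv (pderiv (\<Prod>j\<in>A. [:- c j, 1:]))) (c i) = 2 * poly (pderiv (\<Prod>j\<in>A - {i}. [:- c j, 1:])) (c i)"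
    by (simp_all only: pderiv_linear_mult pderiv_add poly_add poly_mult) simp_all
qed

lemma rsquarefree_linear_product:
  fixes c :: "nat \<Rightarrow> complex"
  shows "rsquarefree (\<Prod>i\<in>{1..n}. [:- c i, 1:]) \<longleftrightarrow> inj_on c {1..n}"
proof -
  let ?p = "\<Prod>i\<in>{1..n}. [:- c i, 1:]"
  have root: "poly ?p t = 0 \<longleftrightarrow> (\<exists>i\<in>{1..n}. t = c i)" for t by (auto simp: poly_prod)
  have der: "poly (pderiv ?p) (c i) = 0 \<longleftrightarrow> (\<exists>j\<in>{1..n} - {i}. c i = c j)" if "i \<in> {1..n}" for i
    unfolding poly_pderiv_linear_product_root(1)[OF finite_atLeastAtMost that] by (simp add: poly_prod)
  have "rsquarefree ?p \<longleftrightarrow> (\<forall>i\<in>{1..n}. poly (pderiv ?p) (c i) \<noteq> 0)"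
    unfolding rsquarefree_roots root by blast
  also have "\<dots> \<longleftrightarrow> (\<forall>i\<in>{1..n}. \<not> (\<exists>j\<in>{1..n} - {i}. c i = c j))"
    by (rule ball_cong[OF refl]) (simp only: der not_False_eq_True)
  also have "\<dots> \<longleftrightarrow> inj_on c {1..n}" unfolding inj_on_def by blast
  finally show ?thesis .
qed

text \<open>At a simple root the second derivative divided by the first is twice the sum of
  \<open>1 / (c i - c j)\<close>, while the logarithmic derivative of the other product is the sum
  over both neighbouring groups.\<close>

lemma bethe_equation:
  fixes A :: "'i set" and c :: "'i \<Rightarrow> complex"
  assumes A: "finite A" "i \<in> A" and B: "finite B" and D: "finite D"
    and neq: "\<And>j. j \<in> A - {i} \<Longrightarrow> c i \<noteq> c j" "\<And>j. j \<in> B \<Longrightarrow> c i \<noteq> b j" "\<And>j. j \<in> D \<Longrightarrow> c i \<noteq> b' j"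
  shows "poly (pderiv (pderiv (\<Prod>j\<in>A. [:- c j, 1:]))) (c i) * poly ((\<Prod>j\<in>B. [:- b j, 1:]) * (\<Prod>j\<in>D. [:- b' j, 1:])) (c i)
       = poly (pderiv (\<Prod>j\<in>A. [:- c j, 1:])) (c i) * poly (pderiv ((\<Prod>j\<in>B. [:- b j, 1:]) * (\<Prod>j\<in>D. [:- b' j, 1:]))) (c i)
     \<longleftrightarrow> (\<Sum>j\<in>B. 1 / (c i - b j)) - (\<Sum>j\<in>A - {i}. 2 / (c i - c j)) + (\<Sum>j\<in>D. 1 / (c i - b' j)) = 0"
proof -
  let ?R = "\<Prod>j\<in>A - {i}. [:- c j, 1:]" and ?U = "\<Prod>j\<in>B. [:- b j, 1:]" and ?V = "\<Prod>j\<in>D. [:- b' j, 1:]"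
  define x where "x = (\<Sum>j\<in>A - {i}. 1 / (c i - c j))"
  define y where "y = (\<Sum>j\<in>B. 1 / (c i - b j))"
  define z where "z = (\<Sum>j\<in>D. 1 / (c i - b' j))"
  have nz: "poly ?R (c i) \<noteq> 0" "poly ?U (c i) \<noteq> 0" "poly ?V (c i) \<noteq> 0"
    using A B D neq by (auto simp: poly_prod)
  have R: "poly (pderiv ?R) (c i) = poly ?R (c i) * x"
    unfolding x_def using A neq by (intro poly_pderiv_linear_product) auto
  have U: "poly (pderiv ?U) (c i) = poly ?U (c i) * y"
    unfolding y_def using B neq by (intro poly_pderiv_linear_product) auto
  have V: "poly (pderiv ?V) (c i) = poly ?V (c i) * z"
    unfolding z_def using D neq by (intro poly_pderiv_linear_product) auto
  have two: "(\<Sum>j\<in>A - {i}. 2 / (c i - c j)) = 2 * x"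
    unfolding x_def by (simp add: sum_distrib_left)
  have alg: "2 * (r * x) * (u * v) = r * (v * (u * y) + u * (v * z)) \<longleftrightarrow> y - 2 * x + z = 0"
    if "r \<noteq> 0" "u \<noteq> 0" "v \<noteq> 0" for r u v :: complex
  proof -
    have "2 * (r * x) * (u * v) - r * (v * (u * y) + u * (v * z)) = - (r * u * v) * (y - 2 * x + z)"
      by (simp add: algebra_simps)
    then show ?thesis using that by (metis eq_iff_diff_eq_0 mult_eq_0_iff neg_equal_0_iff_equal)
  qed
  show ?thesis
    unfolding poly_pderiv_linear_product_root[OF A] two R pderiv_mult poly_add poly_mult U V
      y_def[symmetric] z_def[symmetric]
    using alg[OF nz] by (simp add: mult_ac add.commute)
qed

context partition_data begin

definition bethe :: "(nat \<times> nat \<Rightarrow> complex) \<Rightarrow> bool" where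
  "bethe s \<longleftrightarrow> (\<forall>a\<in>{1..N - 1}. bethe_polys (cpoly s (a - 1)) (cpoly s a) (cpoly s (a + 1)))"

lemma cpoly_quotient_map': "a \<le> N \<Longrightarrow> cpoly (quotient_map N lam T) a = (\<Prod>i=1..l a. [:- T (a, i), 1:])"
  by (cases "a = N") (simp_all add: cpoly_quotient_map)

text \<open>The critical equations become a condition on the quotient point, independent of the
  numbering of the roots. For \<open>a = N - 1\<close> the upper neighbour is the constant
  1.\<close>

lemma critical_point_iff_bethe:
  "critical_point N lam T \<longleftrightarrow> T \<in> affine_points IC \<and> bethe (quotient_map N lam T)"
proof -
  let ?c = "cpoly (quotient_map N lam T)"
  let ?eq = "\<lambda>a i. (\<Sum>j = 1..l (a - 1). 1 / (T (a, i) - T (a - 1, j)))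
          - (\<Sum>j\<in>{1..l a} - {i}. 2 / (T (a, i) - T (a, j)))
          + (\<Sum>j = 1..l (a + 1). 1 / (T (a, i) - T (a + 1, j))) = 0"
  have "bethe_polys (?c (a - 1)) (?c a) (?c (a + 1))
    \<longleftrightarrow> (\<forall>i\<in>{1..l a}.
        (\<forall>j\<in>{1..l (a - 1)}. T (a, i) \<noteq> T (a - 1, j)) \<and>
        (\<forall>j\<in>{1..l a} - {i}. T (a, i) \<noteq> T (a, j)) \<and>
        (\<forall>j\<in>{1..l (a + 1)}. T (a, i) \<noteq> T (a + 1, j)) \<and> ?eq a i)"
    (is "_ \<longleftrightarrow> (\<forall>i\<in>_. ?R i)") if a: "a \<in> {1..N - 1}" for a
  proof -
    have p: "?c a = (\<Prod>i=1..l a. [:- T (a, i), 1:])"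
      "?c (a - 1) = (\<Prod>i=1..l (a - 1). [:- T (a - 1, i), 1:])"
      "?c (a + 1) = (\<Prod>i=1..l (a + 1). [:- T (a + 1, i), 1:])"
    proof -
      have "a \<le> N" "a - 1 \<le> N" "a + 1 \<le> N" using a N_pos by auto
      then show "?c a = (\<Prod>i=1..l a. [:- T (a, i), 1:])"
        "?c (a - 1) = (\<Prod>i=1..l (a - 1). [:- T (a - 1, i), 1:])"
        "?c (a + 1) = (\<Prod>i=1..l (a + 1). [:- T (a + 1, i), 1:])"
        by (simp_all only: cpoly_quotient_map')
    qed
    let ?E = "\<lambda>t. poly (pderiv (pderiv (?c a))) t * poly (?c (a - 1) * ?c (a + 1)) t
          = poly (pderiv (?c a)) t * poly (pderiv (?c (a - 1) * ?c (a + 1))) t"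
    have rsq: "rsquarefree (?c a) \<longleftrightarrow> (\<forall>i\<in>{1..l a}. \<forall>j\<in>{1..l a} - {i}. T (a, i) \<noteq> T (a, j))"
      unfolding p rsquarefree_linear_product inj_on_def by blast
    have root: "poly (?c a) t = 0 \<longleftrightarrow> (\<exists>i\<in>{1..l a}. t = T (a, i))" for t
      unfolding p by (auto simp: poly_prod)
    have nb: "poly (?c (a - 1)) t \<noteq> 0 \<longleftrightarrow> (\<forall>j\<in>{1..l (a - 1)}. t \<noteq> T (a - 1, j))"
      "poly (?c (a + 1)) t \<noteq> 0 \<longleftrightarrow> (\<forall>j\<in>{1..l (a + 1)}. t \<noteq> T (a + 1, j))" for t
      unfolding p by (auto simp: poly_prod)
    have eq: "?E (T (a, i)) \<longleftrightarrow> ?eq a i"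
      if "i \<in> {1..l a}" "\<forall>j\<in>{1..l a} - {i}. T (a, i) \<noteq> T (a, j)"
        "\<forall>j\<in>{1..l (a - 1)}. T (a, i) \<noteq> T (a - 1, j)" "\<forall>j\<in>{1..l (a + 1)}. T (a, i) \<noteq> T (a + 1, j)" for i
      unfolding p
      by (rule bethe_equation[of "{1..l a}" i "{1..l (a - 1)}" "{1..l (a + 1)}" "\<lambda>i. T (a, i)"
            "\<lambda>i. T (a - 1, i)" "\<lambda>i. T (a + 1, i)"]) (use that in blast)+
    have *: "((\<forall>i\<in>I. D i) \<and> (\<forall>t. (\<exists>i\<in>I. t = c i) \<longrightarrow> Q1 t \<and> Q2 t \<and> Q3 t))
      = (\<forall>i\<in>I. D i \<and> Q1 (c i) \<and> Q2 (c i) \<and> Q3 (c i))"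
      for I :: "nat set" and c :: "nat \<Rightarrow> complex" and D Q1 Q2 Q3 by blast
    have "bethe_polys (?c (a - 1)) (?c a) (?c (a + 1)) \<longleftrightarrow>
        (\<forall>i\<in>{1..l a}. (\<forall>j\<in>{1..l a} - {i}. T (a, i) \<noteq> T (a, j)) \<and>
        (\<forall>j\<in>{1..l (a - 1)}. T (a, i) \<noteq> T (a - 1, j)) \<and>
        (\<forall>j\<in>{1..l (a + 1)}. T (a, i) \<noteq> T (a + 1, j)) \<and> ?E (T (a, i)))" (is "_ \<longleftrightarrow> (\<forall>i\<in>_. ?L i)")
      unfolding bethe_polys_def rsq root nb by (rule *[where c = "\<lambda>i. T (a, i)"])
    also have "\<dots> \<longleftrightarrow> (\<forall>i\<in>{1..l a}. ?R i)"
    proof (rule ball_cong[OF refl])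
      fix i assume i: "i \<in> {1..l a}"
      show "?L i \<longleftrightarrow> ?R i" using eq[OF i] by blast
    qed
    finally show ?thesis .
  qed
  then show ?thesis unfolding critical_point_def bethe_def by blast
qed

end

section \<open>From critical points to the cell\<close>

text \<open>With \<open>\<chi>\<close> the logarithmic derivative of \<open>A/B\<close>, the factor
  \<open>d/du - \<chi>\<close> is \<open>d/du\<close> conjugated by \<open>A/B\<close>. It sends
  \<open>y/B\<close> to \<open>(A/B) (y/A)'\<close>, which brings in the Wronskian of
  \<open>A\<close> and \<open>y\<close>.\<close>

lemma dfact_quotient:
  assumes "A \<noteq> 0" "B \<noteq> 0"
  shows "du (y / B) - (dlog A - dlog B) * (y / B) = (A * du y - du A * y) / (A * B)"
proof -
  have "du y = du ((y / B) * B)" using assms by simp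
  also have "\<dots> = du (y / B) * B + (y / B) * du B" by (rule du_mult)
  finally have "du (y / B) = du y / B - dlog B * (y / B)"
    using assms by (simp add: dlog_def divide_simps)
  then have "du (y / B) - (dlog A - dlog B) * (y / B) = du y / B - dlog A * (y / B)"
    by (simp add: left_diff_distrib diff_divide_distrib)
  also have "\<dots> = (A * du y - du A * y) / (A * B)"
    using assms by (simp add: dlog_def diff_divide_distrib)
  finally show ?thesis .
qed

context partition_data begin

text \<open>Put \<open>P_k = cpoly s (N - k)\<close>. To reach \<open>q / P_k\<close> by the first
  \<open>k\<close> factors, the outermost one is undone by some \<open>q'\<close> with
  \<open>wr P_k q' = q P_(k-1)\<close>. For the residues to vanish, the critical equations at the
  roots of \<open>P_k\<close> must be joined by the stationarity of \<open>q / P_(k+1)\<close> at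
  these roots; this is the condition carried through the induction. \<open>E\<close> is the degree
  that \<open>f\<close> has to get.\<close>

lemma bethe_descent:
  assumes bethe: "bethe s"
  shows "k < N \<Longrightarrow> q \<noteq> 0 \<Longrightarrow> degree q + e (Suc k) = l (N - Suc k) + E \<Longrightarrow>
    (\<forall>t. poly (cpoly s (N - k)) t = 0 \<longrightarrow>
       poly (pderiv q) t * poly (cpoly s (N - Suc k)) t = poly q t * poly (pderiv (cpoly s (N - Suc k))) t) \<Longrightarrow>
    \<exists>f. f \<noteq> 0 \<and> degree f = E \<and> diffop_apply (PD s k) (poly_at_inf f) = poly_at_inf q / PP s k"
proof (induction k arbitrary: q)
  case 0
  have "e (Suc 0) = l (N - Suc 0)" using N_pos l_step[of 0] by (simp add: e_altdef)
  then show ?case using 0 by (intro exI[of _ q]) auto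
next
  case (Suc k)
  let ?a = "N - Suc k"
  let ?p = "cpoly s ?a" and ?U = "cpoly s (N - Suc (Suc k))" and ?V = "cpoly s (N - k)"
  let ?r = "q * ?V"
  have a: "?a \<in> {1..N - 1}" "?a - 1 = N - Suc (Suc k)" "?a + 1 = N - k" using Suc.prems(1) by auto
  have sq: "rsquarefree ?p"
    and nz: "\<And>t. poly ?p t = 0 \<Longrightarrow> poly ?U t \<noteq> 0"
    and eq: "\<And>t. poly ?p t = 0 \<Longrightarrow> poly (pderiv (pderiv ?p)) t * poly (?U * ?V) t = poly (pderiv ?p) t * poly (pderiv (?U * ?V)) t"
    using bethe[unfolded bethe_def, rule_format, OF a(1)] unfolding a(2,3) bethe_polys_def by blast+
  have r0: "?r \<noteq> 0" using Suc.prems(2) by simp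
  have "\<exists>q'. q' \<noteq> 0 \<and> wr ?p q' = ?r \<and> degree ?p + degree q' = Suc (degree ?r)"
  proof (rule wr_solvable[OF sq r0])
    fix t assume t: "poly ?p t = 0"
    have good: "poly (pderiv q) t * poly ?U t = poly q t * poly (pderiv ?U) t" using Suc.prems(4) t by blast
    \<comment> \<open>Multiplication by \<open>?U\<close>, which is nonzero at \<open>t\<close>,
      lets both the stationarity of \<open>q / ?U\<close> and the critical equation be
      substituted.\<close>
    have "poly ?U t * (poly (pderiv ?r) t * poly (pderiv ?p) t)
        = poly (pderiv ?p) t * (poly ?V t * (poly (pderiv q) t * poly ?U t) + poly ?U t * poly q t * poly (pderiv ?V) t)"
      by (simp add: pderiv_mult algebra_simps)
    also have "\<dots> = poly q t * (poly (pderiv ?p) t * poly (pderiv (?U * ?V)) t)"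
      unfolding good by (simp add: pderiv_mult algebra_simps)
    also have "\<dots> = poly ?U t * (poly ?r t * poly (pderiv (pderiv ?p)) t)"
      unfolding eq[OF t, symmetric] by (simp add: algebra_simps)
    finally show "poly (pderiv ?r) t * poly (pderiv ?p) t = poly ?r t * poly (pderiv (pderiv ?p)) t"
      using nz[OF t] by simp
  qed
  then obtain q' where q': "q' \<noteq> 0" "wr ?p q' = ?r" "degree ?p + degree q' = Suc (degree ?r)" by blast
  have "\<exists>f. f \<noteq> 0 \<and> degree f = E \<and> diffop_apply (PD s k) (poly_at_inf f) = poly_at_inf q' / PP s k"
  proof (rule Suc.IH)
    show "k < N" using Suc.prems(1) by simp
    have "degree ?r = degree q + l (N - k)" using Suc.prems(2) by (simp add: degree_mult_eq)
    moreover have "l (N - Suc k) = l (N - k) + lam (N - k)"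
      "l (N - Suc (Suc k)) = l (N - Suc k) + lam (N - Suc k)"
      using l_step[of k] l_step[of "Suc k"] Suc.prems(1) by auto
    moreover have "e (Suc k) = lam (N - k) + k" "e (Suc (Suc k)) = lam (N - Suc k) + Suc k"
      using Suc.prems(1) by (auto simp: e_altdef)
    ultimately show "degree q' + e (Suc k) = l (N - Suc k) + E"
      using q'(3) Suc.prems(3) by simp
    \<comment> \<open>The condition for the next step is free, because \<open>wr ?p q'\<close> is a
      multiple of \<open>?V\<close>.\<close>
    show "\<forall>t. poly ?V t = 0 \<longrightarrow> poly (pderiv q') t * poly ?p t = poly q' t * poly (pderiv ?p) t"
    proof (intro allI impI)
      fix t assume "poly ?V t = 0"
      then have "poly (wr ?p q') t = 0" unfolding q'(2) by simp
      then show "poly (pderiv q') t * poly ?p t = poly q' t * poly (pderiv ?p) t"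
        by (simp add: wr_def mult.commute)
    qed
  qed (rule q'(1))
  then obtain f where f: "f \<noteq> 0" "degree f = E"
    "diffop_apply (PD s k) (poly_at_inf f) = poly_at_inf q' / PP s k" by blast
  have PPnz: "PP s (Suc k) \<noteq> 0" "PP s k \<noteq> 0" by simp_all
  have "diffop_apply (PD s (Suc k)) (poly_at_inf f)
      = poly_at_inf (wr ?p q') / (PP s (Suc k) * PP s k)"
    by (simp only: PD.simps diffop_apply_dfact f(3) dfact_quotient[OF PPnz])
      (simp add: wr_def)
  also have "\<dots> = poly_at_inf q / PP s (Suc k)"
    unfolding q'(2) by simp
  finally show ?case using f by blast
qed

lemma PD_kernel_mono:
  assumes "diffop_apply (PD s k) h = 0" "k \<le> m" shows "diffop_apply (PD s m) h = 0"
  using assms(2) by (induction m rule: dec_induct) (auto simp: assms(1) diffop_apply_dfact)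

text \<open>Starting the descent from \<open>cpoly s (N - Suc k)\<close> makes its side condition
  trivial, and \<open>PP s (Suc k) / PP s k\<close> is the function killed by the next
  factor.\<close>

lemma bethe_kernel:
  assumes "bethe s" "k < N"
  shows "\<exists>f. f \<noteq> 0 \<and> degree f = e (Suc k) \<and> diffop_apply (PD s (Suc k)) (poly_at_inf f) = 0"
proof -
  have "\<exists>f. f \<noteq> 0 \<and> degree f = e (Suc k) \<and> diffop_apply (PD s k) (poly_at_inf f) = PP s (Suc k) / PP s k"
    by (rule bethe_descent[OF assms]) auto
  then obtain f where f: "f \<noteq> 0" "degree f = e (Suc k)"
    "diffop_apply (PD s k) (poly_at_inf f) = PP s (Suc k) / PP s k" by blast
  have PPnz: "PP s (Suc k) \<noteq> 0" "PP s k \<noteq> 0" by simp_all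
  have "diffop_apply (PD s (Suc k)) (poly_at_inf f) = 0"
    by (simp only: PD.simps diffop_apply_dfact f(3) dfact_quotient[OF PPnz]) (simp add: algebra_simps)
  then show ?thesis using f by blast
qed

lemma PD_kernel_degree:
  assumes "m \<le> N" "p \<noteq> 0" "diffop_apply (PD s m) (poly_at_inf p) = 0"
  shows "degree p \<in> e ` {1..m}"
proof (rule ccontr)
  assume np: "degree p \<notin> e ` {1..m}"
  have "leads (diffop_apply (PD s m) (poly_at_inf p)) (- int (degree p) + int m)
       ((\<Prod>i=1..m. - of_int (- int (degree p)) - of_nat (e i)) * lead_coeff p)"
    by (rule leads_PD[OF assms(1) leads_poly])
  moreover have "(\<Prod>i=1..m. - of_int (- int (degree p)) - of_nat (e i)) * lead_coeff p \<noteq> 0"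
    using assms np by auto
  ultimately show False using assms leads_nonzero by blast
qed

lemma PD_kernel_subspace: "pv.subspace {p. diffop_apply (PD s m) (poly_at_inf p) = 0}"
  by (rule pv.subspaceI) (auto simp: diffop_apply_arg_add diffop_apply_arg_cmult)

lemma e_strict_mono: "i \<in> {1..N} \<Longrightarrow> j \<in> {1..N} \<Longrightarrow> e i \<le> e j \<longleftrightarrow> i \<le> j"
  using e_mono[of i j] e_mono[of j i] by (cases i j rule: linorder_cases) auto

text \<open>For \<open>psi x = s\<close> it does not suffice that the full operators agree; the
  partial products must match as well. To this end the flag basis is shown to be compatible with the
  increasing kernels \<open>?Y m\<close>. Uniqueness of monic operators then applies at every
  stage.\<close>

theorem bethe_solution:
  assumes bethe: "bethe s" and s: "s \<in> affine_points IC"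
  shows "\<exists>x. (\<forall>i\<in>{1..N}. diffop_apply (PD s N) (poly_at_inf (fpoly x i)) = 0) \<and> psi x = s"
proof -
  let ?Y = "\<lambda>m. {p. diffop_apply (PD s m) (poly_at_inf p) = 0}"
  have Ymono: "?Y k \<subseteq> ?Y m" if "k \<le> m" for k m using PD_kernel_mono that by blast
  have ex: "\<exists>f\<in>?Y m. f \<noteq> 0 \<and> degree f = e m" if "m \<in> {1..N}" for m
  proof -
    have m: "m - 1 < N" "Suc (m - 1) = m" using that by auto
    from bethe_kernel[OF bethe m(1)] show ?thesis unfolding m(2) by blast
  qed
  have "\<exists>x. ?Y N = cellspace x"
  proof (rule subspace_cellspace[OF PD_kernel_subspace])
    show "\<forall>i\<in>{1..N}. \<exists>p\<in>?Y N. p \<noteq> 0 \<and> degree p = d i"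
    proof
      fix i assume i: "i \<in> {1..N}"
      then have m: "N + 1 - i \<in> {1..N}" by auto
      have "d i = e (N + 1 - i)" using i by (intro d_eq_e) auto
      then show "\<exists>p\<in>?Y N. p \<noteq> 0 \<and> degree p = d i"
        using ex[OF m] Ymono[of "N + 1 - i" N] m by auto
    qed
  qed (use PD_kernel_degree[of N] in \<open>auto simp: P_eq_e\<close>)
  then obtain x where x: "?Y N = cellspace x" by blast
  have kill: "diffop_apply (PD s N) (poly_at_inf (fpoly x i)) = 0" if "i \<in> {1..N}" for i
    using fpoly_in_cellspace[OF that, of x] unfolding x[symmetric] by simp
  \<comment> \<open>\<open>?Y m\<close> has monic elements of degrees \<open>e 1, ..., e m\<close>.
    Reducing \<open>F x i\<close> against them leaves an element of \<open>?Y N\<close> of degree at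
    most \<open>e m\<close> without coefficients at these exponents, hence 0.\<close>
  have Fin: "F x i \<in> ?Y m" if m: "m \<le> N" and i: "i \<in> {1..m}" for m i
  proof -
    have "\<exists>f\<in>?Y m. degree f = e j \<and> poly.coeff f (e j) = 1" if j: "j \<in> {1..m}" for j
    proof -
      obtain f where f: "f \<in> ?Y j" "f \<noteq> 0" "degree f = e j" using ex[of j] j m by auto
      then have "f \<in> ?Y m" using Ymono[of j m] j by auto
      then have "Polynomial.smult (inverse (lead_coeff f)) f \<in> ?Y m"
        by (simp add: diffop_apply_arg_cmult)
      moreover have "poly.coeff f (e j) \<noteq> 0" using f leading_coeff_0_iff[of f] by metis
      ultimately show ?thesis
        using f by (intro bexI[of _ "Polynomial.smult (inverse (lead_coeff f)) f"]) auto
    qed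
    then have "\<forall>q\<in>e ` {1..m}. \<exists>f\<in>?Y m. degree f = q \<and> poly.coeff f q = 1" by blast
    then obtain h where h: "\<And>q. q \<in> e ` {1..m} \<Longrightarrow> h q \<in> ?Y m"
      "\<And>q. q \<in> e ` {1..m} \<Longrightarrow> degree (h q) = q" "\<And>q. q \<in> e ` {1..m} \<Longrightarrow> poly.coeff (h q) q = 1" by metis
    obtain c where c: "\<forall>q\<in>e ` {1..m}. poly.coeff (F x i - (\<Sum>r\<in>e ` {1..m}. Polynomial.smult (c r) (h r))) q = 0"
      using echelon_reduction[of "e ` {1..m}" h "F x i"] h(2,3) by auto
    let ?S = "\<Sum>r\<in>e ` {1..m}. Polynomial.smult (c r) (h r)"
    have SY: "?S \<in> ?Y m"
      by (intro pv.subspace_sum[OF PD_kernel_subspace] pv.subspace_scale[OF PD_kernel_subspace] h(1))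
    have le: "q \<le> e m" if "q \<in> e ` {1..m}" for q using that m i e_strict_mono by auto
    have "degree (F x i - ?S) \<le> e m"
      by (intro degree_diff_le degree_sum_le order_trans[OF degree_smult_le])
        (use le h(2) i in auto)
    moreover have "F x i - ?S \<in> ?Y N"
    proof -
      have "F x i \<in> cellspace x" unfolding F_def by (rule fpoly_in_cellspace) (use i m in auto)
      then show ?thesis using SY Ymono[OF m] pv.subspace_diff[OF PD_kernel_subspace, of "F x i" s N ?S]
        unfolding x[symmetric] by blast
    qed
    ultimately have "F x i - ?S = 0"
      using PD_kernel_degree[of N "F x i - ?S" s] c e_strict_mono[of _ m] i m leading_coeff_0_iff
      by (smt (verit, ccfv_threshold) atLeastAtMost_iff imageE image_eqI mem_Collect_eq order_refl order_trans)
    then show ?thesis using SY by simp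
  qed
  have PD_eq: "PD s m = PD (psi x) m" if m: "m \<le> N" for m
    unfolding PD_psi[OF m]
    by (rule chain.lop_eqI[OF m monic_PD]) (use Fin[OF m] in auto)
  \<comment> \<open>The outermost factor shows in the subleading coefficient, so equal partial
    products have equal factors.\<close>
  have dlog_eq: "m \<le> N \<Longrightarrow> dlog (PP s m) = dlog (PP (psi x) m)" for m
  proof (induction m)
    case (Suc m)
    have "poly.coeff (PD s (Suc m)) m = poly.coeff (PD (psi x) (Suc m)) m" using PD_eq[OF Suc.prems] by simp
    moreover have "poly.coeff (PD s m) m = 1" "poly.coeff (PD (psi x) m) m = 1" "PD s m = PD (psi x) m"
      using monic_PD PD_eq[of m] Suc.prems by (auto simp: monic_op_def)
    ultimately have "dlog (PP s (Suc m)) - dlog (PP s m) = dlog (PP (psi x) (Suc m)) - dlog (PP (psi x) m)"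
      by (simp add: coeff_dfact) (metis minus_diff_eq)
    then show ?case using Suc by simp
  qed simp
  have "psi x = s"
  proof (rule cpoly_inject[OF _ s])
    fix a assume a: "a < N"
    have "dlog (poly_at_inf (cpoly s a)) = dlog (poly_at_inf (cpoly (psi x) a))"
      using dlog_eq[of "N - a"] a by simp
    then have "poly_at_inf (wr (cpoly s a) (cpoly (psi x) a)) = 0"
      by (simp add: dlog_def wr_def frac_eq_eq mult.commute)
    then have "wr (cpoly s a) (cpoly (psi x) a) = 0" by simp
    then show "cpoly (psi x) a = cpoly s a"
      by (rule wr_eq_0_monic[symmetric]) (simp_all add: coeff_cpoly)
  qed simp
  then show ?thesis using kill by blast
qed


section \<open>Generic points of the cell\<close>

text \<open>For \<open>k = N\<close>, simple roots mean distinct coordinates in group 0. For smaller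
  \<open>k\<close>, simple roots and disjoint neighbours are the nonzero denominators of the
  critical equations.\<close>

definition generic :: "(nat \<times> nat \<Rightarrow> complex) \<Rightarrow> nat \<Rightarrow> bool" where
  "generic x m \<longleftrightarrow> (\<forall>k\<in>{1..m}. rsquarefree (Wp x k) \<and> (\<forall>t. poly (Wp x k) t = 0 \<longrightarrow> poly (Wp x (k - 1)) t \<noteq> 0))"

abbreviation opW :: "(nat \<times> nat \<Rightarrow> complex) \<Rightarrow> nat \<Rightarrow> complex poly \<Rightarrow> complex poly" where
  "opW x m h \<equiv> wopP m (F x) h"

lemma opW_lop:
  assumes "m \<le> N"
  shows "diffop_apply (lop m (g x)) (poly_at_inf h) = poly_at_inf (opW x m h) / poly_at_inf (Wp x m)"
  by (simp add: lop_def diffop_apply_smult poly_at_inf_wopP W_eq divide_inverse mult.commute)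

lemma Wp_Suc: "Wp x (Suc m) = opW x m (F x (Suc m))"
proof -
  have "poly_at_inf (Wp x (Suc m)) = poly_at_inf (opW x m (F x (Suc m)))"
    by (simp add: W_eq[symmetric] wronskian_Suc poly_at_inf_wopP del: poly_at_inf_eq_iff)
  then show ?thesis by simp
qed

text \<open>Two ways of computing \<open>lop (Suc m)\<close> on the flag polynomial
  \<open>F x (Suc (Suc m))\<close>: as a quotient of Wronskians, and through the outermost
  first-order factor.\<close>

lemma wr_Wp:
  assumes m: "Suc m < N"
  shows "wr (Wp x (Suc m)) (opW x m (F x (Suc (Suc m)))) = Wp x (Suc (Suc m)) * Wp x m"
proof -
  let ?q = "opW x m (F x (Suc (Suc m)))"
  have nz: "poly_at_inf (Wp x (Suc m)) \<noteq> 0" "poly_at_inf (Wp x m) \<noteq> 0"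
    using Wp_nonzero[of "Suc m" x] Wp_nonzero[of m x] m by auto
  have "poly_at_inf (Wp x (Suc (Suc m))) / poly_at_inf (Wp x (Suc m))
      = diffop_apply (lop (Suc m) (g x)) (g x (Suc (Suc m)))"
    using opW_lop[of "Suc m" x "F x (Suc (Suc m))"] m by (simp add: Wp_Suc)
  also have "\<dots> = poly_at_inf (wr (Wp x (Suc m)) ?q) / (poly_at_inf (Wp x (Suc m)) * poly_at_inf (Wp x m))"
    using m by (simp only: chain.lop_Suc[of m x] Suc_lessD diffop_apply_dfact opW_lop less_imp_le W_eq dfact_quotient[OF nz])
      (simp add: wr_def)
  finally have "poly_at_inf (wr (Wp x (Suc m)) ?q) = poly_at_inf (Wp x (Suc (Suc m)) * Wp x m)"
    using nz by (simp add: field_simps)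
  then show ?thesis by (simp only: poly_at_inf_eq_iff)
qed

lemma rsquarefree_smult:
  "c \<noteq> 0 \<Longrightarrow> rsquarefree (Polynomial.smult c p) \<longleftrightarrow> rsquarefree (p :: complex poly)"
  by (simp add: rsquarefree_roots pderiv_smult)

text \<open>Write \<open>w2 w0 = w1 q' - w1' q\<close>. At a root of \<open>w1\<close> the right
  side has value \<open>- w1' q\<close> and derivative \<open>- w1'' q\<close>, because the terms
  \<open>w1' q'\<close> cancel. Eliminating \<open>q\<close> gives the critical equation.\<close>

lemma generic_bethe:
  assumes gen: "generic x N" shows "bethe (psi x)" "rsquarefree (cpoly (psi x) 0)"
proof -
  have Cn: "inverse (C m) \<noteq> 0" if "m \<le> N" for m using chain.C_nonzero[OF that] by simp
  show "rsquarefree (cpoly (psi x) 0)"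
    using gen N_pos Cn[of N] by (simp add: cpoly_psi rsquarefree_smult generic_def)
  show "bethe (psi x)"
    unfolding bethe_def
  proof (intro ballI)
    fix a assume a: "a \<in> {1..N - 1}"
    define m where "m = N - a - 1"
    have m: "N - a = Suc m" "N - (a - 1) = Suc (Suc m)" "N - (a + 1) = m" "Suc m < N" using a by (auto simp: m_def)
    have le: "a \<le> N" "a - 1 \<le> N" "a + 1 \<le> N" using a by auto
    let ?w0 = "Wp x m" and ?w1 = "Wp x (Suc m)" and ?w2 = "Wp x (Suc (Suc m))"
    define c0 c1 c2 where "c0 = inverse (C m)" and "c1 = inverse (C (Suc m))" and "c2 = inverse (C (Suc (Suc m)))"
    have c: "c0 \<noteq> 0" "c1 \<noteq> 0" "c2 \<noteq> 0" using Cn m(4) by (auto simp: c0_def c1_def c2_def)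
    have p: "cpoly (psi x) a = Polynomial.smult c1 ?w1" "cpoly (psi x) (a - 1) = Polynomial.smult c2 ?w2"
      "cpoly (psi x) (a + 1) = Polynomial.smult c0 ?w0"
      using le by (simp_all only: cpoly_psi m c0_def c1_def c2_def)
    have g1: "rsquarefree ?w1" "\<And>t. poly ?w1 t = 0 \<Longrightarrow> poly ?w0 t \<noteq> 0"
      using gen m(4) by (auto simp: generic_def dest!: bspec[of _ _ "Suc m"])
    have g2: "\<And>t. poly ?w2 t = 0 \<Longrightarrow> poly ?w1 t \<noteq> 0"
      using gen m(4) by (auto simp: generic_def dest!: bspec[of _ _ "Suc (Suc m)"])
    let ?q = "opW x m (F x (Suc (Suc m)))"
    have W: "?w2 * ?w0 = ?w1 * pderiv ?q - pderiv ?w1 * ?q" using wr_Wp[OF m(4), of x] by (simp add: wr_def)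
    have eq: "poly (pderiv (pderiv ?w1)) t * poly (?w2 * ?w0) t = poly (pderiv ?w1) t * poly (pderiv (?w2 * ?w0)) t"
      if t: "poly ?w1 t = 0" for t
      unfolding W using t by (simp add: pderiv_mult pderiv_diff algebra_simps)
    show "bethe_polys (cpoly (psi x) (a - 1)) (cpoly (psi x) a) (cpoly (psi x) (a + 1))"
      unfolding p bethe_polys_def
    proof (intro conjI allI impI)
      show "rsquarefree (Polynomial.smult c1 ?w1)" using g1 c by (simp add: rsquarefree_smult)
      fix t assume "poly (Polynomial.smult c1 ?w1) t = 0"
      then have t: "poly ?w1 t = 0" using c by simp
      show "poly (Polynomial.smult c2 ?w2) t \<noteq> 0" using g2 t c by auto
      show "poly (Polynomial.smult c0 ?w0) t \<noteq> 0" using g1 t c by auto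
      show "poly (pderiv (pderiv (Polynomial.smult c1 ?w1))) t * poly (Polynomial.smult c2 ?w2 * Polynomial.smult c0 ?w0) t
        = poly (pderiv (Polynomial.smult c1 ?w1)) t * poly (pderiv (Polynomial.smult c2 ?w2 * Polynomial.smult c0 ?w0)) t"
        using eq[OF t] by (simp only: pderiv_smult mult_smult_left mult_smult_right poly_smult) (simp add: mult_ac)
    qed
  qed
qed

end

text \<open>The polynomial is \<open>(u - z)^\<kappa> / \<kappa>!\<close>, obtained by repeated
  integration from \<open>z\<close>.\<close>

lemma taylor_basis:
  "\<exists>h. degree h \<le> \<kappa> \<and> (\<forall>k. poly ((pderiv ^^ k) h) z = (if k = \<kappa> then 1 else (0 :: complex)))"
proof (induction \<kappa>)
  case 0
  have "(pderiv ^^ k) 1 = (0 :: complex poly)" if "k \<noteq> 0" for k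
    using that by (cases k) (simp_all add: funpow_Suc_right del: funpow.simps)
  then show ?case by (intro exI[of _ 1]) auto
next
  case (Suc \<kappa>)
  then obtain h where h: "degree h \<le> \<kappa>" "\<And>k. poly ((pderiv ^^ k) h) z = (if k = \<kappa> then 1 else 0)" by blast
  obtain v where v: "pderiv v = h" using pderiv_surj by blast
  define v' where "v' = v - [:poly v z:]"
  have v': "pderiv v' = h" by (simp add: v'_def pderiv_diff v pderiv_pCons)
  have "degree h = degree v' - 1" using degree_pderiv[of v'] v' by simp
  then have "degree v' \<le> Suc \<kappa>" using h(1) by simp
  moreover have "poly ((pderiv ^^ k) v') z = (if k = Suc \<kappa> then 1 else 0)" for k
  proof (cases k)
    case (Suc j)
    then show ?thesis using h(2)[of j] by (simp add: funpow_Suc_right v' del: funpow.simps)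
  qed (simp add: v'_def)
  ultimately show ?case by blast
qed

lemma small_avoiding:
  fixes A :: "complex set"
  assumes "finite A" "\<delta> > 0"
  shows "\<exists>c. c \<notin> A \<and> cmod c < \<delta>"
proof -
  have "infinite (complex_of_real ` {0<..<\<delta>})"
    using infinite_Ioo[OF assms(2)] by (subst finite_image_iff) (auto simp: inj_on_def)
  then obtain c where "c \<in> complex_of_real ` {0<..<\<delta>} - A"
    using assms(1) by (metis all_not_in_conv finite.emptyI finite_Diff2)
  then show ?thesis by (intro exI[of _ c]) auto
qed

lemma wopP_add: "wopP m f (a + b) = wopP m f a + wopP m f b"
  and wopP_smult: "wopP m f (Polynomial.smult c a) = Polynomial.smult c (wopP m f a)"
proof -
  have "poly_at_inf (wopP m f (a + b)) = poly_at_inf (wopP m f a + wopP m f b)"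
    by (simp add: poly_at_inf_wopP diffop_apply_arg_add del: poly_at_inf_eq_iff)
  then show "wopP m f (a + b) = wopP m f a + wopP m f b" by (simp only: poly_at_inf_eq_iff)
  have "poly_at_inf (wopP m f (Polynomial.smult c a)) = poly_at_inf (Polynomial.smult c (wopP m f a))"
    by (simp add: poly_at_inf_wopP diffop_apply_arg_cmult del: poly_at_inf_eq_iff)
  then show "wopP m f (Polynomial.smult c a) = Polynomial.smult c (wopP m f a)" by (simp only: poly_at_inf_eq_iff)
qed

lemma wopP_diff: "wopP m f (a - b) = wopP m f a - wopP m f b"
  using wopP_add[of m f "a - b" b] by simp

lemma wopP_sum: "wopP m f (\<Sum>i\<in>I. a i) = (\<Sum>i\<in>I. wopP m f (a i))"
proof -
  have "wopP m f 0 = 0" using wopP_smult[of m f 0 0] by simp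
  then show ?thesis by (induction I rule: infinite_finite_induct) (auto simp: wopP_add)
qed

context partition_data begin

lemma poly_cofactor_top: "poly_cofactor m (F x) m = Wp x m"
proof -
  have "poly_at_inf (poly_cofactor m (F x) m) = poly_at_inf (Wp x m)"
    by (simp only: coeff_wop_poly_at_inf[symmetric] coeff_wop_top W_eq)
  then show ?thesis by simp
qed

lemma poly_cofactor_pred:
  assumes "Suc k \<le> N" shows "poly_cofactor (Suc k) (F x) k = - pderiv (Wp x (Suc k))"
proof -
  have nz: "poly_at_inf (Wp x (Suc k)) \<noteq> 0" using Wp_nonzero[OF assms] by simp
  have "inverse (poly_at_inf (Wp x (Suc k))) * poly_at_inf (poly_cofactor (Suc k) (F x) k)
      = - dlog (poly_at_inf (Wp x (Suc k)))"
    using chain.coeff_lop_pred[OF assms, of x]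
    by (simp only: lop_def coeff_smult coeff_wop_poly_at_inf W_eq)
  then have "poly_at_inf (poly_cofactor (Suc k) (F x) k) = poly_at_inf (- pderiv (Wp x (Suc k)))"
    using nz by (simp add: dlog_def field_simps)
  then show ?thesis by (simp only: poly_at_inf_eq_iff)
qed

lemma opW_kills: "i \<in> {1..m} \<Longrightarrow> opW x m (F x i) = 0"
  using poly_at_inf_wopP[of m "F x" "F x i"] wop_kills[of i m "g x"] by simp

text \<open>The directions in which \<open>F x (Suc m)\<close> can move inside the cell: smaller
  degree, and no coefficient at an exponent, as the flag normalization demands.\<close>

definition admissible :: "nat \<Rightarrow> complex poly set" where
  "admissible m = {h. (\<forall>k\<in>P. poly.coeff h k = 0) \<and> (\<forall>k\<ge>e (Suc m). poly.coeff h k = 0)}"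

lemma admissible_add: "a \<in> admissible m \<Longrightarrow> b \<in> admissible m \<Longrightarrow> a + b \<in> admissible m"
  and admissible_smult: "a \<in> admissible m \<Longrightarrow> Polynomial.smult c a \<in> admissible m"
  by (auto simp: admissible_def)

text \<open>At \<open>z\<close> the operator has coefficient \<open>W_m(z)\<close> at order
  \<open>m\<close> and \<open>- W_m'(z)\<close> at order \<open>m - 1\<close>; simple roots of
  \<open>W_m\<close> keep these from vanishing together. A polynomial with a single nonzero
  derivative at \<open>z\<close> detects the surviving one.\<close>

lemma admissible_base_point:
  assumes m: "m < N" and gen: "generic x m" and em: "e (Suc m) > m"
  shows "\<exists>h\<in>admissible m. poly (opW x m h) z \<noteq> 0"
proof -
  have "\<exists>h0 \<kappa>. degree h0 \<le> \<kappa> \<and> \<kappa> \<le> m \<and> poly (opW x m h0) z \<noteq> 0"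
  proof -
    have val: "poly (opW x m h) z = poly (poly_cofactor m (F x) \<kappa>) z"
      if "\<kappa> \<le> m" "\<forall>k. poly ((pderiv ^^ k) h) z = (if k = \<kappa> then 1 else 0)" for h \<kappa>
      using that by (simp add: wopP_def poly_sum if_distrib[of "\<lambda>t. _ * t"] cong: if_cong)
    show ?thesis
    proof (cases "poly (Wp x m) z = 0")
      case False
      obtain h where "degree h \<le> m" "\<forall>k. poly ((pderiv ^^ k) h) z = (if k = m then 1 else 0)"
        using taylor_basis by blast
      then show ?thesis using False val[of m h]
        by (intro exI[of _ h] exI[of _ m]) (simp add: poly_cofactor_top)
    next
      case True
      moreover have "Wp x 0 = 1" by (simp add: Wp_def poly_wronskian_def)
      ultimately have "m \<noteq> 0" by (intro notI) simp
      then obtain k where k: "m = Suc k" by (cases m) auto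
      have "rsquarefree (Wp x m)" using gen k by (auto simp: generic_def)
      then have d: "poly (pderiv (Wp x m)) z \<noteq> 0" using True by (auto simp: rsquarefree_roots)
      obtain h where "degree h \<le> k" "\<forall>j. poly ((pderiv ^^ j) h) z = (if j = k then 1 else 0)"
        using taylor_basis by blast
      then show ?thesis using d val[of k h] poly_cofactor_pred[of k x] m k
        by (intro exI[of _ h] exI[of _ k]) auto
    qed
  qed
  then obtain h0 where h0: "degree h0 \<le> m" "poly (opW x m h0) z \<noteq> 0" by (metis order_trans)
  \<comment> \<open>The test polynomial becomes admissible by subtracting multiples of
    \<open>F x 1, ..., F x m\<close>, which the operator annihilates. Its degree is small enough by
    \<open>em\<close>.\<close>
  let ?Q = "e ` {1..m}"
  define H where "H q = F x (inv_into {1..m} e q)" for q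
  have inv: "inv_into {1..m} e q \<in> {1..m}" "e (inv_into {1..m} e q) = q" if "q \<in> ?Q" for q
    using that by (rule inv_into_into, rule f_inv_into_f)
  have H: "degree (H q) = q" "poly.coeff (H q) q = 1" "opW x m (H q) = 0" if "q \<in> ?Q" for q
    using inv[OF that] lead_coeff_F[of x "inv_into {1..m} e q"] opW_kills by (auto simp: H_def)
  obtain c where c: "\<forall>q\<in>?Q. poly.coeff (h0 - (\<Sum>r\<in>?Q. Polynomial.smult (c r) (H r))) q = 0"
    using echelon_reduction[of ?Q H h0] H by auto
  let ?S = "\<Sum>r\<in>?Q. Polynomial.smult (c r) (H r)"
  have "poly.coeff (h0 - ?S) k = 0" if k: "k \<ge> e (Suc m)" for k
  proof -
    have "q < k" if "q \<in> ?Q" for q using that k e_mono[of _ "Suc m"] m by fastforce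
    then have "poly.coeff ?S k = 0"
      unfolding coeff_sum by (intro sum.neutral) (auto simp: coeff_eq_0 H)
    moreover have "poly.coeff h0 k = 0" using h0(1) em k by (intro coeff_eq_0) auto
    ultimately show ?thesis by simp
  qed
  moreover have "q \<in> ?Q \<or> q \<ge> e (Suc m)" if "q \<in> P" for q
  proof -
    obtain i where i: "i \<in> {1..N}" "q = e i" using \<open>q \<in> P\<close> by (auto simp: P_eq_e)
    then show ?thesis using e_strict_mono[of "Suc m" i] m by (cases "i \<le> m") auto
  qed
  ultimately have "h0 - ?S \<in> admissible m" using c unfolding admissible_def by blast
  moreover have "opW x m (h0 - ?S) = opW x m h0"
    by (simp add: wopP_diff wopP_sum wopP_smult H)
  ultimately show ?thesis using h0(2) by metis
qed

text \<open>No point is a common zero of the images of admissible directions, so a combination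
  \<open>h + c h'\<close> with \<open>c\<close> off finitely many ratios takes care of one more
  point at a time.\<close>

lemma admissible_nonvanishing:
  assumes m: "m < N" and gen: "generic x m" and em: "e (Suc m) > m" and Z: "finite Z"
  shows "\<exists>h\<in>admissible m. \<forall>z\<in>Z. poly (opW x m h) z \<noteq> 0"
  using Z
proof induction
  case empty
  show ?case by (intro bexI[of _ 0]) (auto simp: admissible_def)
next
  case (insert z Z)
  then obtain h where h: "h \<in> admissible m" "\<forall>z\<in>Z. poly (opW x m h) z \<noteq> 0" by blast
  obtain h' where h': "h' \<in> admissible m" "poly (opW x m h') z \<noteq> 0"
    using admissible_base_point[OF m gen em] by blast
  let ?v = "\<lambda>t. poly (opW x m h) t" and ?v' = "\<lambda>t. poly (opW x m h') t"
  obtain c where c: "c \<notin> (\<lambda>t. - ?v' t / ?v t) ` Z \<union> {- ?v z / ?v' z} \<union> (\<lambda>t. - ?v t / ?v' t) ` Z"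
    using small_avoiding[of "(\<lambda>t. - ?v' t / ?v t) ` Z \<union> {- ?v z / ?v' z} \<union> (\<lambda>t. - ?v t / ?v' t) ` Z" 1] insert.hyps by auto
  have "?v t + c * ?v' t \<noteq> 0" if "t \<in> insert z Z" for t
  proof
    assume 0: "?v t + c * ?v' t = 0"
    then have "?v' t \<noteq> 0" using that h h' by auto
    then have "c = - ?v t / ?v' t" using 0 by (simp add: field_simps add_eq_0_iff)
    then show False using c that by auto
  qed
  then show ?case using h h'
    by (intro bexI[of _ "h + Polynomial.smult c h'"])
      (auto simp: wopP_add wopP_smult intro: admissible_add admissible_smult)
qed

text \<open>Moving in an admissible direction changes the next Wronskian by a polynomial of smaller
  degree; in \<open>generic_dense\<close> this gives the two a nonzero Wronskian with each
  other.\<close>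

lemma degree_opW_admissible:
  assumes m: "m < N" and h: "h \<in> admissible m" and l0: "l (N - Suc m) > 0"
  shows "degree (opW x m h) < l (N - Suc m)"
proof (cases "h = 0")
  case True
  then show ?thesis using wopP_smult[of m "F x" 0 0] l0 by simp
next
  case False
  have "degree h < e (Suc m)"
    using h False leading_coeff_0_iff[of h] not_le by (auto simp: admissible_def simp del: leading_coeff_0_iff)
  then have deg: "degree h < lam (N - m) + m" using m by (simp add: e_altdef)
  have nz: "poly_at_inf (Wp x m) \<noteq> 0" using Wp_nonzero[of m x] m by simp
  obtain c where L: "leads (diffop_apply (lop m (g x)) (poly_at_inf h)) (- int (degree h) + int m) c"
    using chain.leads_chain[of m x] leads_poly[of h] m by (metis less_imp_le)
  have "poly_at_inf (opW x m h) = poly_at_inf (Wp x m) * diffop_apply (lop m (g x)) (poly_at_inf h)"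
    using opW_lop[of m x h] m nz by simp
  then have L2: "leads (poly_at_inf (opW x m h)) (- int (l (N - m)) + (- int (degree h) + int m)) (C m * c)"
    using leads_mult[OF leads_Wp L] m by simp
  have ls: "l (N - Suc m) = l (N - m) + lam (N - m)" using l_step[OF m] .
  have "poly.coeff (opW x m h) k = 0" if "k \<ge> l (N - Suc m)" for k
  proof -
    have "fls_nth (poly_at_inf (opW x m h)) (- int k) = 0"
      using L2 that deg ls by (auto simp: leads_def)
    then show ?thesis by (simp add: poly_at_inf_nth)
  qed
  then have "degree (opW x m h) \<le> l (N - Suc m) - 1"
    using l0 by (intro degree_le) auto
  then show ?thesis using l0 by simp
qed

lemma wopP_cong: "(\<And>i. i \<in> {1..m} \<Longrightarrow> f i = f' i) \<Longrightarrow> wopP m f h = wopP m f' h"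
proof -
  assume *: "\<And>i. i \<in> {1..m} \<Longrightarrow> f i = f' i"
  have "wop m (\<lambda>i. poly_at_inf (f i)) = wop m (\<lambda>i. poly_at_inf (f' i))"
    by (rule wop_cong) (simp add: *)
  then have "poly_at_inf (wopP m f h) = poly_at_inf (wopP m f' h)"
    by (simp only: poly_at_inf_wopP)
  then show ?thesis by (simp only: poly_at_inf_eq_iff)
qed

text \<open>A Bertini argument on the pencil \<open>F + c G\<close>, where \<open>F\<close> is the
  next Wronskian and \<open>G\<close> the image of an admissible direction: multiple roots and roots
  shared with \<open>W_m\<close> occur for finitely many \<open>c\<close> only. The
  \<open>W_k\<close> with \<open>k \<le> m\<close> do not see the polynomial that is moved.\<close>

theorem generic_dense:
  "m \<le> N \<Longrightarrow> \<epsilon> > 0 \<Longrightarrow> \<exists>x'. generic x' m \<and> (\<forall>v. cmod (x' v - x v) < \<epsilon>)"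
proof (induction m arbitrary: \<epsilon>)
  case 0
  then show ?case by (intro exI[of _ x]) (auto simp: generic_def)
next
  case (Suc m)
  then have m: "m < N" by simp
  obtain x1 where gen: "generic x1 m" and x1: "\<And>v. cmod (x1 v - x v) < \<epsilon> / 2"
    using Suc.IH[of "\<epsilon> / 2"] Suc.prems by auto
  show ?case
  \<comment> \<open>If the group of coordinates is empty, the Wronskian is a nonzero constant and
    nothing has to move.\<close>
  proof (cases "l (N - Suc m) = 0")
    case True
    then have "degree (Wp x1 (Suc m)) = 0" using degree_lead_Wp(1)[OF Suc.prems(1)] by simp
    then obtain c where "Wp x1 (Suc m) = [:c:]" by (rule degree_eq_zeroE)
    then have "poly (Wp x1 (Suc m)) t \<noteq> 0" for t using Wp_nonzero[OF Suc.prems(1), of x1] by auto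
    then have "generic x1 (Suc m)" using gen unfolding generic_def
      by (auto simp: rsquarefree_roots le_Suc_eq)
    moreover have "cmod (x1 v - x v) < \<epsilon>" for v using x1[of v] Suc.prems(2) by linarith
    ultimately show ?thesis by blast
  next
    case False
    then have l0: "l (N - Suc m) > 0" by simp
    \<comment> \<open>The parts decrease, so a nonzero sum of the last \<open>Suc m\<close> parts
      has a positive first summand.\<close>
    have lam0: "lam (N - m) > 0"
    proof (rule ccontr)
      assume "\<not> lam (N - m) > 0"
      then have "lam b = 0" if "b \<in> {N - m..N}" for b
        using that lam_antimono[of "N - m" b] m by auto
      then have "l (N - Suc m) = 0" using m by (simp add: num_vars_def Suc_diff_Suc)
      then show False using l0 by simp
    qed
    have em: "e (Suc m) > m" using lam0 m by (simp add: e_altdef)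
    let ?W = "Wp x1 m" and ?F = "Wp x1 (Suc m)"
    have nz: "?W \<noteq> 0" "?F \<noteq> 0" using Wp_nonzero[of m] Wp_nonzero[of "Suc m"] m by auto
    have "finite ({t. poly ?F t = 0} \<union> {t. poly ?W t = 0})" using nz poly_roots_finite by auto
    then obtain h where h: "h \<in> admissible m"
      "\<forall>t\<in>{t. poly ?F t = 0} \<union> {t. poly ?W t = 0}. poly (opW x1 m h) t \<noteq> 0"
      using admissible_nonvanishing[OF m gen em] by blast
    let ?G = "opW x1 m h"
    have degF: "degree ?F = l (N - Suc m)" using degree_lead_Wp(1)[OF Suc.prems(1)] .
    then have "\<not> constant (poly ?F)" using l0 constant_degree[of ?F] by simp
    then obtain t0 where t0: "poly ?F t0 = 0" using fundamental_theorem_of_algebra by blast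
    then have "poly ?G t0 \<noteq> 0" using h(2) by blast
    then have "?G \<noteq> 0" by (intro notI) simp
    then have wr: "wr ?F ?G \<noteq> 0"
      using degree_wr(1)[OF nz(2)] degree_opW_admissible[OF m h(1) l0, of x1] degF by simp
    \<comment> \<open>As \<open>?G\<close> is nonzero at the roots of \<open>?F\<close>, a root
      \<open>t\<close> of a member of the pencil determines \<open>c\<close> as
      \<open>- ?F / ?G\<close> at \<open>t\<close>; it is multiple only if \<open>wr ?F ?G\<close>
      vanishes there too. \<open>Bad\<close> collects these values and those coming from roots of
      \<open>?W\<close>.\<close>
    define Bad where "Bad = (\<lambda>t. - poly ?F t / poly ?G t) ` ({t. poly (wr ?F ?G) t = 0} \<union> {t. poly ?W t = 0})"
    have "finite Bad" unfolding Bad_def using poly_roots_finite[OF wr] poly_roots_finite[OF nz(1)] by auto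
    \<comment> \<open>A bound for the coefficients of \<open>h\<close>; the \<open>+ 1\<close> below
      avoids division by 0 and keeps the move within half of \<open>\<epsilon>\<close>.\<close>
    define M where "M = (\<Sum>k\<le>degree h. cmod (poly.coeff h k))"
    have M: "cmod (poly.coeff h k) \<le> M" for k
    proof (cases "k \<le> degree h")
      case True
      then show ?thesis unfolding M_def by (intro member_le_sum) auto
    qed (auto simp: M_def coeff_eq_0 intro: sum_nonneg)
    have M0: "M \<ge> 0" unfolding M_def by (auto intro: sum_nonneg)
    obtain c where c: "c \<notin> Bad" "cmod c < \<epsilon> / (2 * (M + 1))"
      using small_avoiding[OF \<open>finite Bad\<close>, of "\<epsilon> / (2 * (M + 1))"] Suc.prems(2) M0 by auto
    define x2 where "x2 v = x1 v + c * (if fst v = N - m then poly.coeff h (d (N - m) - snd v) else 0)" for v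
    have dist: "cmod (x2 v - x v) < \<epsilon>" for v
    proof -
      have "cmod (x2 v - x1 v) \<le> cmod c * M"
        using M M0 by (auto simp: x2_def norm_mult intro!: mult_left_mono)
      also have "\<dots> \<le> \<epsilon> / (2 * (M + 1)) * M" using c(2) M0 by (intro mult_right_mono) auto
      also have "\<dots> \<le> \<epsilon> / 2" using M0 Suc.prems(2) by (simp add: field_simps)
      finally have "cmod (x2 v - x1 v) \<le> \<epsilon> / 2" .
      moreover have "cmod (x2 v - x v) \<le> cmod (x2 v - x1 v) + cmod (x1 v - x v)"
        using norm_triangle_ineq[of "x2 v - x1 v" "x1 v - x v"] by simp
      ultimately show ?thesis using x1[of v] by linarith
    qed
    have Feq: "F x2 i = F x1 i" if "i \<in> {1..m}" for i
      unfolding F_def by (rule fpoly_cong) (use that m in \<open>auto simp: x2_def\<close>)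
    have Ftop: "F x2 (Suc m) = F x1 (Suc m) + Polynomial.smult c h"
    proof (rule poly_eqI)
      fix k
      have "d (N - m) = e (Suc m)" by (simp add: e_def)
      then have "poly.coeff h k = 0" if "k \<ge> d (N - m) \<or> k \<in> P" using h(1) that by (auto simp: admissible_def)
      then show "poly.coeff (F x2 (Suc m)) k = poly.coeff (F x1 (Suc m) + Polynomial.smult c h) k"
        by (auto simp: F_def coeff_fpoly x2_def)
    qed
    have W2: "Wp x2 k = Wp x1 k" if "k \<le> m" for k
      by (rule Wp_cong) (use Feq that in auto)
    have "opW x2 m p = opW x1 m p" for p by (rule wopP_cong) (rule Feq)
    then have F2: "Wp x2 (Suc m) = ?F + Polynomial.smult c ?G"
      unfolding Wp_Suc Ftop by (simp add: wopP_add wopP_smult)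
    have good: "poly (pderiv (Wp x2 (Suc m))) t \<noteq> 0 \<and> poly ?W t \<noteq> 0" if t: "poly (Wp x2 (Suc m)) t = 0" for t
    proof -
      have t': "poly ?F t = - c * poly ?G t" using t unfolding F2 by (simp add: add_eq_0_iff)
      have G0: "poly ?G t \<noteq> 0" using h(2) t' by auto
      have ceq: "c = - poly ?F t / poly ?G t" using t' G0 by simp
      have "poly ?W t \<noteq> 0" using c(1) ceq by (auto simp: Bad_def)
      moreover have "poly (pderiv (Wp x2 (Suc m))) t \<noteq> 0"
      proof
        assume "poly (pderiv (Wp x2 (Suc m))) t = 0"
        then have "poly (pderiv ?F) t = - c * poly (pderiv ?G) t"
          unfolding F2 by (simp add: pderiv_add pderiv_smult add_eq_0_iff)
        then have "poly (wr ?F ?G) t = 0" using t' by (simp add: wr_def)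
        then show False using c(1) ceq by (auto simp: Bad_def)
      qed
      ultimately show ?thesis by simp
    qed
    have "generic x2 (Suc m)"
      unfolding generic_def
    proof
      fix k assume k: "k \<in> {1..Suc m}"
      show "rsquarefree (Wp x2 k) \<and> (\<forall>t. poly (Wp x2 k) t = 0 \<longrightarrow> poly (Wp x2 (k - 1)) t \<noteq> 0)"
      proof (cases "k = Suc m")
        case True
        then show ?thesis using good W2[of m] by (auto simp: rsquarefree_roots)
      next
        case False
        then have "k \<in> {1..m}" "k - 1 \<le> m" using k by auto
        then show ?thesis using gen W2[of k] W2[of "k - 1"] unfolding generic_def by auto
      qed
    qed
    then show ?thesis using dist by blast
  qed
qed

end

section \<open>The quotient critical set is the image of the cell\<close>

lemma mpoly_eval_tendsto:
  assumes q: "q \<in> mpolys I" and T: "\<And>v. v \<in> I \<Longrightarrow> (\<lambda>k. T k v) \<longlonglongrightarrow> L v"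
  shows "(\<lambda>k :: nat. mpoly_eval q (T k)) \<longlonglongrightarrow> mpoly_eval q L"
  unfolding mpoly_eval_def
  by (intro tendsto_sum tendsto_mult tendsto_const tendsto_prod tendsto_power T)
    (use q in \<open>auto simp: mpolys_def\<close>)

lemma mpoly_eval_cong:
  assumes "q \<in> mpolys I" "\<And>v. v \<in> I \<Longrightarrow> x v = y v" shows "mpoly_eval q x = mpoly_eval q y"
proof -
  have "x v = y v" if "m \<in> Poly_Mapping.keys q" "v \<in> Poly_Mapping.keys m" for m v
    using assms(1) that by (intro assms(2)) (auto simp: mpolys_def)
  then show ?thesis unfolding mpoly_eval_def by (intro sum.cong) (simp_all cong: prod.cong)
qed

lemma polyfuns_tendsto:
  assumes f: "f \<in> polyfuns UNIV (\<lambda>x. x) I w k" and T: "\<And>v. v \<in> I \<Longrightarrow> (\<lambda>k. T k v) \<longlonglongrightarrow> L v"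
  shows "(\<lambda>k :: nat. f (T k)) \<longlonglongrightarrow> f L"
proof -
  obtain q where q: "q \<in> mpolys I" "\<And>x. f x = mpoly_eval q x"
    using f by (auto simp: polyfuns_def mpolys_homogeneous_def)
  then show ?thesis using mpoly_eval_tendsto[OF q(1) T] by simp
qed

lemma graded_functions_ungrade:
  assumes "graded_functions S H" shows "graded_functions S (\<lambda>_. H 0)"
proof -
  interpret graded_functions S H by fact
  show ?thesis
    by unfold_locales (use const zero add mult[of _ 0 _ 0] cong in auto)
qed

lemma convergent_subsequence_finite:
  fixes T :: "nat \<Rightarrow> 'v \<Rightarrow> complex"
  assumes "finite I" "\<And>v. v \<in> I \<Longrightarrow> \<exists>M. \<forall>k. cmod (T k v) \<le> M"
  shows "\<exists>r L. strict_mono (r :: nat \<Rightarrow> nat) \<and> (\<forall>v\<in>I. (\<lambda>k. T (r k) v) \<longlonglongrightarrow> L v)"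
  using assms
proof induction
  case empty
  show ?case by (intro exI[of _ id]) (auto simp: strict_mono_def)
next
  case (insert v I)
  then obtain r L where r: "strict_mono (r :: nat \<Rightarrow> nat)" "\<And>u. u \<in> I \<Longrightarrow> (\<lambda>k. T (r k) u) \<longlonglongrightarrow> L u" by blast
  obtain M where M: "\<forall>k. cmod (T k v) \<le> M" using insert.prems by blast
  then have "\<forall>k. cmod (T (r k) v) \<le> M" by blast
  then obtain f z where f: "strict_mono (f :: nat \<Rightarrow> nat)" "\<And>e. e > 0 \<Longrightarrow> \<exists>N. \<forall>n\<ge>N. cmod (T (r (f n)) v - z) < e"
    using Bolzano_Weierstrass_complex_disc[of "\<lambda>k. T (r k) v" M] by blast
  have "(\<lambda>k. T (r (f k)) v) \<longlonglongrightarrow> z"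
    using f(2) by (intro LIMSEQ_I) blast
  moreover have "(\<lambda>k. T (r (f k)) u) \<longlonglongrightarrow> L u" if "u \<in> I" for u
    using LIMSEQ_subseq_LIMSEQ[OF r(2)[OF that] f(1)] by (simp add: comp_def)
  moreover have "strict_mono (\<lambda>k. r (f k))"
    using strict_mono_o[OF r(1) f(1)] by (simp add: comp_def)
  ultimately show ?case using insert.hyps
    by (intro exI[of _ "\<lambda>k. r (f k)"] exI[of _ "L(v := z)"]) auto
qed

section \<open>Lifting quotient points to roots and passing to limits\<close>

context partition_data begin

text \<open>Cauchy's bound: for \<open>cmod z > 1\<close> each lower term is at most
  \<open>M\<close> times the power of \<open>cmod z\<close> with exponent
  \<open>l a - 1\<close>.\<close>

lemma cpoly_root_bound:
  assumes root: "poly (cpoly s a) z = 0" and a: "a < N" and M: "\<And>v. v \<in> IC \<Longrightarrow> cmod (s v) \<le> M" "M \<ge> 0"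
  shows "cmod z \<le> 1 + real (l a) * M"
proof (cases "cmod z \<le> 1")
  case True
  then show ?thesis using M(2) by (simp add: add_increasing2)
next
  case False
  then have z1: "cmod z \<ge> 1" "cmod z > 0" by auto
  have "l a \<noteq> 0"
  proof
    assume "l a = 0"
    then have "cpoly s a = 1" by (intro poly_eqI) (auto simp: coeff_cpoly)
    then show False using root by simp
  qed
  then obtain n where n: "l a = Suc n" by (cases "l a") auto
  have "0 = (\<Sum>k\<le>l a. poly.coeff (cpoly s a) k * z ^ k)"
    using root by (simp add: poly_altdef)
  also have "\<dots> = (\<Sum>k<l a. poly.coeff (cpoly s a) k * z ^ k) + z ^ l a"
    by (simp add: lessThan_Suc_atMost[symmetric] coeff_cpoly)
  finally have "z ^ l a = - (\<Sum>k<l a. poly.coeff (cpoly s a) k * z ^ k)"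
    by (simp add: eq_neg_iff_add_eq_0 add.commute)
  then have "cmod z ^ l a = cmod (\<Sum>k<l a. poly.coeff (cpoly s a) k * z ^ k)"
    by (metis norm_minus_cancel norm_power)
  also have "\<dots> \<le> (\<Sum>k<l a. M * cmod z ^ n)"
  proof (rule sum_norm_le)
    fix k assume k: "k \<in> {..<l a}"
    then have "(a, l a - k) \<in> IC" using a by (auto simp: crit_index_def)
    then have "cmod (poly.coeff (cpoly s a) k) \<le> M" using M k by (simp add: coeff_cpoly norm_mult norm_power)
    moreover have "cmod z ^ k \<le> cmod z ^ n" using z1 k n by (intro power_increasing) auto
    ultimately show "cmod (poly.coeff (cpoly s a) k * z ^ k) \<le> M * cmod z ^ n"
      unfolding norm_mult norm_power using M(2) by (intro mult_mono) auto
  qed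
  also have "\<dots> = (real (l a) * M) * cmod z ^ n" by simp
  finally have "cmod z * cmod z ^ n \<le> (real (l a) * M) * cmod z ^ n" by (simp add: n)
  then have "cmod z \<le> real (l a) * M" using z1 by (simp add: mult_le_cancel_right)
  then show ?thesis by simp
qed

lemma quotient_map_surj:
  assumes s: "s \<in> affine_points IC"
  shows "\<exists>T\<in>affine_points IC. quotient_map N lam T = s"
proof -
  have "\<exists>root. (\<Prod>i<l a. [:- root i, 1:]) = cpoly s a" for a
  proof -
    obtain root where "Polynomial.smult (lead_coeff (cpoly s a)) (\<Prod>i<degree (cpoly s a). [:- root i, 1:]) = cpoly s a"
      using complex_poly_decompose' by metis
    then show ?thesis by (intro exI[of _ root]) (simp add: coeff_cpoly)
  qed
  then obtain root where root: "\<And>a. (\<Prod>i<l a. [:- root a i, 1:]) = cpoly s a" by metis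
  define T where "T = (\<lambda>v\<in>IC. root (fst v) (snd v - 1))"
  have "quotient_map N lam T = s"
  proof (rule cpoly_inject[OF _ s])
    fix a assume a: "a < N"
    have "cpoly (quotient_map N lam T) a = (\<Prod>i=1..l a. [:- T (a, i), 1:])" using a by (rule cpoly_quotient_map)
    also have "\<dots> = (\<Prod>i<l a. [:- root a i, 1:])"
    proof (rule prod.reindex_bij_witness[of _ Suc "\<lambda>i. i - 1"])
      fix i assume i: "i \<in> {1..l a}"
      then have "(a, i) \<in> IC" using a by (auto simp: crit_index_def)
      then show "[:- root a (i - 1), 1:] = [:- T (a, i), 1:]" by (simp add: T_def)
    qed auto
    finally show "cpoly (quotient_map N lam T) a = cpoly s a" using root by simp
  qed simp
  moreover have "T \<in> affine_points IC" by (simp add: T_def affine_points_def)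
  ultimately show ?thesis by blast
qed

lemma critical_points_iff:
  "T \<in> critical_points N lam \<longleftrightarrow>
     T \<in> affine_points IC \<and> bethe (quotient_map N lam T) \<and> rsquarefree (cpoly (quotient_map N lam T) 0)"
  using N_pos unfolding critical_points_def critical_point_iff_bethe
  by (simp add: cpoly_quotient_map rsquarefree_linear_product del: One_nat_def)

lemma generic_critical:
  assumes "generic x N" "T \<in> affine_points IC" "quotient_map N lam T = psi x"
  shows "T \<in> critical_points N lam"
  using assms generic_bethe[OF assms(1)] by (simp add: critical_points_iff)

lemma critical_points_subset_closure: "critical_points N lam \<subseteq> critical_closure N lam"
  unfolding critical_closure_def zariski_closure_def by (auto simp: critical_points_iff)

lemma closure_vanish:
  assumes f: "f \<in> polyfuns UNIV (\<lambda>x. x) IC (\<lambda>_. 0) 0"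
    and 0: "\<And>T. T \<in> critical_points N lam \<Longrightarrow> f T = 0" and T: "T \<in> critical_closure N lam"
  shows "f T = 0"
proof -
  obtain q where "q \<in> mpolys IC" "\<And>x. f x = mpoly_eval q x"
    using f by (auto simp: polyfuns_def mpolys_homogeneous_trivial)
  then show ?thesis using 0 T unfolding critical_closure_def zariski_closure_def by auto
qed

lemma quotient_map_polyfun:
  "(\<lambda>T. quotient_map N lam T v) \<in> polyfuns UNIV (\<lambda>x. x) IC (\<lambda>_. 0) 0" if v: "v \<in> IC"
proof -
  interpret graded_functions UNIV "polyfuns UNIV (\<lambda>x. x) IC (\<lambda>_. 0)"
    by (rule graded_functions_polyfuns)
  obtain a i where ai: "v = (a, i)" by (cases v)
  have a: "a < N" using v by (auto simp: ai crit_index_def)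
  have "(\<lambda>T. \<Sum>Y | Y \<subseteq> {1..l a} \<and> card Y = i. \<Prod>k\<in>Y. T (a, k)) \<in> polyfuns UNIV (\<lambda>x. x) IC (\<lambda>_. 0) 0"
  proof (rule sum)
    fix Y assume "Y \<in> {Y. Y \<subseteq> {1..l a} \<and> card Y = i}"
    then have "(a, k) \<in> IC" if "k \<in> Y" for k using that a by (auto simp: crit_index_def)
    then have "(\<lambda>T. \<Prod>k\<in>Y. T (a, k)) \<in> polyfuns UNIV (\<lambda>x. x) IC (\<lambda>_. 0) (\<Sum>k\<in>Y. 0)"
      by (intro prod polyfuns_coord[of _ IC _ _ "\<lambda>_. 0"]) auto
    then show "(\<lambda>T. \<Prod>k\<in>Y. T (a, k)) \<in> polyfuns UNIV (\<lambda>x. x) IC (\<lambda>_. 0) 0" by simp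
  qed
  then show ?thesis using v by (simp add: quotient_map_def ai)
qed

lemma psi_polyfun: "v \<in> IC \<Longrightarrow> (\<lambda>x. psi x v) \<in> polyfuns UNIV (\<lambda>x. x) IW snd (snd v)"
  by (rule psi_graded[OF graded_functions_polyfuns]) (auto intro: polyfuns_coord)

lemma psi_cong: "(\<And>v. v \<in> IW \<Longrightarrow> x v = y v) \<Longrightarrow> psi x = psi y"
proof -
  assume *: "\<And>v. v \<in> IW \<Longrightarrow> x v = y v"
  have "F x m = F y m" if "m \<in> {1..N}" for m
    unfolding F_def by (rule fpoly_cong) (use * that in auto)
  then have "Wp x m = Wp y m" if "m \<le> N" for m by (rule Wp_cong) (use that in auto)
  then show ?thesis unfolding psi_def by (intro restrict_ext) auto
qed

text \<open>\<open>coords_graded\<close> is applied on the set of all pairs linked by the kernel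
  condition, with functions polynomial in the first component. A single polynomial per coordinate
  therefore works for all pairs.\<close>

lemma inverse_coordinates:
  "\<exists>Q. \<forall>v\<in>IW. Q v \<in> mpolys_homogeneous IC snd (snd v) \<and>
     (\<forall>s x. (\<forall>i\<in>{1..N}. diffop_apply (PD s N) (poly_at_inf (fpoly x i)) = 0) \<longrightarrow> x v = mpoly_eval (Q v) s)"
proof -
  let ?R = "{(s, x). \<forall>i\<in>{1..N}. diffop_apply (PD s N) (poly_at_inf (fpoly x i)) = 0}"
  let ?H = "polyfuns ?R fst IC snd"
  have gf: "graded_functions ?R ?H" by (rule graded_functions_polyfuns)
  have "\<exists>q. q \<in> mpolys_homogeneous IC snd (snd v) \<and> (\<forall>p\<in>?R. snd p v = mpoly_eval q (fst p))" if v: "v \<in> IW" for v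
  proof -
    have "(\<lambda>p. snd p v) \<in> ?H (snd v)"
    proof (rule coords_graded[OF gf _ _ v])
      show "(\<lambda>p. B (fst p) i (i + k)) \<in> ?H k" if "i \<in> {1..N}" for i k
        by (rule B_graded[OF gf]) (use that in \<open>auto intro: polyfuns_coord\<close>)
    qed auto
    then show ?thesis by (auto simp: polyfuns_def)
  qed
  then have "\<exists>Q. \<forall>v\<in>IW. Q v \<in> mpolys_homogeneous IC snd (snd v) \<and> (\<forall>p\<in>?R. snd p v = mpoly_eval (Q v) (fst p))"
    by (intro bchoice ballI)
  then obtain Q where Q: "\<forall>v\<in>IW. Q v \<in> mpolys_homogeneous IC snd (snd v) \<and> (\<forall>p\<in>?R. snd p v = mpoly_eval (Q v) (fst p))"
    by (rule exE)
  have "x v = mpoly_eval (Q v) s" if "v \<in> IW" "\<forall>i\<in>{1..N}. diffop_apply (PD s N) (poly_at_inf (fpoly x i)) = 0" for v s x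
  proof -
    have "(s, x) \<in> ?R" using that(2) by simp
    then have "snd (s, x) v = mpoly_eval (Q v) (fst (s, x))" using Q that(1) by blast
    then show ?thesis by simp
  qed
  then show ?thesis using Q by (intro exI[of _ Q]) blast
qed

text \<open>The polynomials expressing the \<open>f\<^sub>i\<^sub>j\<close> through the \<open>\<sigma>\<^sup>(\<^sup>a\<^sup>)\<^sub>i\<close> on the quotient critical set.\<close>

definition Qinv :: "nat \<times> nat \<Rightarrow> (nat \<times> nat) mpolynomial" where
  "Qinv = (SOME Q. \<forall>v\<in>IW. Q v \<in> mpolys_homogeneous IC snd (snd v) \<and>
     (\<forall>s x. (\<forall>i\<in>{1..N}. diffop_apply (PD s N) (poly_at_inf (fpoly x i)) = 0) \<longrightarrow> x v = mpoly_eval (Q v) s))"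

definition xi :: "(nat \<times> nat \<Rightarrow> complex) \<Rightarrow> nat \<times> nat \<Rightarrow> complex" where
  "xi s v = mpoly_eval (Qinv v) s"

lemma Qinv: "v \<in> IW \<Longrightarrow> Qinv v \<in> mpolys_homogeneous IC snd (snd v)"
  and xi_eq: "v \<in> IW \<Longrightarrow> \<forall>i\<in>{1..N}. diffop_apply (PD s N) (poly_at_inf (fpoly x i)) = 0 \<Longrightarrow> xi s v = x v"
proof -
  have Q: "\<forall>v\<in>IW. Qinv v \<in> mpolys_homogeneous IC snd (snd v) \<and>
     (\<forall>s x. (\<forall>i\<in>{1..N}. diffop_apply (PD s N) (poly_at_inf (fpoly x i)) = 0) \<longrightarrow> x v = mpoly_eval (Qinv v) s)"
    unfolding Qinv_def by (rule someI_ex[OF inverse_coordinates])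
  show "v \<in> IW \<Longrightarrow> Qinv v \<in> mpolys_homogeneous IC snd (snd v)" using Q by blast
  show "v \<in> IW \<Longrightarrow> \<forall>i\<in>{1..N}. diffop_apply (PD s N) (poly_at_inf (fpoly x i)) = 0 \<Longrightarrow> xi s v = x v"
    using Q unfolding xi_def by simp
qed

lemma xi_psi: "v \<in> IW \<Longrightarrow> xi (psi x) v = x v"
  by (rule xi_eq) (use g_kill_iff[of "PD (psi x) N" x] PD_psi_kills[of _ x] in auto)

lemma xi_graded:
  assumes "graded_functions S H" "\<And>v. v \<in> IC \<Longrightarrow> (\<lambda>p. s p v) \<in> H (snd v)" "v \<in> IW"
  shows "(\<lambda>p. xi (s p) v) \<in> H (snd v)"
proof -
  interpret graded_functions S H by fact
  show ?thesis unfolding xi_def by (rule mpoly_compose[OF Qinv]) (use assms in auto)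
qed

text \<open>For one inclusion, \<open>psi (xi s) = s\<close> with \<open>s\<close> the image of
  \<open>T\<close> is polynomial in \<open>T\<close>, and it passes from the critical points to
  their closure. The other takes a limit in the space of \<open>T\<close>, since the closure is
  formed there.\<close>

lemma quotient_critical_set_eq: "quotient_critical_set N lam = range psi"
proof
  show "quotient_critical_set N lam \<subseteq> range psi"
  proof
    fix s assume "s \<in> quotient_critical_set N lam"
    then obtain T where T: "T \<in> critical_closure N lam" "s = quotient_map N lam T"
      by (auto simp: quotient_critical_set_def)
    let ?H = "\<lambda>_. polyfuns UNIV (\<lambda>x. x) IC (\<lambda>_. 0) 0"
    have gf: "graded_functions UNIV ?H" by (rule graded_functions_ungrade[OF graded_functions_polyfuns])
    interpret graded_functions UNIV ?H by (rule gf)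
    have "psi (xi s) = s"
    proof (rule PiE_ext[of _ IC "\<lambda>_. UNIV"])
      show "psi (xi s) \<in> (\<Pi>\<^sub>E _\<in>IC. UNIV)" "s \<in> (\<Pi>\<^sub>E _\<in>IC. UNIV)"
        using psi_affine quotient_map_affine by (auto simp: affine_points_def T(2))
      fix v assume v: "v \<in> IC"
      have "(\<lambda>T. psi (xi (quotient_map N lam T)) v - quotient_map N lam T v) \<in> ?H 0"
        by (intro diff psi_graded[OF gf] xi_graded[OF gf] quotient_map_polyfun v)
      moreover have "psi (xi (quotient_map N lam T)) v - quotient_map N lam T v = 0"
        if "T \<in> critical_points N lam" for T
      proof -
        have "bethe (quotient_map N lam T)" using that by (simp add: critical_points_iff)
        then obtain x where x: "psi x = quotient_map N lam T" using bethe_solution by (metis quotient_map_affine)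
        have "psi (xi (psi x)) = psi x" by (rule psi_cong) (rule xi_psi)
        then show ?thesis using x by simp
      qed
      ultimately have "psi (xi (quotient_map N lam T)) v - quotient_map N lam T v = 0"
        using closure_vanish T(1) by blast
      then show "psi (xi s) v = s v" by (simp add: T(2))
    qed
    then show "s \<in> range psi" by (metis rangeI)
  qed
  show "range psi \<subseteq> quotient_critical_set N lam"
  proof
    fix s assume "s \<in> range psi"
    then obtain x where x: "s = psi x" by auto
    have "\<exists>x'. generic x' N \<and> (\<forall>v. cmod (x' v - x v) < 1 / Suc k)" for k
      by (rule generic_dense) auto
    then obtain y where y: "\<And>k. generic (y k) N" "\<And>k v. cmod (y k v - x v) < 1 / Suc k" by metis
    have ylim: "(\<lambda>k. y k v) \<longlonglongrightarrow> x v" for v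
    proof (rule LIMSEQ_I)
      fix r :: real assume "r > 0"
      then obtain n where n: "1 / Suc n < r" using nat_approx_posE by auto
      have "norm (y k v - x v) < r" if "k \<ge> n" for k
      proof -
        have "1 / real (Suc k) \<le> 1 / real (Suc n)" using that by (intro divide_left_mono) auto
        then show ?thesis using y(2)[of k v] n by linarith
      qed
      then show "\<exists>no. \<forall>n\<ge>no. norm (y n v - x v) < r" by blast
    qed
    have plim: "(\<lambda>k. psi (y k) v) \<longlonglongrightarrow> psi x v" if "v \<in> IC" for v
      by (rule polyfuns_tendsto[OF psi_polyfun[OF that]]) (rule ylim)
    have "\<exists>T\<in>affine_points IC. quotient_map N lam T = psi (y k)" for k by (rule quotient_map_surj) simp
    then obtain T where T: "\<And>k. T k \<in> affine_points IC" "\<And>k. quotient_map N lam (T k) = psi (y k)" by metis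
    have crit: "T k \<in> critical_points N lam" for k using generic_critical[OF y(1) T] .
    have "\<exists>M. \<forall>k. cmod (psi (y k) v) \<le> M" if "v \<in> IC" for v
      using convergent_imp_Bseq[OF convergentI[OF plim[OF that]]] by (auto simp: Bseq_def)
    then obtain Mv where Mv: "\<And>k v. v \<in> IC \<Longrightarrow> cmod (psi (y k) v) \<le> Mv v" by metis
    define M where "M = (\<Sum>v\<in>IC. \<bar>Mv v\<bar>)"
    have M: "cmod (psi (y k) v) \<le> M" if "v \<in> IC" for k v
    proof -
      have "\<bar>Mv v\<bar> \<le> M" unfolding M_def using that by (intro member_le_sum) auto
      then show ?thesis using Mv[OF that, of k] by linarith
    qed
    have M0: "M \<ge> 0" unfolding M_def by (auto intro: sum_nonneg)
    \<comment> \<open>The roots are numbered arbitrarily for each \<open>k\<close>, so their bounds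
      can only give a convergent subsequence; its limit still has the right quotient.\<close>
    have bounded: "\<exists>B. \<forall>k. cmod (T k v) \<le> B" if v: "v \<in> IC" for v
    proof -
      obtain a i where ai: "v = (a, i)" "a < N" "i \<in> {1..l a}" using v by (auto simp: crit_index_def)
      have "cmod (T k v) \<le> 1 + real (l a) * M" for k
      proof (rule cpoly_root_bound[OF _ ai(2) M M0])
        show "poly (cpoly (psi (y k)) a) (T k v) = 0"
          unfolding T(2)[symmetric] cpoly_quotient_map[OF ai(2)] using ai by (auto simp: poly_prod)
      qed
      then show ?thesis by blast
    qed
    have "\<exists>r L. strict_mono (r :: nat \<Rightarrow> nat) \<and> (\<forall>v\<in>IC. (\<lambda>k. T (r k) v) \<longlonglongrightarrow> L v)"
      by (rule convergent_subsequence_finite[OF finite_IC bounded])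
    then obtain r L where r: "strict_mono (r :: nat \<Rightarrow> nat)" "\<And>v. v \<in> IC \<Longrightarrow> (\<lambda>k. T (r k) v) \<longlonglongrightarrow> L v"
      by blast
    define T' where "T' = restrict L IC"
    have T'lim: "(\<lambda>k. T (r k) v) \<longlonglongrightarrow> T' v" if "v \<in> IC" for v using r(2)[OF that] that by (simp add: T'_def)
    have "T' \<in> critical_closure N lam"
      unfolding critical_closure_def zariski_closure_def
    proof (intro CollectI conjI ballI impI)
      show "T' \<in> affine_points IC" by (simp add: T'_def affine_points_def)
      fix q assume q: "q \<in> mpolys IC" "\<forall>s\<in>critical_points N lam. mpoly_eval q s = 0"
      have "(\<lambda>k. mpoly_eval q (T (r k))) \<longlonglongrightarrow> mpoly_eval q T'" by (rule mpoly_eval_tendsto[OF q(1) T'lim])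
      moreover have "mpoly_eval q (T (r k)) = 0" for k using q(2) crit by blast
      ultimately show "mpoly_eval q T' = 0" by (simp add: LIMSEQ_const_iff)
    qed
    moreover have "quotient_map N lam T' = psi x"
    proof (rule PiE_ext[of _ IC "\<lambda>_. UNIV"])
      show "quotient_map N lam T' \<in> (\<Pi>\<^sub>E _\<in>IC. UNIV)" "psi x \<in> (\<Pi>\<^sub>E _\<in>IC. UNIV)"
        using psi_affine quotient_map_affine by (auto simp: affine_points_def)
      fix v assume v: "v \<in> IC"
      have "(\<lambda>k. quotient_map N lam (T (r k)) v) \<longlonglongrightarrow> quotient_map N lam T' v"
        by (rule polyfuns_tendsto[OF quotient_map_polyfun[OF v] T'lim])
      moreover have "(\<lambda>k. quotient_map N lam (T (r k)) v) \<longlonglongrightarrow> psi x v"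
        using LIMSEQ_subseq_LIMSEQ[OF plim[OF v] r(1)] by (simp add: T(2) comp_def)
      ultimately show "quotient_map N lam T' v = psi x v" by (rule LIMSEQ_unique)
    qed
    ultimately show "s \<in> quotient_critical_set N lam"
      unfolding quotient_critical_set_def x by (metis imageI)
  qed
qed

end

section \<open>The isomorphism\<close>

lemma ring_function_algebra:
  assumes A: "A \<subseteq> extensional S"
    and const: "\<And>c. (\<lambda>p\<in>S. c) \<in> A"
    and add: "\<And>f g. f \<in> A \<Longrightarrow> g \<in> A \<Longrightarrow> (\<lambda>p\<in>S. f p + g p) \<in> A"
    and mult: "\<And>f g. f \<in> A \<Longrightarrow> g \<in> A \<Longrightarrow> (\<lambda>p\<in>S. f p * g p) \<in> A"
  shows "ring (function_algebra S A)"
proof -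
  have ext: "f \<in> extensional S" if "f \<in> A" for f using A that by blast
  have eqI: "restrict h S = f" if "f \<in> A" "\<And>p. p \<in> S \<Longrightarrow> h p = f p" for f h
    by (rule extensionalityI[OF restrict_extensional ext[OF that(1)]]) (simp add: that(2))
  have neg: "(\<lambda>p\<in>S. - f p) \<in> A" if "f \<in> A" for f
    using mult[OF const[of "-1"] that] by (auto cong: restrict_cong)
  show ?thesis
  proof (rule ringI)
    show "abelian_group (function_algebra S A)"
    proof (rule abelian_groupI)
      fix f assume "f \<in> carrier (function_algebra S A)"
      then have f: "f \<in> A" by (simp add: function_algebra_def)
      show "\<exists>y\<in>carrier (function_algebra S A). y \<oplus>\<^bsub>function_algebra S A\<^esub> f = \<zero>\<^bsub>function_algebra S A\<^esub>"
        using neg[OF f] by (intro bexI[of _ "\<lambda>p\<in>S. - f p"]) (auto simp: function_algebra_def cong: restrict_cong)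
    qed (auto simp: function_algebra_def add const eqI algebra_simps cong: restrict_cong)
    show "monoid (function_algebra S A)"
      by (rule monoidI) (auto simp: function_algebra_def mult const eqI algebra_simps cong: restrict_cong)
  qed (auto simp: function_algebra_def algebra_simps cong: restrict_cong)
qed

lemma poly_functions_mpolys: "poly_functions S c (mpolys I) = (\<lambda>f. restrict f S) ` polyfuns S c I (\<lambda>_. 0) 0"
proof
  show "poly_functions S c (mpolys I) \<subseteq> (\<lambda>f. restrict f S) ` polyfuns S c I (\<lambda>_. 0) 0"
    by (auto simp: poly_functions_def polyfuns_def mpolys_homogeneous_trivial)
  show "(\<lambda>f. restrict f S) ` polyfuns S c I (\<lambda>_. 0) 0 \<subseteq> poly_functions S c (mpolys I)"
    using poly_functions_restrict[of _ S c I "\<lambda>_. 0" 0] by (auto simp: mpolys_homogeneous_trivial)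
qed

lemma ring_poly_functions: "ring (function_algebra S (poly_functions S c (mpolys I)))"
proof -
  interpret graded_functions S "polyfuns S c I (\<lambda>_. 0)" by (rule graded_functions_polyfuns)
  show ?thesis
  proof (rule ring_function_algebra)
    fix f g assume "f \<in> poly_functions S c (mpolys I)" "g \<in> poly_functions S c (mpolys I)"
    then obtain f' g' where fg: "f = restrict f' S" "g = restrict g' S"
      "f' \<in> polyfuns S c I (\<lambda>_. 0) 0" "g' \<in> polyfuns S c I (\<lambda>_. 0) 0"
      unfolding poly_functions_mpolys by blast
    show "(\<lambda>p\<in>S. f p + g p) \<in> poly_functions S c (mpolys I)"
      unfolding poly_functions_mpolys
      by (rule image_eqI[OF _ add[OF fg(3,4)]]) (auto simp: fg(1,2) cong: restrict_cong)
    show "(\<lambda>p\<in>S. f p * g p) \<in> poly_functions S c (mpolys I)"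
      unfolding poly_functions_mpolys
      by (rule image_eqI[OF _ mult[OF fg(3,4), simplified]]) (auto simp: fg(1,2) cong: restrict_cong)
  next
    show "(\<lambda>p\<in>S. a) \<in> poly_functions S c (mpolys I)" for a
      unfolding poly_functions_mpolys by (rule image_eqI[OF _ const[of a]]) simp
  qed (auto simp: poly_functions_def)
qed

section \<open>The pull-back along \<open>iota\<close>\<close>

locale big_cell = partition_data +
  fixes dd :: nat
  assumes dd: "lam 1 + N \<le> dd"
begin

abbreviation QC :: "(nat \<times> nat \<Rightarrow> complex) set" where "QC \<equiv> quotient_critical_set N lam"
abbreviation X :: "complex poly set set" where "X \<equiv> cell dd N lam"
abbreviation co :: "complex poly set \<Rightarrow> nat \<times> nat \<Rightarrow> complex" where "co \<equiv> cell_coord N lam"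
abbreviation io :: "(nat \<times> nat \<Rightarrow> complex) \<Rightarrow> complex poly set" where "io \<equiv> iota dd N lam"

lemma psi_xi: "s \<in> QC \<Longrightarrow> psi (xi s) = s"
proof -
  assume "s \<in> QC"
  then obtain x where "s = psi x" unfolding quotient_critical_set_eq by auto
  then show ?thesis using psi_cong[of "xi (psi x)" x] xi_psi by simp
qed

lemma Qinv_mpolys: "v \<in> IW \<Longrightarrow> Qinv v \<in> mpolys IC"
  using Qinv by (auto simp: mpolys_homogeneous_def)

lemma carrier_O_C: "carrier (O_C N lam) = poly_functions QC (\<lambda>s. s) (mpolys IC)"
  by (simp add: O_C_def function_algebra_def)

lemma carrier_O_W: "carrier (O_W dd N lam) = poly_functions X co (mpolys IW)"
  by (simp add: O_W_def function_algebra_def)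

text \<open>Uniqueness: the coordinates of two candidates are polynomials that agree at images of
  critical points. Composed with the quotient map, this is a polynomial identity that extends to the
  closure.\<close>

lemma iota_eq: "iota dd N lam = (\<lambda>s\<in>QC. cellspace (xi s))"
  unfolding iota_def
proof (rule the_equality)
  let ?\<phi> = "\<lambda>s\<in>QC. cellspace (xi s)"
  have coord: "co (?\<phi> s) v = xi s v" if "s \<in> QC" "v \<in> IW" for s v
    using that by (simp add: cell_coord_cellspace)
  show "?\<phi> \<in> QC \<rightarrow>\<^sub>E X \<and>
        (\<forall>v\<in>IW. (\<lambda>s\<in>QC. co (?\<phi> s) v) \<in> carrier (O_C N lam)) \<and>
        (\<forall>T\<in>critical_points N lam. ?\<phi> (quotient_map N lam T) = X_T N lam T)"
  proof (intro conjI ballI)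
    show "?\<phi> \<in> QC \<rightarrow>\<^sub>E X" using cellspace_cell[OF dd] by auto
    fix v assume v: "v \<in> IW"
    show "(\<lambda>s\<in>QC. co (?\<phi> s) v) \<in> carrier (O_C N lam)"
      unfolding carrier_O_C poly_functions_def
      using coord[OF _ v] by (intro image_eqI[OF _ Qinv_mpolys[OF v]] restrict_ext) (simp add: xi_def)
  next
    fix T assume T: "T \<in> critical_points N lam"
    let ?s = "quotient_map N lam T"
    have "bethe ?s" using T by (simp add: critical_points_iff)
    then obtain x where x: "\<forall>i\<in>{1..N}. diffop_apply (PD ?s N) (poly_at_inf (fpoly x i)) = 0" "psi x = ?s"
      using bethe_solution[of ?s] quotient_map_affine by blast
    have "X_T N lam T = cellspace x"
      unfolding X_T_def D_T_eq by (rule kernel_eq_cellspace) (use x in blast)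
    also have "\<dots> = cellspace (xi ?s)"
      by (rule cellspace_cong) (rule xi_eq[OF _ x(1), symmetric])
    also have "?s \<in> QC"
      using critical_points_subset_closure T by (auto simp: quotient_critical_set_def)
    then have "cellspace (xi ?s) = ?\<phi> ?s" by simp
    finally show "?\<phi> ?s = X_T N lam T" ..
  qed
  note \<phi> = this
  fix \<theta> assume \<theta>: "\<theta> \<in> QC \<rightarrow>\<^sub>E X \<and>
        (\<forall>v\<in>IW. (\<lambda>s\<in>QC. co (\<theta> s) v) \<in> carrier (O_C N lam)) \<and>
        (\<forall>T\<in>critical_points N lam. \<theta> (quotient_map N lam T) = X_T N lam T)"
  show "\<theta> = ?\<phi>"
  proof (rule PiE_ext[of _ QC "\<lambda>_. X"])
    fix s assume s: "s \<in> QC"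
    then obtain T where T: "T \<in> critical_closure N lam" "s = quotient_map N lam T"
      by (auto simp: quotient_critical_set_def)
    interpret graded_functions UNIV "polyfuns UNIV (\<lambda>T. T) IC (\<lambda>_. 0)" by (rule graded_functions_polyfuns)
    have "co (\<theta> s) v = co (?\<phi> s) v" if v: "v \<in> IW" for v
    proof -
      have "(\<lambda>s\<in>QC. co (\<theta> s) v) \<in> poly_functions QC (\<lambda>s. s) (mpolys IC)"
        using \<theta> v by (simp add: carrier_O_C)
      then obtain q where q: "q \<in> mpolys IC" "(\<lambda>s\<in>QC. co (\<theta> s) v) = (\<lambda>s\<in>QC. mpoly_eval q s)"
        by (auto simp: poly_functions_def)
      have qe: "co (\<theta> s) v = mpoly_eval q s" if "s \<in> QC" for s
        using fun_cong[OF q(2), of s] that by simp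
      let ?f = "\<lambda>T. mpoly_eval q (quotient_map N lam T) - mpoly_eval (Qinv v) (quotient_map N lam T)"
      have "?f \<in> polyfuns UNIV (\<lambda>T. T) IC (\<lambda>_. 0) 0"
        using q(1) Qinv_mpolys[OF v]
        by (intro diff mpoly_compose[of _ IC "\<lambda>_. 0"] quotient_map_polyfun) (simp_all add: mpolys_homogeneous_trivial)
      moreover have "?f T = 0" if T: "T \<in> critical_points N lam" for T
      proof -
        have s: "quotient_map N lam T \<in> QC"
          using critical_points_subset_closure T by (auto simp: quotient_critical_set_def)
        have "\<theta> (quotient_map N lam T) = ?\<phi> (quotient_map N lam T)" using \<theta> \<phi> T by metis
        then show ?thesis using qe[OF s] coord[OF s v] by (simp add: xi_def)
      qed
      ultimately have "?f T = 0" using closure_vanish T(1) by blast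
      then show ?thesis using qe[OF s] coord[OF s v] by (simp add: T(2) xi_def)
    qed
    then have "cellspace (co (\<theta> s)) = cellspace (co (?\<phi> s))" by (rule cellspace_cong)
    moreover have "\<theta> s \<in> X" "?\<phi> s \<in> X" using \<theta> \<phi> s by blast+
    ultimately show "\<theta> s = ?\<phi> s" using cell_eq_cellspace_coord by metis
  qed (use \<theta> \<phi> in blast)+
qed

lemma iota_cell: "s \<in> QC \<Longrightarrow> io s \<in> X"
  by (simp add: iota_eq cellspace_cell[OF dd])

lemma coord_iota: "s \<in> QC \<Longrightarrow> v \<in> IW \<Longrightarrow> co (io s) v = xi s v"
  by (simp add: iota_eq cell_coord_cellspace)

lemma psi_QC: "psi x \<in> QC"
  by (simp add: quotient_critical_set_eq)

lemma iota_psi: "Y \<in> X \<Longrightarrow> io (psi (co Y)) = Y"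
  using cell_eq_cellspace_coord[of Y dd] cellspace_cong[of "xi (psi (co Y))" "co Y"] xi_psi
  by (simp add: iota_eq psi_QC)

lemma psi_coord_iota: "s \<in> QC \<Longrightarrow> psi (co (io s)) = s"
  using psi_cong[of "co (io s)" "xi s"] coord_iota psi_xi by simp

lemma pullback_poly_function:
  assumes "q \<in> mpolys_homogeneous IW w k" "\<And>v. v \<in> IW \<Longrightarrow> (\<lambda>s. xi s v) \<in> polyfuns QC (\<lambda>s. s) IC w (w v)"
  shows "iota_pullback dd N lam (\<lambda>Y\<in>X. mpoly_eval q (co Y)) \<in> poly_functions QC (\<lambda>s. s) (mpolys_homogeneous IC w k)"
proof -
  interpret graded_functions QC "polyfuns QC (\<lambda>s. s) IC w" by (rule graded_functions_polyfuns)
  have q: "q \<in> mpolys IW" using assms(1) by (simp add: mpolys_homogeneous_def)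
  have "iota_pullback dd N lam (\<lambda>Y\<in>X. mpoly_eval q (co Y)) = (\<lambda>s\<in>QC. mpoly_eval q (xi s))"
    unfolding iota_pullback_def pullback_def
    by (rule restrict_ext) (simp add: iota_cell mpoly_eval_cong[OF q coord_iota])
  moreover have "(\<lambda>s. mpoly_eval q (xi s)) \<in> polyfuns QC (\<lambda>s. s) IC w k"
    by (rule mpoly_compose[OF assms])
  ultimately show ?thesis using poly_functions_restrict by metis
qed

text \<open>The preimage is obtained by composing with \<open>psi\<close>, which is inverse to
  \<open>iota\<close> and polynomial in the cell coordinates.\<close>

lemma pullback_preimage:
  assumes "p \<in> mpolys_homogeneous IC w k" "\<And>v. v \<in> IC \<Longrightarrow> (\<lambda>x. psi x v) \<in> polyfuns UNIV (\<lambda>x. x) IW w (w v)"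
  shows "(\<lambda>s\<in>QC. mpoly_eval p s) \<in> iota_pullback dd N lam ` poly_functions X co (mpolys_homogeneous IW w k)"
proof -
  interpret graded_functions UNIV "polyfuns UNIV (\<lambda>x. x) IW w" by (rule graded_functions_polyfuns)
  have "(\<lambda>x. mpoly_eval p (psi x)) \<in> polyfuns UNIV (\<lambda>x. x) IW w k" by (rule mpoly_compose[OF assms])
  then obtain q where q: "q \<in> mpolys_homogeneous IW w k" "\<And>x. mpoly_eval p (psi x) = mpoly_eval q x"
    by (auto simp: polyfuns_def)
  have "(\<lambda>s\<in>QC. mpoly_eval p s) = iota_pullback dd N lam (\<lambda>Y\<in>X. mpoly_eval q (co Y))"
    unfolding iota_pullback_def pullback_def
    by (rule restrict_ext) (simp add: iota_cell q(2)[symmetric] psi_coord_iota)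
  then show ?thesis using q(1) unfolding poly_functions_def by blast
qed

lemma xi_polyfun: "v \<in> IW \<Longrightarrow> (\<lambda>s. xi s v) \<in> polyfuns QC (\<lambda>s. s) IC snd (snd v)"
  by (rule xi_graded[OF graded_functions_polyfuns]) (auto intro: polyfuns_coord)

text \<open>The weight \<open>snd\<close> yields the graded components, the zero weight in degree 0
  the whole algebras.\<close>

lemma pullback_poly_functions:
  assumes "w = snd \<or> w = (\<lambda>_. 0)"
  shows "iota_pullback dd N lam ` poly_functions X co (mpolys_homogeneous IW w k)
    = poly_functions QC (\<lambda>s. s) (mpolys_homogeneous IC w k)"
proof
  have xi: "(\<lambda>s. xi s v) \<in> polyfuns QC (\<lambda>s. s) IC w (w v)" if "v \<in> IW" for v
    using assms xi_polyfun[OF that] polyfuns_ungrade[OF xi_polyfun[OF that]] by auto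
  have psi: "(\<lambda>x. psi x v) \<in> polyfuns UNIV (\<lambda>x. x) IW w (w v)" if "v \<in> IC" for v
    using assms psi_polyfun[OF that] polyfuns_ungrade[OF psi_polyfun[OF that]] by auto
  show "iota_pullback dd N lam ` poly_functions X co (mpolys_homogeneous IW w k)
    \<subseteq> poly_functions QC (\<lambda>s. s) (mpolys_homogeneous IC w k)"
    using pullback_poly_function[OF _ xi] by (auto simp: poly_functions_def[of X])
  show "poly_functions QC (\<lambda>s. s) (mpolys_homogeneous IC w k)
    \<subseteq> iota_pullback dd N lam ` poly_functions X co (mpolys_homogeneous IW w k)"
    using pullback_preimage[OF _ psi] by (auto simp: poly_functions_def[of QC])
qed

lemma pullback_carrier: "iota_pullback dd N lam ` carrier (O_W dd N lam) = carrier (O_C N lam)"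
  using pullback_poly_functions[of "\<lambda>_. 0" 0] by (simp add: carrier_O_W carrier_O_C mpolys_homogeneous_trivial)

lemma pullback_inj: "inj_on (iota_pullback dd N lam) (carrier (O_W dd N lam))"
proof (rule inj_onI)
  fix f f' assume f: "f \<in> carrier (O_W dd N lam)" "f' \<in> carrier (O_W dd N lam)"
    and eq: "iota_pullback dd N lam f = iota_pullback dd N lam f'"
  have ext: "f \<in> extensional X" "f' \<in> extensional X"
    using f by (auto simp: carrier_O_W poly_functions_def)
  show "f = f'"
  proof (rule extensionalityI[OF ext])
    fix Y assume Y: "Y \<in> X"
    have "f (io (psi (co Y))) = f' (io (psi (co Y)))"
      using fun_cong[OF eq, of "psi (co Y)"] by (simp add: iota_pullback_def pullback_def psi_QC)
    then show "f Y = f' Y" by (simp add: iota_psi[OF Y])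
  qed
qed

lemma pullback_iso:
  "graded_algebra_iso (O_W dd N lam) (O_W_degree dd N lam) (O_C N lam) (O_C_degree N lam) (iota_pullback dd N lam)"
  unfolding graded_algebra_iso_def
proof (intro conjI allI ballI)
  let ?\<phi> = "iota_pullback dd N lam"
  have "?\<phi> \<in> Ring.ring_hom (O_W dd N lam) (O_C N lam)"
  proof (rule ring_hom_memI)
    fix f assume "f \<in> carrier (O_W dd N lam)"
    then show "?\<phi> f \<in> carrier (O_C N lam)" using pullback_carrier by blast
  qed (auto simp: O_W_def O_C_def function_algebra_def iota_pullback_def pullback_def iota_cell cong: restrict_cong)
  moreover have "bij_betw ?\<phi> (carrier (O_W dd N lam)) (carrier (O_C N lam))"
    using pullback_inj pullback_carrier by (simp add: bij_betw_def)
  ultimately show "?\<phi> \<in> ring_iso (O_W dd N lam) (O_C N lam)" by (simp add: ring_iso_def)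
  show "?\<phi> (a \<odot>\<^bsub>O_W dd N lam\<^esub> f) = a \<odot>\<^bsub>O_C N lam\<^esub> ?\<phi> f" for a f
    by (auto simp: O_W_def O_C_def function_algebra_def iota_pullback_def pullback_def iota_cell cong: restrict_cong)
  show "?\<phi> ` O_W_degree dd N lam k = O_C_degree N lam k" for k
    unfolding O_W_degree_def O_C_degree_def by (rule pullback_poly_functions) simp
qed

lemma B_W_eq: "B_W dd N lam i j = (\<lambda>Y\<in>X. B (psi (co Y)) i j)"
  unfolding B_W_def
proof (rule restrict_ext)
  fix Y assume "Y \<in> X"
  then show "fls_nth (poly.coeff (D_W N lam Y) (N - i)) (int j) = B (psi (co Y)) i j"
    using D_W_cellspace[of "co Y"] cell_eq_cellspace_coord[of Y dd] by simp
qed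

text \<open>The lift chosen by \<open>inv_into\<close> may lie outside the critical closure, but by
  \<open>D_T_eq\<close> the operator depends only on the quotient point.\<close>

lemma B_C_eq: "B_C N lam i j = (\<lambda>s\<in>QC. B s i j)"
  unfolding B_C_def
proof (rule restrict_ext)
  fix s assume "s \<in> QC"
  then have "s \<in> affine_points IC" unfolding quotient_critical_set_eq using psi_affine by blast
  then have "s \<in> quotient_map N lam ` affine_points IC" using quotient_map_surj by blast
  then have "quotient_map N lam (inv_into (affine_points IC) (quotient_map N lam) s) = s"
    by (rule f_inv_into_f)
  then show "B_T N lam i j (inv_into (affine_points IC) (quotient_map N lam) s) = B s i j"
    by (simp add: B_T_def D_T_eq)
qed

lemma B_W_carrier:
  assumes "i \<in> {1..N}" "i \<le> j" shows "B_W dd N lam i j \<in> carrier (O_W dd N lam)"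
proof -
  let ?H = "\<lambda>_. polyfuns UNIV (\<lambda>x. x) IW (\<lambda>_. 0) 0"
  have gf: "graded_functions UNIV ?H" by (rule graded_functions_ungrade[OF graded_functions_polyfuns])
  have "(\<lambda>x. B (psi x) i (i + (j - i))) \<in> ?H (j - i)"
    by (rule B_graded[OF gf]) (use assms polyfuns_ungrade[OF psi_polyfun] in auto)
  then obtain q where q: "q \<in> mpolys IW" "\<And>x. B (psi x) i j = mpoly_eval q x"
    using assms(2) by (auto simp: polyfuns_def mpolys_homogeneous_trivial)
  then show ?thesis unfolding B_W_eq carrier_O_W poly_functions_def by auto
qed

lemma pullback_B_W: "iota_pullback dd N lam (B_W dd N lam i j) = B_C N lam i j"
  unfolding B_C_eq iota_pullback_def pullback_def
  by (rule restrict_ext) (simp add: B_W_eq iota_cell psi_coord_iota)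

text \<open>The inversion of \<open>psi\<close> is run with values in the generated subalgebra: it
  contains the \<open>B_ij\<close>, hence by \<open>coords_graded\<close> the functions
  \<open>xi s v\<close>, hence by \<open>psi_graded\<close> the coordinates of \<open>s\<close>
  themselves.\<close>

lemma subalgebra_generated_B_C:
  "subalgebra_generated (O_C N lam) {B_C N lam i j | i j. i \<in> {1..N} \<and> i \<le> j} = carrier (O_C N lam)"
proof
  let ?G = "{a \<odot>\<^bsub>O_C N lam\<^esub> \<one>\<^bsub>O_C N lam\<^esub> | a. True} \<union> {B_C N lam i j | i j. i \<in> {1..N} \<and> i \<le> j}"
  have const_eq: "a \<odot>\<^bsub>O_C N lam\<^esub> \<one>\<^bsub>O_C N lam\<^esub> = (\<lambda>s\<in>QC. a)" for a
    by (auto simp: O_C_def function_algebra_def cong: restrict_cong)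
  interpret ring "O_C N lam" unfolding O_C_def by (rule ring_poly_functions)
  have BC: "B_C N lam i j \<in> carrier (O_C N lam)" if "i \<in> {1..N}" "i \<le> j" for i j
    using imageI[OF B_W_carrier[OF that], of "iota_pullback dd N lam"]
    unfolding pullback_carrier pullback_B_W .
  have cC: "(\<lambda>s\<in>QC. a) \<in> carrier (O_C N lam)" for a
    unfolding carrier_O_C poly_functions_mpolys
    by (rule image_eqI[OF _ graded_functions.const[OF graded_functions_polyfuns, of a]]) simp
  have "?G \<subseteq> carrier (O_C N lam)"
  proof (rule Un_least; rule subsetI; elim CollectE exE conjE)
    show "f \<in> carrier (O_C N lam)" if "f = a \<odot>\<^bsub>O_C N lam\<^esub> \<one>\<^bsub>O_C N lam\<^esub>" for f a
      unfolding that const_eq by (rule cC)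
    show "f \<in> carrier (O_C N lam)" if "f = B_C N lam i j" "i \<in> {1..N}" "i \<le> j" for f i j
      unfolding that(1) by (rule BC[OF that(2,3)])
  qed
  then show "subalgebra_generated (O_C N lam) {B_C N lam i j | i j. i \<in> {1..N} \<and> i \<le> j} \<subseteq> carrier (O_C N lam)"
    unfolding subalgebra_generated_def by (rule generate_ring_incl)
  let ?A = "generate_ring (O_C N lam) ?G"
  \<comment> \<open>The same space in every degree: functions whose restriction lies in the
    generated subalgebra.\<close>
  let ?H = "\<lambda>_ :: nat. {f. restrict f QC \<in> ?A}"
  have gf: "graded_functions QC ?H"
  proof
    have c: "(\<lambda>s\<in>QC. a) \<in> ?A" for a
      by (rule generate_ring.incl, rule UnI1, rule CollectI, rule exI[of _ a]) (simp only: const_eq simp_thms)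
    then show "(\<lambda>_. a) \<in> ?H 0" "(\<lambda>_. 0) \<in> ?H k" for a k by auto
    fix f g :: "(nat \<times> nat \<Rightarrow> complex) \<Rightarrow> complex" and j k :: nat
    assume f: "f \<in> ?H j"
    show "(\<lambda>p. f p + g p) \<in> ?H j" if g: "g \<in> ?H j"
    proof -
      have "restrict f QC \<oplus>\<^bsub>O_C N lam\<^esub> restrict g QC \<in> ?A" using f g by (intro generate_ring.eng_add) auto
      then show ?thesis by (auto simp: O_C_def function_algebra_def cong: restrict_cong)
    qed
    show "(\<lambda>p. f p * g p) \<in> ?H (j + k)" if g: "g \<in> ?H k"
    proof -
      have "restrict f QC \<otimes>\<^bsub>O_C N lam\<^esub> restrict g QC \<in> ?A" using f g by (intro generate_ring.eng_mult) auto
      then show ?thesis by (auto simp: O_C_def function_algebra_def cong: restrict_cong)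
    qed
    show "g \<in> ?H j" if "\<And>p. p \<in> QC \<Longrightarrow> f p = g p"
    proof -
      have "restrict f QC = restrict g QC" by (rule restrict_ext) (rule that)
      then show ?thesis using f by simp
    qed
  qed
  have xi: "(\<lambda>s. xi s v) \<in> ?H (snd v)" if v: "v \<in> IW" for v
  proof (rule coords_graded[OF gf _ _ v, where s = "\<lambda>s. s" and x = xi])
    fix i k assume i: "i \<in> {1..N}"
    have "B_C N lam i (i + k) \<in> ?A" 
      by (rule generate_ring.incl, rule UnI2, rule CollectI, rule exI[of _ i], rule exI[of _ "i + k"]) (use i in simp)
    then show "(\<lambda>s. B s i (i + k)) \<in> ?H k" by (simp add: B_C_eq)
  next
    fix s i assume "s \<in> QC" "i \<in> {1..N}"
    then show "diffop_apply (PD s N) (poly_at_inf (fpoly (xi s) i)) = 0"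
      using g_kill_iff[of "PD (psi (xi s)) N" "xi s"] PD_psi_kills[of _ "xi s"] psi_xi[of s] by simp
  qed
  interpret H: graded_functions QC ?H by (rule gf)
  have s: "(\<lambda>s. s v) \<in> ?H 0" if v: "v \<in> IC" for v
  proof (rule H.cong[OF psi_graded[OF gf xi v]])
    fix p assume "p \<in> QC"
    then show "psi (xi p) v = p v" by (simp only: psi_xi)
  qed
  show "carrier (O_C N lam) \<subseteq> subalgebra_generated (O_C N lam) {B_C N lam i j | i j. i \<in> {1..N} \<and> i \<le> j}"
  proof
    fix f assume "f \<in> carrier (O_C N lam)"
    then obtain q where q: "q \<in> mpolys IC" "f = (\<lambda>s\<in>QC. mpoly_eval q s)"
      by (auto simp: carrier_O_C poly_functions_def)
    have "(\<lambda>s. mpoly_eval q s) \<in> ?H 0"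
      by (rule H.mpoly_compose[of q IC "\<lambda>_. 0" 0]) (use q(1) s in \<open>simp_all add: mpolys_homogeneous_trivial\<close>)
    then show "f \<in> subalgebra_generated (O_C N lam) {B_C N lam i j | i j. i \<in> {1..N} \<and> i \<le> j}"
      unfolding subalgebra_generated_def q(2) by simp
  qed
qed

end

theorem corollary5p4:
  fixes N n d :: nat and lam :: "nat \<Rightarrow> nat"
  assumes "N > 0" and "n > 0"
    and "\<forall>i\<in>{1..<N}. lam (Suc i) \<le> lam i"
    and "(\<Sum>i = 1..N. lam i) = n"
    and "lam 1 + N \<le> d"
  shows "graded_algebra_iso (O_W d N lam) (O_W_degree d N lam) (O_C N lam) (O_C_degree N lam)
           (iota_pullback d N lam) \<and>
         (\<forall>i\<in>{1..N}. \<forall>j\<ge>i. B_W d N lam i j \<in> carrier (O_W d N lam) \<and>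
           iota_pullback d N lam (B_W d N lam i j) = B_C N lam i j) \<and>
         subalgebra_generated (O_C N lam) {B_C N lam i j | i j. i \<in> {1..N} \<and> i \<le> j}
           = carrier (O_C N lam)"
proof -
  interpret big_cell N lam d
    using assms by unfold_locales auto
  show ?thesis
    using pullback_iso B_W_carrier pullback_B_W subalgebra_generated_B_C by blast
qed

end
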